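(* Let $S=k[x_1,\dots,x_n]$ be a polynomial ring over a field $k$. If $M\subset S$ is a cogeneric monomial ideal, then the algebraic co-Scarf complex $F^{\Delta_M^{\mathbf a}}$ equals the minimal free resolution of $M$ over $S$. In particular, $M$ is minimally generated by the set of monomials $\{\mathbf x^{\mathbf D-\mathbf a_\sigma} : \sigma\text{ is a facet of }\Delta_M^{\mathbf a}\}$.
   Context: For $\mathbf b\in\mathbb N^n$ write $\mathbf x^{\mathbf b}=x_1^{b_1}\cdots x_n^{b_n}$ and $\mathfrak m^{\mathbf b}=\langle x_s^{b_s}: b_s\ge 1\rangle$; the ideals $\mathfrak m^{\mathbf b}$ are the irreducible monomial ideals. Every monomial ideal has a unique finite irredundant decomposition $M=\bigcap_{i=1}^r M_i$ into irreducible monomial ideals, the irreducible components of $M$. Cogeneric: $M$ is cogeneric if whenever two distinct irreducible components $M_i,M_j$ have a minimal generator in common, there is an irreducible component $M_l\subset M_i+M_j$ such that $M_l$ and $M_i+M_j$ do not have a minimal generator in common. Co-Scarf complex: choose an integer $D$ larger than any exponent on any minimal generator of $M$; let $\mathbf a=(D-1,\dots,D-1)$ and $\mathbf D=(D,\dots,D)$. For $M_i=\mathfrak m^{\mathbf b_i}$ let $m_i=\mathbf x^{\mathbf b_i^{\mathbf a}}$, where $(\mathbf b^{\mathbf a})_s=D-b_s$ if $b_s\ge1$ and $(\mathbf b^{\mathbf a})_s=0$ if $b_s=0$. The Alexander dual ideal $M^{\mathbf a}$ is minimally generated by $m_1,\dots,m_r$. Put $(M^{\mathbf a})^*=M^{\mathbf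 a}+\langle x_1^D,\dots,x_n^D\rangle$, and index the generator $x_s^D$ (when it is a minimal generator) by $x_s$. For a set $\sigma$ of indices of minimal generators of $(M^{\mathbf a})^*$, let $m_\sigma$ be the least common multiple of the generators indexed by $\sigma$ ($m_\emptyset=1$), and $\mathbf a_\sigma\in\mathbb N^n$ its exponent vector. The co-Scarf complex $\Delta_M^{\mathbf a}$ is the simplicial complex of all $\sigma$ with $m_\tau\neq m_\sigma$ for all $\tau\ne\sigma$; its vertex set is a subset of $\{1,\dots,r,x_1,\dots,x_n\}$, and it triangulates an $(n-1)$-simplex. A face $\sigma$ is an interior face if $m_\sigma$ has full support, i.e. is divisible by every $x_s$; the set of interior faces is denoted $\operatorname{int}(\Delta_M^{\mathbf a})$. Algebraic co-Scarf complex: $F^{\Delta_M^{\mathbf a}}=\bigoplus_{\sigma\in\operatorname{int}(\Delta_M^{\mathbf a})}S(\mathbf a_\sigma-\mathbf D)$, where $S(\mathbf a_\sigma-\mathbf D)$ is the free $S$-module with one generator $e^*_\sigma$ in multidegree $\mathbf D-\mathbf a_\sigma$, placed in homological degree $n-\#\sigma$, with differential $$d^*(e^*_\sigma)=\sum_{\substack{i\notin\sigma\\ \sigma\cup\{i\}\in\operatorname{int}(\Delta_M^{\mathbf a})}}\operatorname{sign}(i,\sigma\cup\{i\})\,\frac{m_{\sigma\cup\{i\}}}{m_\sigma}\,e^*_{\sigma\cup\{i\}},$$ where, for a fixed total order on the vertices, $\operatorname{sign}(i,\sigma\cup\{i\})=(-1)^{j+1}$ if $i$ is the $j$-th element of $\sigma\cup\{i\}$.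 *)

theory Defs
  imports Complex_Main "HOL-Library.Poly_Mapping" "HOL-Library.Function_Algebras"
begin

section \<open>Monomial ideals\<close>

text \<open>
  The variables are indexed by a type \<open>'v\<close> of class \<open>finite\<close>, and their number \<open>n\<close> is the
  cardinality of \<open>'v\<close>.  Exponent vectors are functions \<open>'v \<Rightarrow> nat\<close> with pointwise addition,
  subtraction and order, and the polynomial ring is the monoid algebra of these exponent vectors
  over \<open>'k\<close>.
\<close>

type_synonym 'v expo = "'v \<Rightarrow> nat"
type_synonym ('v, 'k) mpoly = "('v \<Rightarrow> nat) \<Rightarrow>\<^sub>0 'k"

definition monom :: "'v expo \<Rightarrow> ('v, 'k::comm_ring_1) mpoly" where
  "monom u = Poly_Mapping.single u 1"

definition var_pow :: "'v \<Rightarrow> nat \<Rightarrow> 'v expo" where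
  "var_pow s c = (\<lambda>t. if t = s then c else 0)"

abbreviation var :: "'v \<Rightarrow> ('v, 'k::comm_ring_1) mpoly" where
  "var s \<equiv> monom (var_pow s 1)"

abbreviation ideal_gen :: "('v, 'k::comm_ring_1) mpoly set \<Rightarrow> ('v, 'k) mpoly set" where
  "ideal_gen \<equiv> module.span (*)"

definition ideal_sum ::
  "('v, 'k::comm_ring_1) mpoly set \<Rightarrow> ('v, 'k) mpoly set \<Rightarrow> ('v, 'k) mpoly set" where
  "ideal_sum I J = {p + q | p q. p \<in> I \<and> q \<in> J}"

definition monomial_ideal :: "('v, 'k::comm_ring_1) mpoly set \<Rightarrow> bool" where
  "monomial_ideal M \<longleftrightarrow> (\<exists>U. M = ideal_gen (monom ` U))"

text \<open>Exponent vectors of the minimal generators of a monomial ideal, that is, of the monomials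
  in it that are minimal with respect to divisibility.\<close>

definition min_gens :: "('v, 'k::comm_ring_1) mpoly set \<Rightarrow> 'v expo set" where
  "min_gens M = {u. (monom u :: ('v, 'k) mpoly) \<in> M \<and>
     (\<forall>v. (monom v :: ('v, 'k) mpoly) \<in> M \<and> (monom v :: ('v, 'k) mpoly) dvd monom u \<longrightarrow> v = u)}"

definition minimally_generated_by ::
  "('v, 'k::comm_ring_1) mpoly set \<Rightarrow> ('v, 'k) mpoly set \<Rightarrow> bool" where
  "minimally_generated_by M G \<longleftrightarrow> ideal_gen G = M \<and> (\<forall>H. H \<subset> G \<longrightarrow> ideal_gen H \<noteq> M)"

definition irr_ideal :: "'v expo \<Rightarrow> ('v, 'k::comm_ring_1) mpoly set" where
  "irr_ideal b = ideal_gen {monom (var_pow s (b s)) | s. 1 \<le> b s}"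

text \<open>The irreducible components of \<open>M\<close> are \<open>irr_ideal (b i)\<close> for \<open>i = 1, \<dots>, r\<close>.  The empty
  intersection is the whole ring; irredundancy makes these ideals pairwise distinct.\<close>

definition irreducible_decomposition ::
  "('v, 'k::comm_ring_1) mpoly set \<Rightarrow> nat \<Rightarrow> (nat \<Rightarrow> 'v expo) \<Rightarrow> bool" where
  "irreducible_decomposition M r b \<longleftrightarrow>
     M = (\<Inter>i\<in>{1..r}. irr_ideal (b i)) \<and>
     (\<forall>i\<in>{1..r}. (\<Inter>j\<in>{1..r} - {i}. irr_ideal (b j)) \<noteq> M)"

text \<open>A monomial ideal has exactly one irredundant irreducible decomposition up to the order of
  the components, so the quantifier over \<open>r\<close> and \<open>b\<close> only gives the components names.\<close>

definition cogeneric :: "('v, 'k::comm_ring_1) mpoly set \<Rightarrow> bool" where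
  "cogeneric M \<longleftrightarrow> monomial_ideal M \<and>
     (\<exists>r b. irreducible_decomposition M r b \<and>
       (let Mi = (\<lambda>i. irr_ideal (b i) :: ('v, 'k) mpoly set) in
         \<forall>i\<in>{1..r}. \<forall>j\<in>{1..r}. Mi i \<noteq> Mi j \<and> min_gens (Mi i) \<inter> min_gens (Mi j) \<noteq> {} \<longrightarrow>
           (\<exists>l\<in>{1..r}. Mi l \<subseteq> ideal_sum (Mi i) (Mi j) \<and>
              min_gens (Mi l) \<inter> min_gens (ideal_sum (Mi i) (Mi j)) = {})))"

section \<open>The co-Scarf complex\<close>

definition dual_exp :: "nat \<Rightarrow> 'v expo \<Rightarrow> 'v expo" where
  "dual_exp D b = (\<lambda>s. if 1 \<le> b s then D - b s else 0)"

text \<open>The index \<open>Inl i\<close> stands for the generator \<open>m\<^sub>i\<close> of the Alexander dual, and \<open>Inr s\<close> for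
  the power of the variable \<open>s\<close> with exponent \<open>D\<close>.\<close>

fun gen_exp :: "nat \<Rightarrow> (nat \<Rightarrow> 'v expo) \<Rightarrow> nat + 'v \<Rightarrow> 'v expo" where
  "gen_exp D b (Inl i) = dual_exp D (b i)"
| "gen_exp D b (Inr s) = var_pow s D"

definition dual_star_ideal ::
  "nat \<Rightarrow> nat \<Rightarrow> (nat \<Rightarrow> 'v expo) \<Rightarrow> ('v, 'k::comm_ring_1) mpoly set" where
  "dual_star_ideal D r b = ideal_gen (monom ` gen_exp D b ` (Inl ` {1..r} \<union> range Inr))"

text \<open>The type argument only fixes the coefficient ring of the ideal whose minimal generators are
  taken.\<close>

definition gen_indices ::
  "'k::comm_ring_1 itself \<Rightarrow> nat \<Rightarrow> nat \<Rightarrow> (nat \<Rightarrow> 'v expo) \<Rightarrow> (nat + 'v) set" where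
  "gen_indices K D r b = {v \<in> Inl ` {1..r} \<union> range Inr.
     gen_exp D b v \<in> min_gens (dual_star_ideal D r b :: ('v, 'k) mpoly set)}"

text \<open>The exponent vector of the least common multiple \<open>m\<^sub>\<sigma>\<close>.\<close>

definition lcm_exp :: "nat \<Rightarrow> (nat \<Rightarrow> 'v expo) \<Rightarrow> (nat + 'v) set \<Rightarrow> 'v expo" where
  "lcm_exp D b \<sigma> = (\<lambda>s. Max (insert 0 ((\<lambda>v. gen_exp D b v s) ` \<sigma>)))"

definition co_scarf ::
  "'k::comm_ring_1 itself \<Rightarrow> nat \<Rightarrow> nat \<Rightarrow> (nat \<Rightarrow> 'v expo) \<Rightarrow> (nat + 'v) set set" where
  "co_scarf K D r b = {\<sigma>. \<sigma> \<subseteq> gen_indices K D r b \<and>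
     (\<forall>\<tau>. \<tau> \<subseteq> gen_indices K D r b \<and> \<tau> \<noteq> \<sigma> \<longrightarrow> lcm_exp D b \<tau> \<noteq> lcm_exp D b \<sigma>)}"

definition interior_faces ::
  "'k::comm_ring_1 itself \<Rightarrow> nat \<Rightarrow> nat \<Rightarrow> (nat \<Rightarrow> 'v expo) \<Rightarrow> (nat + 'v) set set" where
  "interior_faces K D r b = {\<sigma> \<in> co_scarf K D r b.
     \<forall>s. (var s :: ('v, 'k) mpoly) dvd monom (lcm_exp D b \<sigma>)}"

definition facets :: "'a set set \<Rightarrow> 'a set set" where
  "facets \<Delta> = {\<sigma> \<in> \<Delta>. \<forall>\<tau>\<in>\<Delta>. \<not> \<sigma> \<subset> \<tau>}"

section \<open>Multigraded complexes of free modules\<close>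

text \<open>
  A multigraded complex of free modules with chosen homogeneous bases.  The module is the set of
  finitely supported functions on \<open>fc_basis\<close> with values in the polynomial ring; the basis element
  \<open>\<beta>\<close> sits in homological degree \<open>fc_hdeg \<beta>\<close> and in multidegree \<open>fc_mdeg \<beta>\<close>, and \<open>fc_diff \<beta>\<close>
  is its image under the differential.
\<close>

record (overloaded) ('v, 'k, 'b) free_complex =
  fc_basis :: "'b set"
  fc_hdeg :: "'b \<Rightarrow> int"
  fc_mdeg :: "'b \<Rightarrow> 'v \<Rightarrow> nat"
  fc_diff :: "'b \<Rightarrow> 'b \<Rightarrow>\<^sub>0 (('v \<Rightarrow> nat) \<Rightarrow>\<^sub>0 'k)"

definition smult :: "'a::comm_ring_1 \<Rightarrow> ('b \<Rightarrow>\<^sub>0 'a) \<Rightarrow> ('b \<Rightarrow>\<^sub>0 'a)" where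
  "smult p f = Poly_Mapping.map ((*) p) f"

definition chains :: "('v, 'k::comm_ring_1, 'b) free_complex \<Rightarrow> int \<Rightarrow> ('b \<Rightarrow>\<^sub>0 ('v, 'k) mpoly) set" where
  "chains F h = {f. Poly_Mapping.keys f \<subseteq> {\<beta> \<in> fc_basis F. fc_hdeg F \<beta> = h}}"

definition boundary_map ::
  "('v, 'k::comm_ring_1, 'b) free_complex \<Rightarrow> ('b \<Rightarrow>\<^sub>0 ('v, 'k) mpoly) \<Rightarrow> ('b \<Rightarrow>\<^sub>0 ('v, 'k) mpoly)" where
  "boundary_map F f = (\<Sum>\<beta>\<in>Poly_Mapping.keys f. smult (Poly_Mapping.lookup f \<beta>) (fc_diff F \<beta>))"

definition augmentation_map ::
  "('b \<Rightarrow> ('v, 'k::comm_ring_1) mpoly) \<Rightarrow> ('b \<Rightarrow>\<^sub>0 ('v, 'k) mpoly) \<Rightarrow> ('v, 'k) mpoly" where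
  "augmentation_map \<epsilon> f = (\<Sum>\<beta>\<in>Poly_Mapping.keys f. Poly_Mapping.lookup f \<beta> * \<epsilon> \<beta>)"

text \<open>The differential lowers the homological degree by one and preserves the multidegree.\<close>

definition multigraded_complex :: "('v, 'k::comm_ring_1, 'b) free_complex \<Rightarrow> bool" where
  "multigraded_complex F \<longleftrightarrow>
     (\<forall>\<beta>\<in>fc_basis F. fc_diff F \<beta> \<in> chains F (fc_hdeg F \<beta> - 1) \<and>
        boundary_map F (fc_diff F \<beta>) = 0 \<and>
        (\<forall>\<gamma>\<in>fc_basis F. \<forall>u\<in>Poly_Mapping.keys (Poly_Mapping.lookup (fc_diff F \<beta>) \<gamma>).
           u + fc_mdeg F \<gamma> = fc_mdeg F \<beta>))"

text \<open>\<open>F\<close> together with \<open>\<epsilon>\<close> is an exact sequence \<open>\<dots> \<rightarrow> F\<^sub>1 \<rightarrow> F\<^sub>0 \<rightarrow> M \<rightarrow> 0\<close> of multigraded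
  modules of finite rank.\<close>

definition free_resolution ::
  "('v, 'k::comm_ring_1, 'b) free_complex \<Rightarrow> ('b \<Rightarrow> ('v, 'k) mpoly) \<Rightarrow> ('v, 'k) mpoly set \<Rightarrow> bool" where
  "free_resolution F \<epsilon> M \<longleftrightarrow>
     multigraded_complex F \<and>
     (\<forall>\<beta>\<in>fc_basis F. 0 \<le> fc_hdeg F \<beta>) \<and>
     (\<forall>h. finite {\<beta> \<in> fc_basis F. fc_hdeg F \<beta> = h}) \<and>
     (\<forall>\<beta>\<in>fc_basis F. fc_hdeg F \<beta> = 0 \<longrightarrow> Poly_Mapping.keys (\<epsilon> \<beta>) \<subseteq> {fc_mdeg F \<beta>}) \<and>
     augmentation_map \<epsilon> ` chains F 0 = M \<and>
     {f \<in> chains F 0. augmentation_map \<epsilon> f = 0} = boundary_map F ` chains F 1 \<and>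
     (\<forall>h>0. {f \<in> chains F h. boundary_map F f = 0} = boundary_map F ` chains F (h + 1))"

text \<open>A resolution is minimal if the differential maps \<open>F\<close> into \<open>\<mm> F\<close>, where \<open>\<mm>\<close> is the ideal
  generated by the variables.\<close>

definition minimal_complex :: "('v, 'k::comm_ring_1, 'b) free_complex \<Rightarrow> bool" where
  "minimal_complex F \<longleftrightarrow>
     (\<forall>\<beta>\<in>fc_basis F. \<forall>\<gamma>. Poly_Mapping.lookup (fc_diff F \<beta>) \<gamma> \<in> ideal_gen (range var))"

text \<open>The minimal free resolution is unique up to isomorphism.  A complex is one if it becomes a
  minimal resolution of \<open>M\<close> with a suitable augmentation from \<open>F\<^sub>0\<close> onto \<open>M\<close>.\<close>

definition minimal_free_resolution ::
  "('v, 'k::comm_ring_1, 'b) free_complex \<Rightarrow> ('v, 'k) mpoly set \<Rightarrow> bool" where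
  "minimal_free_resolution F M \<longleftrightarrow> minimal_complex F \<and> (\<exists>\<epsilon>. free_resolution F \<epsilon> M)"

section \<open>The algebraic co-Scarf complex\<close>

text \<open>\<open>R\<close> is a reflexive linear order, so the cardinality is the position of \<open>v\<close> in \<open>\<sigma>\<close>.\<close>

definition face_sign :: "'a rel \<Rightarrow> 'a \<Rightarrow> 'a set \<Rightarrow> 'c::comm_ring_1" where
  "face_sign R v \<sigma> = (- 1) ^ (card {w \<in> \<sigma>. (w, v) \<in> R} + 1)"

text \<open>The natural number subtractions are exact: \<open>m\<^sub>\<sigma>\<close> divides the least common multiple for a
  larger face, and no exponent of \<open>m\<^sub>\<sigma>\<close> exceeds \<open>D\<close>.  The homological degree is an integer, hence
  not truncated.\<close>

definition co_scarf_diff ::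
  "nat \<Rightarrow> nat \<Rightarrow> (nat \<Rightarrow> 'v expo) \<Rightarrow> (nat + 'v) rel \<Rightarrow> (nat + 'v) set \<Rightarrow>
     ((nat + 'v) set \<Rightarrow>\<^sub>0 ('v, 'k::comm_ring_1) mpoly)" where
  "co_scarf_diff D r b R \<sigma> =
     (\<Sum>i\<in>{i. i \<notin> \<sigma> \<and> insert i \<sigma> \<in> interior_faces TYPE('k) D r b}.
        Poly_Mapping.single (insert i \<sigma>)
          (face_sign R i (insert i \<sigma>) * monom (lcm_exp D b (insert i \<sigma>) - lcm_exp D b \<sigma>)))"

definition algebraic_co_scarf ::
  "nat \<Rightarrow> nat \<Rightarrow> (nat \<Rightarrow> ('v::finite) expo) \<Rightarrow> (nat + 'v) rel \<Rightarrow>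
     ('v, 'k::comm_ring_1, (nat + 'v) set) free_complex" where
  "algebraic_co_scarf D r b R =
     \<lparr>fc_basis = interior_faces TYPE('k) D r b,
      fc_hdeg = (\<lambda>\<sigma>. int (card (UNIV :: 'v set)) - int (card \<sigma>)),
      fc_mdeg = (\<lambda>\<sigma> s. D - lcm_exp D b \<sigma> s),
      fc_diff = co_scarf_diff D r b R\<rparr>"

end

theory Submission
  imports Defs "HOL-Library.Cardinality"
begin

text \<open>
  In a fixed multidegree \<open>c\<close>, the complex is the cochain complex of the interior faces of the co-Scarf
  complex whose label lies strictly above an exponent vector \<open>w\<close>, and by Alexander duality
  \<open>x\<^sup>c \<in> M\<close> iff \<open>x\<^sup>w\<close> lies outside the dual ideal.  This is a quotient of the cochain complex of all
  sets of generators with label above \<open>w\<close>.  The kernel is acyclic: by genericity, the label of a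
  full-support set outside the Scarf complex is strictly divided by some generator \<open>i\<close>, and
  inserting or removing \<open>i\<close> does not change the label.  For \<open>x\<^sup>w\<close> outside the dual ideal, the sets
  with label above \<open>w\<close> can be cancelled in pairs by inserting or removing the pure powers one after
  the other, and only the set of all \<open>n\<close> pure powers survives.  So the cohomology is
  one-dimensional and sits in the top degree, where the class of a facet is its orientation; this
  defines the augmentation.  The minimal generators are then read off from the minimality of the
  resolution.
\<close>

section \<open>Monomial ideals and irreducible decompositions\<close>

text \<open>The obstacle is the augmentation: homological degree zero has one generator per facet,
  and the map onto \<open>M\<close> needs coherent signs for them. No geometric orientation is
  chosen. A top-degree cochain on interior faces lifts to a genuine cocycle on all sets with label
  above \<open>w\<close>, and the lift is unique up to a cocycle of the acyclic kernel. The set of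
  pure powers has no codimension-one face above \<open>w\<close>, so coboundaries vanish there, and
  the value of the lift at this set depends only on the cohomology class. This value for the
  indicator of a facet is its sign. One lift, chosen for the largest admissible \<open>w\<close>,
  serves all multidegrees.

  That facets have \<open>n\<close> elements is not taken from the triangulation. Genericity shows
  that a facet has full support; then its differential is zero, and in a minimal resolution this is
  possible only in degree zero.\<close>

lemma module_times: "module ((*) :: 'a::comm_ring_1 \<Rightarrow> 'a \<Rightarrow> 'a)"
  by unfold_locales (simp_all add: algebra_simps)

lemma le_imp_add_diff: "u \<le> v \<Longrightarrow> (v - u) + u = v" for u v :: "'v expo"
  by (auto simp: le_fun_def fun_eq_iff)

lemma keys_monom: "Poly_Mapping.keys (monom u :: ('v, 'k::comm_ring_1) mpoly) = {u}"
  by (simp add: monom_def)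

lemma sum_single_lookup:
  "(\<Sum>v\<in>Poly_Mapping.keys p. Poly_Mapping.single v (Poly_Mapping.lookup p v)) = p"
  by (rule poly_mapping_eqI)
    (auto simp: lookup_sum lookup_single when_def in_keys_iff)

lemma lookup_single_times:
  fixes p :: "('v, 'k::comm_ring_1) mpoly"
  shows "Poly_Mapping.lookup (Poly_Mapping.single u a * p) e =
    (if u \<le> e then a * Poly_Mapping.lookup p (e - u) else 0)"
proof -
  have "Poly_Mapping.lookup (Poly_Mapping.single u a * Poly_Mapping.single v c) e =
      (if u \<le> e then a * Poly_Mapping.lookup (Poly_Mapping.single v c) (e - u) else 0)" for v c
  proof -
    have "u + v = e \<longleftrightarrow> u \<le> e \<and> v = e - u"
      by (auto simp: le_fun_def fun_eq_iff) (metis le_add1 diff_add_inverse)+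
    then show ?thesis
      by (auto simp: mult_single lookup_single when_def)
  qed
  then have "Poly_Mapping.lookup (Poly_Mapping.single u a *
        (\<Sum>v\<in>Poly_Mapping.keys p. Poly_Mapping.single v (Poly_Mapping.lookup p v))) e =
      (if u \<le> e then a * Poly_Mapping.lookup
        (\<Sum>v\<in>Poly_Mapping.keys p. Poly_Mapping.single v (Poly_Mapping.lookup p v)) (e - u) else 0)"
    by (simp add: sum_distrib_left lookup_sum)
  then show ?thesis
    by (simp only: sum_single_lookup)
qed

text \<open>The polynomials all of whose exponents lie above \<open>U\<close> form a submodule, and
  each term of such a polynomial is a multiple of a generator. From here on ideals are handled
  through exponent vectors.\<close>

lemma mem_ideal_gen_monom_iff:
  fixes p :: "('v, 'k::comm_ring_1) mpoly"
  shows "p \<in> ideal_gen (monom ` U) \<longleftrightarrow> (\<forall>e\<in>Poly_Mapping.keys p. \<exists>u\<in>U. u \<le> e)"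
proof
  assume "p \<in> ideal_gen (monom ` U)"
  then show "\<forall>e\<in>Poly_Mapping.keys p. \<exists>u\<in>U. u \<le> e"
  proof (rule module.span_induct[OF module_times])
    show "module.subspace (*) (Collect (\<lambda>x :: ('v, 'k) mpoly. \<forall>e\<in>Poly_Mapping.keys x. \<exists>u\<in>U. u \<le> e))"
    proof (rule module.subspaceI[OF module_times])
      fix x y :: "('v, 'k) mpoly"
      assume "x \<in> {x. \<forall>e\<in>Poly_Mapping.keys x. \<exists>u\<in>U. u \<le> e}"
        "y \<in> {x. \<forall>e\<in>Poly_Mapping.keys x. \<exists>u\<in>U. u \<le> e}"
      then show "x + y \<in> {x. \<forall>e\<in>Poly_Mapping.keys x. \<exists>u\<in>U. u \<le> e}"
        using Poly_Mapping.keys_add[of x y] by blast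
    next
      fix c x :: "('v, 'k) mpoly"
      assume x: "x \<in> {x. \<forall>e\<in>Poly_Mapping.keys x. \<exists>u\<in>U. u \<le> e}"
      {
        fix e assume "e \<in> Poly_Mapping.keys (c * x)"
        then obtain a b' where "e = a + b'" "b' \<in> Poly_Mapping.keys x"
          using keys_mult[of c x] by blast
        moreover obtain u where "u \<in> U" "u \<le> b'"
          using x calculation by blast
        ultimately have "\<exists>u\<in>U. u \<le> e"
          by (auto simp: le_fun_def intro!: bexI[of _ u] trans_le_add2)
      }
      then show "c * x \<in> {x. \<forall>e\<in>Poly_Mapping.keys x. \<exists>u\<in>U. u \<le> e}"
        by blast
    qed simp
  next
    fix x :: "('v, 'k) mpoly" assume "x \<in> monom ` U"
    then show "\<forall>e\<in>Poly_Mapping.keys x. \<exists>u\<in>U. u \<le> e"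
      by (auto simp: keys_monom)
  qed
next
  assume *: "\<forall>e\<in>Poly_Mapping.keys p. \<exists>u\<in>U. u \<le> e"
  have "(\<Sum>e\<in>Poly_Mapping.keys p. Poly_Mapping.single e (Poly_Mapping.lookup p e))
      \<in> ideal_gen (monom ` U)"
  proof (rule module.span_sum[OF module_times])
    fix e assume "e \<in> Poly_Mapping.keys p"
    then obtain u where u: "u \<in> U" "u \<le> e"
      using * by blast
    have "Poly_Mapping.single e (Poly_Mapping.lookup p e)
        = Poly_Mapping.single (e - u) (Poly_Mapping.lookup p e) * monom u"
      using u(2) by (simp add: monom_def mult_single le_imp_add_diff)
    also have "\<dots> \<in> ideal_gen (monom ` U)"
      by (intro module.span_scale[OF module_times] module.span_base[OF module_times] imageI u(1))
    finally show "Poly_Mapping.single e (Poly_Mapping.lookup p e) \<in> ideal_gen (monom ` U)" .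
  qed
  then show "p \<in> ideal_gen (monom ` U)"
    by (simp only: sum_single_lookup)
qed

lemma monom_mem_ideal_gen_iff:
  "(monom v :: ('v, 'k::comm_ring_1) mpoly) \<in> ideal_gen (monom ` U) \<longleftrightarrow> (\<exists>u\<in>U. u \<le> v)"
  by (simp add: mem_ideal_gen_monom_iff keys_monom)

lemma monom_dvd_monom_iff:
  "(monom u :: ('v, 'k::comm_ring_1) mpoly) dvd monom v \<longleftrightarrow> u \<le> v"
proof
  assume "(monom u :: ('v, 'k) mpoly) dvd monom v"
  then obtain p where p: "monom v = monom u * (p :: ('v, 'k) mpoly)"
    by (elim dvdE)
  show "u \<le> v"
  proof (rule ccontr)
    assume "\<not> u \<le> v"
    then have "Poly_Mapping.lookup (monom u * p) v = 0"
      by (simp add: monom_def lookup_single_times)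
    then have "Poly_Mapping.lookup (monom v :: ('v, 'k) mpoly) v = 0"
      by (subst p)
    then show False
      by (simp add: monom_def)
  qed
next
  assume "u \<le> v"
  then have "(monom v :: ('v, 'k) mpoly) = monom u * monom (v - u)"
    by (simp add: monom_def mult_single le_imp_add_diff add.commute[of u])
  then show "(monom u :: ('v, 'k) mpoly) dvd monom v"
    by (rule dvdI)
qed

lemma min_gens_ideal_gen_monom:
  "min_gens (ideal_gen (monom ` U) :: ('v, 'k::comm_ring_1) mpoly set) =
    {u \<in> U. \<forall>v\<in>U. v \<le> u \<longrightarrow> v = u}"
  unfolding min_gens_def monom_mem_ideal_gen_iff monom_dvd_monom_iff
  by auto

text \<open>\<open>U\<close> may be infinite, but \<open>'v\<close> is finite, so only finitely many
  exponent vectors lie below \<open>u\<close>.\<close>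

lemma ex_minimal_expo_le:
  fixes u :: "'v::finite expo"
  assumes "u \<in> U"
  obtains v where "v \<in> U" "v \<le> u" "\<And>v'. v' \<in> U \<Longrightarrow> v' \<le> v \<Longrightarrow> v' = v"
proof -
  have u_le: "u s \<le> Max (range u)" for s
    by (rule Max_ge) auto
  have "finite {v :: 'v expo. \<forall>s. (s \<in> UNIV \<longrightarrow> v s \<in> {..Max (range u)}) \<and> (s \<notin> UNIV \<longrightarrow> v s = 0)}"
    by (rule finite_set_of_finite_funs) auto
  then have fin: "finite {v \<in> U. v \<le> u}"
    by (rule finite_subset[rotated]) (use u_le in \<open>auto simp: le_fun_def intro: order.trans\<close>)
  from finite_has_minimal2[OF fin, of u] assms obtain v where
    v: "v \<in> {v \<in> U. v \<le> u}" "\<And>v'. v' \<in> {v \<in> U. v \<le> u} \<Longrightarrow> v' \<le> v \<Longrightarrow> v = v'"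
    by blast
  then show ?thesis
    by (intro that[of v]) (auto intro: order.trans)
qed

lemma ex_min_gens_le:
  fixes M :: "('v::finite, 'k::comm_ring_1) mpoly set"
  assumes "(monom u :: ('v, 'k) mpoly) \<in> M"
  obtains v where "v \<in> min_gens M" "v \<le> u"
proof -
  obtain v where "v \<in> {v. (monom v :: ('v, 'k) mpoly) \<in> M}" "v \<le> u"
    "\<And>v'. v' \<in> {v. (monom v :: ('v, 'k) mpoly) \<in> M} \<Longrightarrow> v' \<le> v \<Longrightarrow> v' = v"
    by (rule ex_minimal_expo_le[of u "{v. (monom v :: ('v, 'k) mpoly) \<in> M}"]) (use assms in auto)
  then show ?thesis
    using that by (auto simp: min_gens_def monom_dvd_monom_iff)
qed

lemma var_pow_le_iff: "var_pow s c \<le> u \<longleftrightarrow> c \<le> u s"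
  by (auto simp: var_pow_def le_fun_def)

lemma irr_ideal_eq: "irr_ideal b = ideal_gen (monom ` {var_pow s (b s) | s. 1 \<le> b s})"
  unfolding irr_ideal_def by (rule arg_cong[of _ _ ideal_gen]) blast

lemma mem_irr_ideal_iff:
  "p \<in> irr_ideal b \<longleftrightarrow> (\<forall>e\<in>Poly_Mapping.keys p. \<exists>s. 1 \<le> b s \<and> b s \<le> e s)"
  unfolding irr_ideal_eq mem_ideal_gen_monom_iff by (simp add: var_pow_le_iff) (metis var_pow_le_iff)

lemma monom_mem_irr_ideal_iff:
  "(monom u :: ('v, 'k::comm_ring_1) mpoly) \<in> irr_ideal b \<longleftrightarrow> (\<exists>s. 1 \<le> b s \<and> b s \<le> u s)"
  by (simp add: mem_irr_ideal_iff keys_monom)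

lemma min_gens_irr_ideal:
  "min_gens (irr_ideal b :: ('v, 'k::comm_ring_1) mpoly set) = {var_pow s (b s) | s. 1 \<le> b s}"
proof -
  have "t = s" if "Suc 0 \<le> b t" "b t \<le> var_pow s (b s) t" for s t
    using that by (auto simp: var_pow_def split: if_splits)
  then show ?thesis
    unfolding irr_ideal_eq min_gens_ideal_gen_monom by (auto simp: var_pow_le_iff) blast
qed

lemma irr_ideal_subset_iff:
  "(irr_ideal b :: ('v, 'k::comm_ring_1) mpoly set) \<subseteq> irr_ideal c \<longleftrightarrow>
    (\<forall>s. 1 \<le> b s \<longrightarrow> 1 \<le> c s \<and> c s \<le> b s)"
proof
  assume sub: "(irr_ideal b :: ('v, 'k) mpoly set) \<subseteq> irr_ideal c"
  show "\<forall>s. 1 \<le> b s \<longrightarrow> 1 \<le> c s \<and> c s \<le> b s"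
  proof (intro allI impI)
    fix s assume s: "1 \<le> b s"
    then have "(monom (var_pow s (b s)) :: ('v, 'k) mpoly) \<in> irr_ideal b"
      by (auto simp: monom_mem_irr_ideal_iff var_pow_def)
    then have "(monom (var_pow s (b s)) :: ('v, 'k) mpoly) \<in> irr_ideal c"
      using sub by blast
    then show "1 \<le> c s \<and> c s \<le> b s"
      by (auto simp: monom_mem_irr_ideal_iff var_pow_def split: if_splits)
  qed
next
  assume "\<forall>s. 1 \<le> b s \<longrightarrow> 1 \<le> c s \<and> c s \<le> b s"
  then show "(irr_ideal b :: ('v, 'k) mpoly set) \<subseteq> irr_ideal c"
    by (auto simp: mem_irr_ideal_iff) (meson order.trans)
qed

lemma irr_ideal_eq_iff:
  "(irr_ideal b :: ('v, 'k::comm_ring_1) mpoly set) = irr_ideal c \<longleftrightarrow> b = c"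
proof
  assume eq: "(irr_ideal b :: ('v, 'k) mpoly set) = irr_ideal c"
  have "b s = c s" for s
  proof -
    have "1 \<le> b s \<longrightarrow> 1 \<le> c s \<and> c s \<le> b s" "1 \<le> c s \<longrightarrow> 1 \<le> b s \<and> b s \<le> c s"
      using irr_ideal_subset_iff[of b c, where 'k = 'k] irr_ideal_subset_iff[of c b, where 'k = 'k] eq
      by auto
    then show ?thesis
      by linarith
  qed
  then show "b = c"
    by (rule ext)
qed simp

lemma ideal_sum_ideal_gen_monom:
  "ideal_sum (ideal_gen (monom ` U)) (ideal_gen (monom ` V)) =
    (ideal_gen (monom ` (U \<union> V)) :: ('v, 'k::comm_ring_1) mpoly set)"
  unfolding ideal_sum_def image_Un module.span_Un[OF module_times] by blast

section \<open>Irredundant decompositions: bounds on exponents and uniqueness\<close>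

lemma mem_decomposition_iff:
  fixes M :: "('v, 'k::comm_ring_1) mpoly set"
  assumes "irreducible_decomposition M r b"
  shows "p \<in> M \<longleftrightarrow>
    (\<forall>e\<in>Poly_Mapping.keys p. \<forall>i\<in>{1..r}. \<exists>s. 1 \<le> b i s \<and> b i s \<le> e s)"
proof -
  have "M = (\<Inter>i\<in>{1..r}. irr_ideal (b i))"
    using assms by (simp add: irreducible_decomposition_def)
  then show ?thesis
    by (auto simp: mem_irr_ideal_iff)
qed

lemma monom_mem_decomposition_iff:
  fixes M :: "('v, 'k::comm_ring_1) mpoly set"
  assumes "irreducible_decomposition M r b"
  shows "(monom e :: ('v, 'k) mpoly) \<in> M \<longleftrightarrow> (\<forall>i\<in>{1..r}. \<exists>s. 1 \<le> b i s \<and> b i s \<le> e s)"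
  by (simp add: mem_decomposition_iff[OF assms] keys_monom)

lemma irr_component_redundant:
  fixes M :: "('v, 'k::comm_ring_1) mpoly set"
  assumes dec: "irreducible_decomposition M r b" and i: "i \<in> {1..r}" and j: "j \<in> {1..r}"
    and sub: "(irr_ideal (b j) :: ('v, 'k) mpoly set) \<subseteq> irr_ideal (b i)"
  shows "j = i"
proof (rule ccontr)
  assume "j \<noteq> i"
  then have "(\<Inter>j\<in>{1..r} - {i}. irr_ideal (b j) :: ('v, 'k) mpoly set) \<subseteq> irr_ideal (b i)"
    using j sub by blast
  then have "(\<Inter>j\<in>{1..r} - {i}. irr_ideal (b j) :: ('v, 'k) mpoly set) =
      (\<Inter>j\<in>{1..r}. irr_ideal (b j))"
    using i by blast
  then show False
    using dec i unfolding irreducible_decomposition_def by metis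
qed

lemma decomposition_inj_on:
  assumes "irreducible_decomposition (M :: ('v, 'k::comm_ring_1) mpoly set) r b"
  shows "inj_on b {1..r}"
  using irr_component_redundant[OF assms] by (intro inj_onI) auto

text \<open>If a component involves \<open>s\<close> with exponent at least \<open>D\<close>, raise the exponent of \<open>s\<close> in a monomial
  that lies in all other components only: a minimal generator below the new monomial cannot use the
  new exponent.\<close>

lemma decomposition_exponent_less:
  fixes M :: "('v::finite, 'k::comm_ring_1) mpoly set"
  assumes dec: "irreducible_decomposition M r b" and i: "i \<in> {1..r}" and s: "1 \<le> b i s"
    and D: "\<forall>u\<in>min_gens M. u s < D"
  shows "b i s < D"
proof (rule ccontr)
  assume nless: "\<not> b i s < D"
  have "(\<Inter>j\<in>{1..r} - {i}. irr_ideal (b j) :: ('v, 'k) mpoly set) \<noteq> M"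
    "M \<subseteq> (\<Inter>j\<in>{1..r} - {i}. irr_ideal (b j) :: ('v, 'k) mpoly set)"
    using dec i by (auto simp: irreducible_decomposition_def)
  then obtain p :: "('v, 'k) mpoly" where
    p: "p \<in> (\<Inter>j\<in>{1..r} - {i}. irr_ideal (b j))" "p \<notin> M"
    by blast
  from p(2) obtain e j where e: "e \<in> Poly_Mapping.keys p" and j: "j \<in> {1..r}"
    and ej: "\<not> (\<exists>s. 1 \<le> b j s \<and> b j s \<le> e s)"
    unfolding mem_decomposition_iff[OF dec] by blast
  have others: "\<exists>s. 1 \<le> b l s \<and> b l s \<le> e s" if "l \<in> {1..r} - {i}" for l
    using p(1) that e unfolding INT_iff mem_irr_ideal_iff by blast
  then have "j = i"
    using j ej by blast
  define e' where "e' = e(s := max (e s) (b i s))"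
  have "(monom e' :: ('v, 'k) mpoly) \<in> M"
    unfolding monom_mem_decomposition_iff[OF dec]
  proof
    fix l assume l: "l \<in> {1..r}"
    show "\<exists>s. 1 \<le> b l s \<and> b l s \<le> e' s"
    proof (cases "l = i")
      case True
      then show ?thesis
        using s by (intro exI[of _ s]) (auto simp: e'_def)
    next
      case False
      then obtain t where "1 \<le> b l t" "b l t \<le> e t"
        using others l by blast
      then show ?thesis
        by (intro exI[of _ t]) (auto simp: e'_def)
    qed
  qed
  then obtain v where v: "v \<in> min_gens M" "v \<le> e'"
    by (rule ex_min_gens_le)
  have "(monom v :: ('v, 'k) mpoly) \<in> M"
    using v(1) by (simp add: min_gens_def)
  then obtain t where t: "1 \<le> b i t" "b i t \<le> v t"
    using i unfolding monom_mem_decomposition_iff[OF dec] by blast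
  have "t \<noteq> s"
    using D v(1) t nless by auto
  then have "v t \<le> e t"
    using v(2) by (auto simp: e'_def le_fun_def dest: spec[of _ t])
  then show False
    using ej t \<open>j = i\<close> by (meson order.trans)
qed

text \<open>A monomial outside \<open>irr_ideal c\<close> may stay just below \<open>c\<close> in
  the variables of \<open>c\<close> and be arbitrarily high in the others; it then escapes only
  those \<open>irr_ideal (b j)\<close> that lie in \<open>irr_ideal c\<close>. This primality is the
  source of uniqueness.\<close>

lemma Inter_irr_ideal_subset:
  fixes r :: nat
  assumes sub: "(\<Inter>j\<in>{1..r}. irr_ideal (b j)) \<subseteq>
    (irr_ideal c :: ('v, 'k::comm_ring_1) mpoly set)"
  shows "\<exists>j\<in>{1..r}. (irr_ideal (b j) :: ('v, 'k) mpoly set) \<subseteq> irr_ideal c"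
proof (rule ccontr)
  assume neg: "\<not> ?thesis"
  have *: "\<exists>t. 1 \<le> b j t \<and> \<not> (1 \<le> c t \<and> c t \<le> b j t)" if "j \<in> {1..r}" for j
    using neg that unfolding irr_ideal_subset_iff by blast
  \<comment> \<open>The sum serves only as a common upper bound of all \<open>b j t\<close>.\<close>
  define e where "e = (\<lambda>t. if 1 \<le> c t then c t - 1 else (\<Sum>j\<in>{1..r}. b j t))"
  have "(monom e :: ('v, 'k) mpoly) \<in> (\<Inter>j\<in>{1..r}. irr_ideal (b j))"
  proof
    fix j assume j: "j \<in> {1..r}"
    then obtain t where t: "1 \<le> b j t" "\<not> (1 \<le> c t \<and> c t \<le> b j t)"
      using * by blast
    have "b j t \<le> (\<Sum>j\<in>{1..r}. b j t)"
      using j by (intro member_le_sum) auto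
    then have "b j t \<le> e t"
      using t by (auto simp: e_def)
    then show "(monom e :: ('v, 'k) mpoly) \<in> irr_ideal (b j)"
      using t by (auto simp: monom_mem_irr_ideal_iff)
  qed
  moreover have "(monom e :: ('v, 'k) mpoly) \<notin> irr_ideal c"
    by (auto simp: monom_mem_irr_ideal_iff e_def)
  ultimately show False
    using sub by blast
qed

text \<open>\<open>cogeneric\<close> speaks of some decomposition, the co-Scarf complex of a given
  one. Primality applied twice gives \<open>irr_ideal (b i') \<subseteq> irr_ideal (b' j)
  \<subseteq> irr_ideal (b i)\<close>, and irredundancy forces \<open>i' = i\<close>.\<close>

lemma decomposition_component_unique:
  fixes M :: "('v, 'k::comm_ring_1) mpoly set"
  assumes dec: "irreducible_decomposition M r b" and dec': "irreducible_decomposition M r' b'"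
    and i: "i \<in> {1..r}"
  obtains j where "j \<in> {1..r'}" "b' j = b i"
proof -
  have M: "M = (\<Inter>i\<in>{1..r}. irr_ideal (b i))" "M = (\<Inter>j\<in>{1..r'}. irr_ideal (b' j))"
    using dec dec' by (auto simp: irreducible_decomposition_def)
  have "(\<Inter>j\<in>{1..r'}. irr_ideal (b' j)) \<subseteq> (irr_ideal (b i) :: ('v, 'k) mpoly set)"
    using M i by blast
  then obtain j where j: "j \<in> {1..r'}"
    "(irr_ideal (b' j) :: ('v, 'k) mpoly set) \<subseteq> irr_ideal (b i)"
    using Inter_irr_ideal_subset by blast
  have "(\<Inter>i\<in>{1..r}. irr_ideal (b i)) \<subseteq> (irr_ideal (b' j) :: ('v, 'k) mpoly set)"
    using M j by blast
  then obtain i' where i': "i' \<in> {1..r}"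
    "(irr_ideal (b i') :: ('v, 'k) mpoly set) \<subseteq> irr_ideal (b' j)"
    using Inter_irr_ideal_subset by blast
  have "i' = i"
    using irr_component_redundant[OF dec i i'(1)] i'(2) j(2) by blast
  then have "(irr_ideal (b' j) :: ('v, 'k) mpoly set) = irr_ideal (b i)"
    using i'(2) j(2) by blast
  then show ?thesis
    using that[OF j(1)] by (simp add: irr_ideal_eq_iff)
qed

text \<open>Each generator of the component \<open>l\<close> lies in the sum of the two components,
  so a generator of one of them divides it; it is not a minimal generator of the sum, so the
  division is proper. In this form the condition can be carried over to the exponents
  \<open>D - b\<close>.\<close>

lemma cogeneric_decompositionD:
  fixes M :: "('v, 'k::comm_ring_1) mpoly set"
  assumes cog: "cogeneric M" and dec: "irreducible_decomposition M r b"
    and i: "i \<in> {1..r}" and j: "j \<in> {1..r}" and ij: "b i \<noteq> b j"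
    and s: "1 \<le> b i s" "b i s = b j s"
  obtains l where "l \<in> {1..r}"
    "\<And>t. 1 \<le> b l t \<Longrightarrow> 1 \<le> b i t \<and> b i t < b l t \<or> 1 \<le> b j t \<and> b j t < b l t"
proof -
  let ?I = "\<lambda>b. irr_ideal b :: ('v, 'k) mpoly set"
  obtain r' b' where dec': "irreducible_decomposition M r' b'" and
    cog': "\<And>i j. i \<in> {1..r'} \<Longrightarrow> j \<in> {1..r'} \<Longrightarrow> ?I (b' i) \<noteq> ?I (b' j) \<Longrightarrow>
      min_gens (?I (b' i)) \<inter> min_gens (?I (b' j)) \<noteq> {} \<Longrightarrow>
      \<exists>l\<in>{1..r'}. ?I (b' l) \<subseteq> ideal_sum (?I (b' i)) (?I (b' j)) \<and>
        min_gens (?I (b' l)) \<inter> min_gens (ideal_sum (?I (b' i)) (?I (b' j))) = {}"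
    using cog unfolding cogeneric_def Let_def by blast
  obtain i' where i': "i' \<in> {1..r'}" "b' i' = b i"
    using decomposition_component_unique[OF dec dec' i] .
  obtain j' where j': "j' \<in> {1..r'}" "b' j' = b j"
    using decomposition_component_unique[OF dec dec' j] .
  have "var_pow s (b i s) \<in> min_gens (?I (b i))"
    using s(1) by (auto simp: min_gens_irr_ideal)
  moreover have "var_pow s (b j s) \<in> min_gens (?I (b j))"
    using s by (auto simp: min_gens_irr_ideal)
  ultimately have "min_gens (?I (b i)) \<inter> min_gens (?I (b j)) \<noteq> {}"
    using s(2) by auto
  then obtain l' where l': "l' \<in> {1..r'}" "?I (b' l') \<subseteq> ideal_sum (?I (b i)) (?I (b j))"
    "min_gens (?I (b' l')) \<inter> min_gens (ideal_sum (?I (b i)) (?I (b j))) = {}"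
    using cog'[OF i'(1) j'(1)] unfolding i'(2) j'(2) irr_ideal_eq_iff using ij by blast
  obtain l where l: "l \<in> {1..r}" "b l = b' l'"
    using decomposition_component_unique[OF dec' dec l'(1)] .
  let ?U = "{var_pow s (b i s) | s. 1 \<le> b i s} \<union> {var_pow s (b j s) | s. 1 \<le> b j s}"
  have sum: "ideal_sum (?I (b i)) (?I (b j)) = ideal_gen (monom ` ?U)"
    by (simp only: irr_ideal_eq ideal_sum_ideal_gen_monom)
  have U_le: "u \<le> var_pow t c \<Longrightarrow> u \<in> ?U \<Longrightarrow>
      (u = var_pow t (b i t) \<and> 1 \<le> b i t \<and> b i t \<le> c) \<or>
      (u = var_pow t (b j t) \<and> 1 \<le> b j t \<and> b j t \<le> c)" for u t c
    by (auto simp: var_pow_le_iff) (auto simp: var_pow_def split: if_splits)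
  show ?thesis
  proof (rule that[OF l(1)])
    fix t assume t: "1 \<le> b l t"
    show "1 \<le> b i t \<and> b i t < b l t \<or> 1 \<le> b j t \<and> b j t < b l t"
    proof (rule ccontr)
      assume neg: "\<not> ?thesis"
      let ?x = "var_pow t (b l t)"
      have x: "?x \<in> min_gens (?I (b l))"
        using t by (auto simp: min_gens_irr_ideal)
      then have "(monom ?x :: ('v, 'k) mpoly) \<in> ?I (b l)"
        by (simp add: min_gens_def)
      then have "(monom ?x :: ('v, 'k) mpoly) \<in> ideal_gen (monom ` ?U)"
        using l'(2) l(2) unfolding sum by auto
      then obtain u where u: "u \<in> ?U" "u \<le> ?x"
        unfolding monom_mem_ideal_gen_iff by blast
      \<comment> \<open>Under \<open>neg\<close> a generator of the sum that divides
        \<open>?x\<close> can only be \<open>?x\<close> itself, which makes \<open>?x\<close> a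
        forbidden common minimal generator.\<close>
      have only: "u = ?x" if "u \<in> ?U" "u \<le> ?x" for u
        using U_le[OF that(2,1)] neg by auto
      have "?x \<in> ?U"
        using u(1) unfolding only[OF u] .
      then have "?x \<in> min_gens (ideal_gen (monom ` ?U) :: ('v, 'k) mpoly set)"
        using only unfolding min_gens_ideal_gen_monom by blast
      then show False
        using x l'(3) l(2) unfolding sum by auto
    qed
  qed
qed

section \<open>Cochains on upward closed families of sets\<close>

lemma face_sign_mult_self: "face_sign R i \<tau> * face_sign R i \<tau> = (1 :: 'k::comm_ring_1)"
  by (simp add: face_sign_def flip: power_add mult_2)

text \<open>If \<open>i\<close> precedes \<open>j\<close>, removing \<open>i\<close> lowers the
  position of \<open>j\<close> by one, while removing \<open>j\<close> leaves the position of
  \<open>i\<close> alone.\<close>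

lemma face_sign_swap:
  assumes R: "linear_order_on V R" and V: "finite V" "\<tau> \<subseteq> V" and ij: "i \<in> \<tau>" "j \<in> \<tau>" "i \<noteq> j"
  shows "face_sign R i \<tau> * face_sign R j (\<tau> - {i}) =
    - (face_sign R j \<tau> * face_sign R i (\<tau> - {j}) :: 'k::comm_ring_1)"
proof -
  have fin: "finite \<tau>"
    using V finite_subset by blast
  have main: "face_sign R i \<tau> * face_sign R j (\<tau> - {i}) =
    - (face_sign R j \<tau> * face_sign R i (\<tau> - {j}) :: 'k)"
    if ij: "i \<in> \<tau>" "j \<in> \<tau>" "(i, j) \<in> R" "(j, i) \<notin> R" for i j
  proof -
    have "{w \<in> \<tau>. (w, j) \<in> R} = insert i {w \<in> \<tau> - {i}. (w, j) \<in> R}"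
      using ij by auto
    then have "card {w \<in> \<tau>. (w, j) \<in> R} = Suc (card {w \<in> \<tau> - {i}. (w, j) \<in> R})"
      using fin by simp
    moreover have "{w \<in> \<tau> - {j}. (w, i) \<in> R} = {w \<in> \<tau>. (w, i) \<in> R}"
      using ij by auto
    ultimately show ?thesis
      by (simp add: face_sign_def)
  qed
  have "(i, j) \<in> R \<and> (j, i) \<notin> R \<or> (j, i) \<in> R \<and> (i, j) \<notin> R"
    using R V(2) ij unfolding linear_order_on_def partial_order_on_def total_on_def antisym_def
    by blast
  then show ?thesis
    using main[of i j] main[of j i] ij by auto
qed

text \<open>The cochain complex of the full simplex on \<open>V\<close>, with the empty set as a
  face. The subcomplexes of interest consist of the cochains supported on an upward closed family,
  which the coboundary preserves.\<close>

definition coboundary :: "'a set \<Rightarrow> 'a rel \<Rightarrow> ('a set \<Rightarrow> 'k::comm_ring_1) \<Rightarrow> 'a set \<Rightarrow> 'k" where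
  "coboundary V R \<phi> = (\<lambda>\<tau>. if \<tau> \<subseteq> V then \<Sum>i\<in>\<tau>. face_sign R i \<tau> * \<phi> (\<tau> - {i}) else 0)"

definition supported_on :: "('b \<Rightarrow> 'k::zero) \<Rightarrow> 'b set \<Rightarrow> bool" where
  "supported_on \<phi> X \<longleftrightarrow> (\<forall>x. x \<notin> X \<longrightarrow> \<phi> x = 0)"

definition restrict_to :: "'b set \<Rightarrow> ('b \<Rightarrow> 'k::zero) \<Rightarrow> 'b \<Rightarrow> 'k" where
  "restrict_to X \<phi> = (\<lambda>x. if x \<in> X then \<phi> x else 0)"

definition upclosed :: "'a set \<Rightarrow> 'a set set \<Rightarrow> bool" where
  "upclosed V X \<longleftrightarrow> X \<subseteq> Pow V \<and> (\<forall>\<sigma>\<in>X. \<forall>\<tau>. \<sigma> \<subseteq> \<tau> \<and> \<tau> \<subseteq> V \<longrightarrow> \<tau> \<in> X)"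

text \<open>With \<open>Suc (card \<sigma>) = m\<close> in place of
  \<open>card \<sigma> = m - 1\<close>, the condition at \<open>m = 0\<close> says that the cocycle
  is zero.\<close>

definition acyclic_on :: "'k::comm_ring_1 itself \<Rightarrow> 'a set \<Rightarrow> 'a rel \<Rightarrow> 'a set set \<Rightarrow> bool" where
  "acyclic_on K V R X \<longleftrightarrow> (\<forall>m (\<phi> :: 'a set \<Rightarrow> 'k).
     supported_on \<phi> {\<sigma> \<in> X. card \<sigma> = m} \<and> coboundary V R \<phi> = 0 \<longrightarrow>
     (\<exists>\<psi>. supported_on \<psi> {\<sigma> \<in> X. Suc (card \<sigma>) = m} \<and> coboundary V R \<psi> = \<phi>))"

lemma sum_fun_apply: "(\<Sum>x\<in>A. f x) y = (\<Sum>x\<in>A. f x y)"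
  by (induction A rule: infinite_finite_induct) auto

lemma supported_on_mono: "supported_on \<phi> X \<Longrightarrow> X \<subseteq> Y \<Longrightarrow> supported_on \<phi> Y"
  by (auto simp: supported_on_def)

lemma supported_on_add:
  "supported_on \<phi> X \<Longrightarrow> supported_on \<psi> X \<Longrightarrow> supported_on (\<phi> + \<psi>) X"
  for \<phi> \<psi> :: "'b \<Rightarrow> 'k::monoid_add"
  by (simp add: supported_on_def)

lemma supported_on_diff:
  "supported_on \<phi> X \<Longrightarrow> supported_on \<psi> X \<Longrightarrow> supported_on (\<phi> - \<psi>) X"
  for \<phi> \<psi> :: "'b \<Rightarrow> 'k::ab_group_add"
  by (simp add: supported_on_def)

lemma restrict_to_eq_self_iff: "restrict_to X \<phi> = \<phi> \<longleftrightarrow> supported_on \<phi> X"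
  by (auto simp: supported_on_def restrict_to_def fun_eq_iff)

lemma coboundary_add: "coboundary V R (\<phi> + \<psi>) = coboundary V R \<phi> + coboundary V R \<psi>"
  by (auto simp: coboundary_def fun_eq_iff distrib_left sum.distrib)

lemma coboundary_diff: "coboundary V R (\<phi> - \<psi>) = coboundary V R \<phi> - coboundary V R \<psi>"
  by (auto simp: coboundary_def fun_eq_iff right_diff_distrib sum_subtractf)

lemma coboundary_0 [simp]: "coboundary V R 0 = 0"
  by (auto simp: coboundary_def fun_eq_iff)

lemma coboundary_sum: "coboundary V R (\<Sum>x\<in>A. f x) = (\<Sum>x\<in>A. coboundary V R (f x))"
  by (induction A rule: infinite_finite_induct)
    (simp_all only: sum.infinite sum.empty sum.insert coboundary_0 coboundary_add simp_thms)

lemma coboundary_scale: "coboundary V R (\<lambda>\<sigma>. c * \<phi> \<sigma>) = (\<lambda>\<tau>. c * coboundary V R \<phi> \<tau>)"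
  by (auto simp: coboundary_def fun_eq_iff sum_distrib_left mult.left_commute)

lemma coboundary_supported_on:
  assumes X: "upclosed V X" and V: "finite V" and \<phi>: "supported_on \<phi> {\<sigma> \<in> X. card \<sigma> = m}"
  shows "supported_on (coboundary V R \<phi>) {\<sigma> \<in> X. card \<sigma> = Suc m}"
  unfolding supported_on_def
proof (intro allI impI)
  fix \<tau> assume \<tau>: "\<tau> \<notin> {\<sigma> \<in> X. card \<sigma> = Suc m}"
  show "coboundary V R \<phi> \<tau> = 0"
  proof (cases "\<tau> \<subseteq> V")
    case True
    have "\<phi> (\<tau> - {i}) = 0" if i: "i \<in> \<tau>" for i
    proof (rule ccontr)
      assume "\<phi> (\<tau> - {i}) \<noteq> 0"
      then have "\<tau> - {i} \<in> X" "card (\<tau> - {i}) = m"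
        using \<phi> by (auto simp: supported_on_def)
      moreover have "card \<tau> = Suc (card (\<tau> - {i}))"
        using card.remove[OF finite_subset[OF True V] i] .
      moreover have "\<tau> \<in> X"
        using X True calculation(1) by (auto simp: upclosed_def)
      ultimately show False
        using \<tau> by simp
    qed
    then show ?thesis
      by (simp add: coboundary_def)
  qed (simp add: coboundary_def)
qed

lemma coboundary_supported_on':
  assumes X: "upclosed V X" and \<phi>: "supported_on \<phi> X"
  shows "supported_on (coboundary V R \<phi>) X"
  unfolding supported_on_def
proof (intro allI impI)
  fix \<tau> assume \<tau>: "\<tau> \<notin> X"
  have "\<phi> (\<tau> - {i}) = 0" if "\<tau> \<subseteq> V" for i
  proof -
    have "\<tau> - {i} \<notin> X"
      using X \<tau> that unfolding upclosed_def by (meson Diff_subset)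
    then show ?thesis
      using \<phi> by (simp add: supported_on_def)
  qed
  then show "coboundary V R \<phi> \<tau> = 0"
    by (simp add: coboundary_def)
qed

context
  fixes V :: "'a set" and R :: "'a rel"
  assumes V: "finite V" and R: "linear_order_on V R"
begin

text \<open>The terms are split by the order of the two removed elements rather than shown to be equal to
  their own negative, so that characteristic two is covered.\<close>

lemma coboundary_coboundary: "coboundary V R (coboundary V R \<phi>) = (0 :: 'a set \<Rightarrow> 'k::comm_ring_1)"
proof
  fix \<tau>
  show "coboundary V R (coboundary V R \<phi>) \<tau> = (0 :: 'a set \<Rightarrow> 'k) \<tau>"
  proof (cases "\<tau> \<subseteq> V")
    case True
    have fin: "finite \<tau>"
      using True V finite_subset by blast
    define A where "A = (\<lambda>i j. face_sign R i \<tau> * face_sign R j (\<tau> - {i}) * \<phi> (\<tau> - {i} - {j}))"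
    have A: "A i j = - A j i" if "i \<in> \<tau>" "j \<in> \<tau>" "i \<noteq> j" for i j
    proof -
      have "\<tau> - {i} - {j} = \<tau> - {j} - {i}"
        by blast
      then show ?thesis
        unfolding A_def using face_sign_swap[OF R V True that, where 'k = 'k] by simp
    qed
    have split: "\<tau> - {i} = {j \<in> \<tau>. j \<noteq> i \<and> (i, j) \<in> R} \<union> {j \<in> \<tau>. j \<noteq> i \<and> (j, i) \<in> R}"
      if "i \<in> \<tau>" for i
      using that R True unfolding linear_order_on_def total_on_def by blast
    have disj: "{j \<in> \<tau>. j \<noteq> i \<and> (i, j) \<in> R} \<inter> {j \<in> \<tau>. j \<noteq> i \<and> (j, i) \<in> R} = {}" for i
      using R unfolding linear_order_on_def partial_order_on_def antisym_def by blast
    have "coboundary V R (coboundary V R \<phi>) \<tau> = (\<Sum>i\<in>\<tau>. \<Sum>j\<in>\<tau> - {i}. A i j)"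
    proof -
      have "\<tau> - {i} \<subseteq> V" for i
        using True by blast
      then show ?thesis
        using True by (simp add: coboundary_def A_def sum_distrib_left mult.assoc)
    qed
    also have "\<dots> = (\<Sum>i\<in>\<tau>. (\<Sum>j | j \<in> \<tau> \<and> j \<noteq> i \<and> (i, j) \<in> R. A i j) +
        (\<Sum>j | j \<in> \<tau> \<and> j \<noteq> i \<and> (j, i) \<in> R. A i j))"
      by (intro sum.cong refl, subst split, assumption, rule sum.union_disjoint)
        (use fin disj in auto)
    also have "\<dots> = (\<Sum>i\<in>\<tau>. \<Sum>j | j \<in> \<tau> \<and> j \<noteq> i \<and> (i, j) \<in> R. A i j) +
        (\<Sum>i\<in>\<tau>. \<Sum>j | j \<in> \<tau> \<and> j \<noteq> i \<and> (j, i) \<in> R. A i j)"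
      by (rule sum.distrib)
    also have "(\<Sum>i\<in>\<tau>. \<Sum>j | j \<in> \<tau> \<and> j \<noteq> i \<and> (j, i) \<in> R. A i j) =
        (\<Sum>j\<in>\<tau>. \<Sum>i | i \<in> \<tau> \<and> j \<noteq> i \<and> (j, i) \<in> R. A i j)"
      by (rule sum.swap_restrict[OF fin fin])
    also have "\<dots> = (\<Sum>j\<in>\<tau>. \<Sum>i | i \<in> \<tau> \<and> i \<noteq> j \<and> (j, i) \<in> R. - A j i)"
      by (intro sum.cong) (auto intro: A)
    finally show ?thesis
      by (simp add: sum_negf)
  qed (simp add: coboundary_def)
qed

section \<open>Cone contractions and cancellation of paired sets\<close>

definition cone_homotopy :: "'a \<Rightarrow> ('a set \<Rightarrow> 'k::comm_ring_1) \<Rightarrow> 'a set \<Rightarrow> 'k" where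
  "cone_homotopy p \<phi> \<sigma> = (if p \<notin> \<sigma> then face_sign R p (insert p \<sigma>) * \<phi> (insert p \<sigma>) else 0)"

text \<open>The full simplex is a cone with apex \<open>p\<close>, and
  \<open>cone_homotopy p\<close> is its contraction. If \<open>p \<in> \<sigma>\<close>, only the
  removal of \<open>p\<close> survives; otherwise the terms that remove another vertex cancel by
  \<open>face_sign_swap\<close>.\<close>

lemma coboundary_cone_homotopy:
  assumes \<sigma>: "\<sigma> \<subseteq> V" and p: "p \<in> V"
  shows "coboundary V R (cone_homotopy p \<phi>) \<sigma> + cone_homotopy p (coboundary V R \<phi>) \<sigma> =
    (\<phi> \<sigma> :: 'k::comm_ring_1)"
proof (cases "p \<in> \<sigma>")
  case True
  have fin: "finite \<sigma>"
    using \<sigma> V finite_subset by blast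
  have "coboundary V R (cone_homotopy p \<phi>) \<sigma> =
      (\<Sum>i\<in>\<sigma>. if i = p then face_sign R p \<sigma> * (face_sign R p \<sigma> * \<phi> \<sigma>) else 0)"
    unfolding coboundary_def if_P[OF \<sigma>]
    by (intro sum.cong) (use True in \<open>auto simp: cone_homotopy_def insert_absorb\<close>)
  also have "\<dots> = \<phi> \<sigma>"
    using fin True by (simp add: face_sign_mult_self flip: mult.assoc)
  finally show ?thesis
    using True by (simp add: cone_homotopy_def)
next
  case False
  have fin: "finite \<sigma>"
    using \<sigma> V finite_subset by blast
  let ?\<tau> = "insert p \<sigma>"
  have \<tau>: "?\<tau> \<subseteq> V"
    using \<sigma> p by blast
  have "cone_homotopy p (coboundary V R \<phi>) \<sigma> =
      face_sign R p ?\<tau> * (\<Sum>i\<in>?\<tau>. face_sign R i ?\<tau> * \<phi> (?\<tau> - {i}))"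
    using False \<tau> by (simp add: cone_homotopy_def coboundary_def)
  also have "(\<Sum>i\<in>?\<tau>. face_sign R i ?\<tau> * \<phi> (?\<tau> - {i})) =
      face_sign R p ?\<tau> * \<phi> \<sigma> + (\<Sum>i\<in>\<sigma>. face_sign R i ?\<tau> * \<phi> (?\<tau> - {i}))"
    using fin False by simp
  also have "face_sign R p ?\<tau> * \<dots> =
      \<phi> \<sigma> + (\<Sum>i\<in>\<sigma>. face_sign R p ?\<tau> * face_sign R i ?\<tau> * \<phi> (?\<tau> - {i}))"
    by (simp add: distrib_left face_sign_mult_self sum_distrib_left mult.assoc flip: mult.assoc[of _ _ "\<phi> \<sigma>"])
  finally have h: "cone_homotopy p (coboundary V R \<phi>) \<sigma> =
      \<phi> \<sigma> + (\<Sum>i\<in>\<sigma>. face_sign R p ?\<tau> * face_sign R i ?\<tau> * \<phi> (?\<tau> - {i}))" .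
  have "coboundary V R (cone_homotopy p \<phi>) \<sigma> =
      (\<Sum>i\<in>\<sigma>. - (face_sign R p ?\<tau> * face_sign R i ?\<tau> * \<phi> (?\<tau> - {i})))"
    unfolding coboundary_def if_P[OF \<sigma>]
  proof (intro sum.cong refl)
    fix i assume i: "i \<in> \<sigma>"
    then have ip: "i \<noteq> p"
      using False by blast
    have eq: "insert p (\<sigma> - {i}) = ?\<tau> - {i}" "?\<tau> - {p} = \<sigma>"
      using ip False by auto
    \<comment> \<open>Signs square to 1, so multiplying the swap identity by two of them moves them
      to the other side.\<close>
    have "face_sign R p ?\<tau> * face_sign R i \<sigma> =
        - (face_sign R i ?\<tau> * face_sign R p (?\<tau> - {i}) :: 'k)"
      using face_sign_swap[OF R V \<tau>, of p i, where 'k = 'k] i ip eq(2) by simp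
    moreover have "(face_sign R p ?\<tau> * face_sign R p ?\<tau>) * (face_sign R i \<sigma> * face_sign R p (?\<tau> - {i}))
        = face_sign R p ?\<tau> * (face_sign R p ?\<tau> * face_sign R i \<sigma>) * (face_sign R p (?\<tau> - {i}) :: 'k)"
      by (simp only: mult_ac)
    ultimately have "(face_sign R p ?\<tau> * face_sign R p ?\<tau>) * (face_sign R i \<sigma> * face_sign R p (?\<tau> - {i}))
        = - (face_sign R p ?\<tau> * face_sign R i ?\<tau> *
            (face_sign R p (?\<tau> - {i}) * face_sign R p (?\<tau> - {i})) :: 'k)"
      by (simp only: mult_minus_left mult_minus_right mult_ac)
    then have "face_sign R i \<sigma> * face_sign R p (?\<tau> - {i}) =
        - (face_sign R p ?\<tau> * face_sign R i ?\<tau> :: 'k)"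
      by (simp add: face_sign_mult_self)
    then show "face_sign R i \<sigma> * cone_homotopy p \<phi> (\<sigma> - {i}) =
        - (face_sign R p ?\<tau> * face_sign R i ?\<tau> * \<phi> (?\<tau> - {i}))"
      using False eq(1) by (simp add: cone_homotopy_def flip: mult.assoc)
  qed
  then show ?thesis
    by (simp add: h sum_negf)
qed

text \<open>Modulo the cochains on \<open>X'\<close>, inserting and removing \<open>p\<close> pairs
  all sets, so the cone contraction works on the quotient. It moves a cocycle on \<open>X\<close> to
  a cohomologous one on \<open>X'\<close>, where acyclicity is assumed. Both acyclicity results
  below iterate this step.\<close>

lemma acyclic_on_cone_extension:
  assumes acyc: "acyclic_on TYPE('k::comm_ring_1) V R X'"
    and X: "upclosed V X" "upclosed V X'" "X' \<subseteq> X" and p: "p \<in> V"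
    and toggle: "\<And>\<sigma>. \<sigma> \<subseteq> V \<Longrightarrow> insert p \<sigma> \<in> X - X' \<longleftrightarrow> \<sigma> - {p} \<in> X - X'"
  shows "acyclic_on TYPE('k) V R X"
  unfolding acyclic_on_def
proof (intro allI impI, elim conjE)
  fix m and \<phi> :: "'a set \<Rightarrow> 'k"
  assume \<phi>: "supported_on \<phi> {\<sigma> \<in> X. card \<sigma> = m}" and cocycle: "coboundary V R \<phi> = 0"
  have sub: "\<sigma> \<subseteq> V" if "\<sigma> \<in> X" for \<sigma>
    using that X(1) by (auto simp: upclosed_def)
  have tog: "insert p \<sigma> \<in> X - X'" if "\<sigma> \<in> X - X'" for \<sigma>
  proof (cases "p \<in> \<sigma>")
    case False
    then show ?thesis
      using toggle[OF sub, of \<sigma>] that by simp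
  qed (use that in \<open>simp add: insert_absorb\<close>)
  have tog': "\<sigma> \<in> X - X'" if "insert p \<sigma> \<in> X - X'" for \<sigma>
  proof (cases "p \<in> \<sigma>")
    case False
    then show ?thesis
      using toggle[of \<sigma>] sub[of "insert p \<sigma>"] that by simp
  qed (use that in \<open>simp add: insert_absorb\<close>)
  \<comment> \<open>Restricting to \<open>X - X'\<close> before contracting keeps
    \<open>\<psi>\<close> supported in \<open>X\<close>, because \<open>p\<close> can be removed
    there.\<close>
  define \<phi>Y where "\<phi>Y = restrict_to (X - X') \<phi>"
  define \<psi> where "\<psi> = cone_homotopy p \<phi>Y"
  have \<psi>: "supported_on \<psi> {\<sigma> \<in> X. Suc (card \<sigma>) = m}"
    unfolding supported_on_def
  proof (intro allI impI, rule ccontr)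
    fix \<sigma> assume *: "\<sigma> \<notin> {\<sigma> \<in> X. Suc (card \<sigma>) = m}" "\<psi> \<sigma> \<noteq> 0"
    then have p\<sigma>: "p \<notin> \<sigma>" and "\<phi>Y (insert p \<sigma>) \<noteq> 0"
      by (auto simp: \<psi>_def cone_homotopy_def split: if_splits)
    then have Y: "insert p \<sigma> \<in> X - X'" and "\<phi> (insert p \<sigma>) \<noteq> 0"
      by (auto simp: \<phi>Y_def restrict_to_def split: if_splits)
    then have "card (insert p \<sigma>) = m"
      using \<phi> by (auto simp: supported_on_def)
    then have "Suc (card \<sigma>) = m"
      using p\<sigma> finite_subset[OF sub V, of "insert p \<sigma>"] Y by simp
    then show False
      using * tog'[OF Y] by auto
  qed
  have "supported_on (\<phi> - coboundary V R \<psi>) {\<sigma> \<in> X. card \<sigma> = m}"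
  proof (cases m)
    case 0
    then have "\<psi> = 0"
      using \<psi> by (auto simp: supported_on_def fun_eq_iff)
    then show ?thesis
      using \<phi> by simp
  next
    case (Suc m')
    then have "supported_on \<psi> {\<sigma> \<in> X. card \<sigma> = m'}"
      using \<psi> by simp
    then show ?thesis
      using \<phi> coboundary_supported_on[OF X(1) V] Suc by (intro supported_on_diff) auto
  qed
  moreover have "(\<phi> - coboundary V R \<psi>) \<sigma> = 0" if Y: "\<sigma> \<in> X - X'" for \<sigma>
  proof -
    \<comment> \<open>A face of \<open>insert p \<sigma>\<close> in \<open>X'\<close> would force
      \<open>insert p \<sigma>\<close> itself into \<open>X'\<close>; hence the coboundary at
      \<open>insert p \<sigma>\<close> does not notice the restriction.\<close>
    have face: "\<phi>Y (insert p \<sigma> - {i}) = \<phi> (insert p \<sigma> - {i})" for i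
    proof (cases "insert p \<sigma> - {i} \<in> X")
      case True
      moreover have "insert p \<sigma> - {i} \<notin> X'"
      proof
        assume "insert p \<sigma> - {i} \<in> X'"
        moreover have "insert p \<sigma> - {i} \<subseteq> insert p \<sigma>" "insert p \<sigma> \<subseteq> V"
          using sub[of \<sigma>] Y p by auto
        ultimately have "insert p \<sigma> \<in> X'"
          using X(2) unfolding upclosed_def by (meson)
        then show False
          using tog[OF Y] by simp
      qed
      ultimately show ?thesis
        by (simp add: \<phi>Y_def restrict_to_def)
    next
      case False
      then show ?thesis
        using \<phi> by (auto simp: \<phi>Y_def restrict_to_def supported_on_def)
    qed
    have "coboundary V R \<phi>Y (insert p \<sigma>) = coboundary V R \<phi> (insert p \<sigma>)"
      by (simp add: coboundary_def face)
    then have "cone_homotopy p (coboundary V R \<phi>Y) \<sigma> = 0"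
      using cocycle by (simp add: cone_homotopy_def)
    then have "coboundary V R \<psi> \<sigma> = \<phi>Y \<sigma>"
      using coboundary_cone_homotopy[of \<sigma> p \<phi>Y] sub Y p by (simp add: \<psi>_def)
    then show ?thesis
      using Y by (simp add: \<phi>Y_def restrict_to_def)
  qed
  ultimately have "supported_on (\<phi> - coboundary V R \<psi>) {\<sigma> \<in> X'. card \<sigma> = m}"
    unfolding supported_on_def by blast
  moreover have "coboundary V R (\<phi> - coboundary V R \<psi>) = 0"
    by (simp add: coboundary_diff cocycle coboundary_coboundary)
  ultimately obtain \<psi>' where \<psi>': "supported_on \<psi>' {\<sigma> \<in> X'. Suc (card \<sigma>) = m}"
    "coboundary V R \<psi>' = \<phi> - coboundary V R \<psi>"
    using acyc unfolding acyclic_on_def by blast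
  have "supported_on (\<psi>' + \<psi>) {\<sigma> \<in> X. Suc (card \<sigma>) = m}"
    using \<psi> X(3) by (intro supported_on_add supported_on_mono[OF \<psi>'(1)]) auto
  moreover have "coboundary V R (\<psi>' + \<psi>) = \<phi>"
    by (simp add: coboundary_add \<psi>'(2))
  ultimately show "\<exists>\<psi>. supported_on \<psi> {\<sigma> \<in> X. Suc (card \<sigma>) = m} \<and> coboundary V R \<psi> = \<phi>"
    by blast
qed

lemma acyclic_on_empty: "acyclic_on TYPE('k::comm_ring_1) V R {}"
  by (auto simp: acyclic_on_def supported_on_def fun_eq_iff intro!: exI[of _ 0])

end

section \<open>Scarf complexes of generic monomials\<close>

definition lcm_label :: "('a \<Rightarrow> 'v \<Rightarrow> nat) \<Rightarrow> 'a set \<Rightarrow> 'v \<Rightarrow> nat" where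
  "lcm_label g \<sigma> = (\<lambda>s. Max (insert 0 ((\<lambda>v. g v s) ` \<sigma>)))"

lemma less_lcm_label_iff: "finite \<sigma> \<Longrightarrow> k < lcm_label g \<sigma> s \<longleftrightarrow> (\<exists>v\<in>\<sigma>. k < g v s)"
  by (auto simp: lcm_label_def Max_gr_iff)

lemma lcm_label_le_iff: "finite \<sigma> \<Longrightarrow> lcm_label g \<sigma> s \<le> k \<longleftrightarrow> (\<forall>v\<in>\<sigma>. g v s \<le> k)"
  by (auto simp: lcm_label_def)

lemma le_lcm_label: "finite \<sigma> \<Longrightarrow> v \<in> \<sigma> \<Longrightarrow> g v s \<le> lcm_label g \<sigma> s"
  by (simp add: lcm_label_def)

lemma lcm_label_mono: "finite \<tau> \<Longrightarrow> \<sigma> \<subseteq> \<tau> \<Longrightarrow> lcm_label g \<sigma> s \<le> lcm_label g \<tau> s"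
  unfolding lcm_label_def by (intro Max_mono) auto

lemma lcm_label_attained:
  assumes "finite \<sigma>" "0 < lcm_label g \<sigma> s"
  obtains v where "v \<in> \<sigma>" "g v s = lcm_label g \<sigma> s"
proof -
  have "lcm_label g \<sigma> s \<in> insert 0 ((\<lambda>v. g v s) ` \<sigma>)"
    unfolding lcm_label_def by (rule Max_in) (use assms(1) in auto)
  then show ?thesis
    using that assms(2) by auto
qed

lemma lcm_label_insert:
  assumes "finite \<sigma>"
  shows "lcm_label g (insert j \<sigma>) s = max (g j s) (lcm_label g \<sigma> s)"
proof -
  have "lcm_label g (insert j \<sigma>) s = Max (insert (g j s) (insert 0 ((\<lambda>v. g v s) ` \<sigma>)))"
    by (simp add: lcm_label_def insert_commute)
  then show ?thesis
    using assms by (simp add: lcm_label_def)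
qed

lemma lcm_label_insert_remove:
  assumes "finite \<sigma>"
  shows "lcm_label g (insert j \<sigma>) s = max (g j s) (lcm_label g (\<sigma> - {j}) s)"
  using lcm_label_insert[of "\<sigma> - {j}" g j s] assms by simp

text \<open>Cogenericity of \<open>M\<close> turns into the assumption \<open>generic\<close> for the generators of the Alexander dual.\<close>

locale generic_labels =
  fixes V :: "'a set" and R :: "'a rel" and g :: "'a \<Rightarrow> 'v::finite \<Rightarrow> nat"
  assumes finite_V: "finite V"
    and order_R: "linear_order_on V R"
    and ex_pure_power: "\<And>s. \<exists>v\<in>V. \<forall>t. t \<noteq> s \<longrightarrow> g v t = 0"
    and generic: "\<And>i j t. i \<in> V \<Longrightarrow> j \<in> V \<Longrightarrow> i \<noteq> j \<Longrightarrow> g i t = g j t \<Longrightarrow> 0 < g i t \<Longrightarrow>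
      \<exists>l\<in>V. \<forall>s. g l s < max (g i s) (g j s) \<or> g l s = 0"
begin

abbreviation lab :: "'a set \<Rightarrow> 'v \<Rightarrow> nat" where
  "lab \<equiv> lcm_label g"

definition scarf :: "'a set set" where
  "scarf = {\<sigma>. \<sigma> \<subseteq> V \<and> (\<forall>\<tau>. \<tau> \<subseteq> V \<and> \<tau> \<noteq> \<sigma> \<longrightarrow> lab \<tau> \<noteq> lab \<sigma>)}"

definition interior :: "'a set set" where
  "interior = {\<sigma> \<in> scarf. \<forall>s. 0 < lab \<sigma> s}"

definition above :: "('v \<Rightarrow> nat) \<Rightarrow> 'a set set" where
  "above w = {\<sigma>. \<sigma> \<subseteq> V \<and> (\<forall>s. w s < lab \<sigma> s)}"

text \<open>Given by a strict divisor and not as a complement, because in this form the family is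
  visibly upward closed; \<open>nonscarf_above_eq\<close> identifies it with the sets outside the
  Scarf complex.\<close>

definition nonscarf_above :: "('v \<Rightarrow> nat) \<Rightarrow> 'a set set" where
  "nonscarf_above w = {\<sigma> \<in> above w. \<exists>i\<in>V. \<forall>s. g i s < lab \<sigma> s}"

text \<open>The monomial with exponent \<open>w\<close> does not lie in the ideal generated by the monomials
  \<open>g v\<close>.\<close>

definition standard :: "('v \<Rightarrow> nat) \<Rightarrow> bool" where
  "standard w \<longleftrightarrow> (\<forall>v\<in>V. \<exists>s. w s < g v s)"

text \<open>A choice, because the power of \<open>s\<close> among the minimal generators may be the
  one with exponent \<open>D\<close> or one of the dual generators. If the monomial 1 is a
  generator, \<open>g (pure s) s\<close> may be zero; \<open>pure_greater\<close> excludes this for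
  standard \<open>w\<close>.\<close>

definition pure :: "'v \<Rightarrow> 'a" where
  "pure s = (SOME v. v \<in> V \<and> (\<forall>t. t \<noteq> s \<longrightarrow> g v t = 0))"

lemma pure_in: "pure s \<in> V" and pure_eq_0: "t \<noteq> s \<Longrightarrow> g (pure s) t = 0"
proof -
  have "pure s \<in> V \<and> (\<forall>t. t \<noteq> s \<longrightarrow> g (pure s) t = 0)"
    unfolding pure_def by (rule someI_ex) (use ex_pure_power[of s] in blast)
  then show "pure s \<in> V" and "t \<noteq> s \<Longrightarrow> g (pure s) t = 0"
    by auto
qed

lemma finite_face: "\<sigma> \<subseteq> V \<Longrightarrow> finite \<sigma>"
  using finite_V finite_subset by blast

lemma above_iff: "\<sigma> \<in> above w \<longleftrightarrow> \<sigma> \<subseteq> V \<and> (\<forall>s. \<exists>v\<in>\<sigma>. w s < g v s)"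
  by (auto simp: above_def less_lcm_label_iff finite_face)

lemma scarf_subset: "\<sigma> \<in> scarf \<Longrightarrow> \<sigma> \<subseteq> V"
  by (simp add: scarf_def)

lemma scarf_eqI: "\<sigma> \<in> scarf \<Longrightarrow> \<tau> \<subseteq> V \<Longrightarrow> (\<And>s. lab \<tau> s = lab \<sigma> s) \<Longrightarrow> \<tau> = \<sigma>"
  unfolding scarf_def mem_Collect_eq by (metis ext)

text \<open>A strict divisor can be inserted or deleted without changing the label, so a Scarf face
  would equal both \<open>insert i \<sigma>\<close> and \<open>\<sigma> - {i}\<close>.\<close>

lemma not_scarf_if_strict_divisor:
  assumes i: "i \<in> V" and strict: "\<And>s. g i s < lab \<sigma> s"
  shows "\<sigma> \<notin> scarf"
proof
  assume \<sigma>: "\<sigma> \<in> scarf"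
  have fin: "finite \<sigma>"
    using scarf_subset[OF \<sigma>] by (rule finite_face)
  have "lab (insert i \<sigma>) s = lab \<sigma> s" "lab (\<sigma> - {i}) s = lab \<sigma> s" for s
  proof -
    show "lab (insert i \<sigma>) s = lab \<sigma> s"
      using strict[of s] by (simp add: lcm_label_insert fin)
    then show "lab (\<sigma> - {i}) s = lab \<sigma> s"
      using strict[of s] by (simp add: lcm_label_insert_remove fin max_def split: if_splits)
  qed
  then have "insert i \<sigma> = \<sigma>" "\<sigma> - {i} = \<sigma>"
    using scarf_subset[OF \<sigma>] i by (auto intro!: scarf_eqI[OF \<sigma>])
  then show False
    by blast
qed

text \<open>Two different sets with the same label differ in some \<open>j\<close>. If
  \<open>j\<close> attains the label in a variable, the set without \<open>j\<close> attains it
  there through another generator, and genericity turns this tie into a strict divisor.\<close>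

lemma ex_strict_divisor_if_not_scarf:
  assumes \<sigma>: "\<sigma> \<subseteq> V" "\<sigma> \<notin> scarf" and pos: "\<And>s. 0 < lab \<sigma> s"
  shows "\<exists>i\<in>V. \<forall>s. g i s < lab \<sigma> s"
proof -
  \<comment> \<open>Stated for two arbitrary sets with the label of \<open>\<sigma>\<close>, since
    the element that distinguishes them may lie in either one.\<close>
  have main: ?thesis
    if j: "j \<in> \<rho>" "j \<notin> \<rho>'" and \<rho>: "\<rho> \<subseteq> V" "\<rho>' \<subseteq> V" "lab \<rho> = lab \<sigma>" "lab \<rho>' = lab \<sigma>"
    for \<rho> \<rho>' j
  proof (cases "\<forall>s. g j s < lab \<sigma> s")
    case True
    then show ?thesis
      using j(1) \<rho>(1) by blast
  next
    case False
    have le: "g v s \<le> lab \<sigma> s" if "v \<in> \<rho> \<or> v \<in> \<rho>'" for v s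
      using that le_lcm_label[OF finite_face[OF \<rho>(1)], of v g s]
        le_lcm_label[OF finite_face[OF \<rho>(2)], of v g s] \<rho>(3,4) by auto
    from False obtain s where "\<not> g j s < lab \<sigma> s"
      by blast
    then have s: "g j s = lab \<sigma> s"
      using le[of j s] j(1) by simp
    obtain j' where j': "j' \<in> \<rho>'" "g j' s = lab \<sigma> s"
      using lcm_label_attained[OF finite_face[OF \<rho>(2)], of g s] pos[of s] \<rho>(4) by auto
    obtain l where l: "l \<in> V" "\<And>s. g l s < max (g j s) (g j' s) \<or> g l s = 0"
      using generic[of j j' s] j j' \<rho> s pos[of s] by auto
    \<comment> \<open>Positivity of the label makes the alternative \<open>g l s = 0\<close> strict
      as well.\<close>
    have "g l s < lab \<sigma> s" for s
      using l(2)[of s] le[of j s] le[of j' s] j(1) j'(1) pos[of s] by (auto simp: less_max_iff_disj)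
    then show ?thesis
      using l(1) by blast
  qed
  obtain \<tau> where \<tau>: "\<tau> \<subseteq> V" "\<tau> \<noteq> \<sigma>" "lab \<tau> = lab \<sigma>"
    using \<sigma> by (auto simp: scarf_def)
  then consider j where "j \<in> \<tau>" "j \<notin> \<sigma>" | j where "j \<in> \<sigma>" "j \<notin> \<tau>"
    by blast
  then show ?thesis
    by cases (use main \<sigma> \<tau> in blast)+
qed

lemma nonscarf_above_eq: "nonscarf_above w = above w - scarf"
proof (intro set_eqI iffI)
  fix \<sigma> assume "\<sigma> \<in> nonscarf_above w"
  then show "\<sigma> \<in> above w - scarf"
    using not_scarf_if_strict_divisor[of _ \<sigma>] by (auto simp: nonscarf_above_def)
next
  fix \<sigma> assume \<sigma>: "\<sigma> \<in> above w - scarf"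
  then have "0 < lab \<sigma> s" for s
    by (auto simp: above_def dest: spec[of _ s])
  then have "\<exists>i\<in>V. \<forall>s. g i s < lab \<sigma> s"
    using ex_strict_divisor_if_not_scarf[of \<sigma>] \<sigma> by (auto simp: above_def)
  then show "\<sigma> \<in> nonscarf_above w"
    using \<sigma> by (auto simp: nonscarf_above_def)
qed

lemma interior_above_iff: "\<sigma> \<in> interior \<and> (\<forall>s. w s < lab \<sigma> s) \<longleftrightarrow> \<sigma> \<in> above w - nonscarf_above w"
  
  unfolding nonscarf_above_eq
  by (auto simp: interior_def above_def dest: scarf_subset intro: le_less_trans[OF le0])

text \<open>A generator dividing the monomial of \<open>w\<close> would strictly divide the label of
  \<open>\<sigma>\<close>. Hence no interior face contributes in a multidegree outside
  \<open>M\<close>.\<close>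

lemma standard_if_interior_above:
  assumes "\<sigma> \<in> interior" "\<And>s. w s < lab \<sigma> s"
  shows "standard w"
  unfolding standard_def
proof (intro ballI, rule ccontr)
  fix v assume "v \<in> V" "\<not> (\<exists>s. w s < g v s)"
  then have "g v s < lab \<sigma> s" for s
    using assms(2)[of s] by (metis leI le_less_trans)
  then show False
    using assms(1) not_scarf_if_strict_divisor[OF \<open>v \<in> V\<close>] by (auto simp: interior_def)
qed

section \<open>Acyclic families of sets above a given exponent vector\<close>

lemma above_upclosed: "upclosed V (above w)"
  by (auto simp: upclosed_def above_iff subset_iff) blast

lemma strict_multiples_upclosed:
  "upclosed V {\<sigma> \<in> above w. \<exists>i\<in>S. \<forall>s. g i s < lab \<sigma> s}"
  unfolding upclosed_def
proof (intro conjI ballI allI impI; (elim conjE)?)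
  show "{\<sigma> \<in> above w. \<exists>i\<in>S. \<forall>s. g i s < lab \<sigma> s} \<subseteq> Pow V"
    by (auto simp: above_def)
next
  fix \<sigma> \<tau> assume \<sigma>: "\<sigma> \<in> {\<sigma> \<in> above w. \<exists>i\<in>S. \<forall>s. g i s < lab \<sigma> s}" and \<tau>: "\<sigma> \<subseteq> \<tau>" "\<tau> \<subseteq> V"
  then have "lab \<sigma> s \<le> lab \<tau> s" for s
    by (intro lcm_label_mono finite_face)
  then show "\<tau> \<in> {\<sigma> \<in> above w. \<exists>i\<in>S. \<forall>s. g i s < lab \<sigma> s}"
    using \<sigma> \<tau>(2) by (auto simp: above_def) (meson less_le_trans)+
qed

lemma nonscarf_above_upclosed: "upclosed V (nonscarf_above w)"
  unfolding nonscarf_above_def by (rule strict_multiples_upclosed)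

text \<open>Whether \<open>g j\<close> strictly divides the label of a face does not depend on whether \<open>j\<close> belongs to
  the face, and the generators \<open>j\<close> are used one after the other as cone points.\<close>

lemma nonscarf_above_acyclic: "acyclic_on TYPE('k::comm_ring_1) V R (nonscarf_above w)"
proof -
  define N where "N = (\<lambda>S. {\<sigma> \<in> above w. \<exists>i\<in>S. \<forall>s. g i s < lab \<sigma> s})"
  have "acyclic_on TYPE('k) V R (N S)" if "finite S" "S \<subseteq> V" for S
    using that
  proof (induction S)
    case empty
    then show ?case
      by (simp add: N_def acyclic_on_empty finite_V order_R)
  next
    case (insert j S)
    show ?case
    proof (rule acyclic_on_cone_extension[OF finite_V order_R, where X' = "N S" and p = j])
      show "acyclic_on TYPE('k) V R (N S)"
        using insert by simp
      show "upclosed V (N (insert j S))" "upclosed V (N S)"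
        unfolding N_def by (rule strict_multiples_upclosed)+
      show "N S \<subseteq> N (insert j S)"
        by (auto simp: N_def)
      show "j \<in> V"
        using insert by simp
      fix \<sigma> assume \<sigma>: "\<sigma> \<subseteq> V"
      have D: "\<rho> \<in> N (insert j S) - N S \<longleftrightarrow>
          (\<forall>s. w s < lab \<rho> s) \<and> (\<forall>s. g j s < lab \<rho> s) \<and> \<not> (\<exists>i\<in>S. \<forall>s. g i s < lab \<rho> s)"
        if "\<rho> \<subseteq> V" for \<rho>
        using that by (auto simp: N_def above_def)
      have eq: "lab (insert j \<sigma>) = lab (\<sigma> - {j})"
        if "(\<forall>s. g j s < lab (insert j \<sigma>) s) \<or> (\<forall>s. g j s < lab (\<sigma> - {j}) s)"
      proof
        fix s
        have "g j s < lab (insert j \<sigma>) s \<or> g j s < lab (\<sigma> - {j}) s"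
          using that by blast
        then show "lab (insert j \<sigma>) s = lab (\<sigma> - {j}) s"
          by (auto simp: lcm_label_insert_remove[OF finite_face[OF \<sigma>]] max_def split: if_splits)
      qed
      show "insert j \<sigma> \<in> N (insert j S) - N S \<longleftrightarrow> \<sigma> - {j} \<in> N (insert j S) - N S"
      proof (cases "(\<forall>s. g j s < lab (insert j \<sigma>) s) \<or> (\<forall>s. g j s < lab (\<sigma> - {j}) s)")
        case True
        show ?thesis
          using \<sigma> \<open>j \<in> V\<close> by (subst (1 2) D) (auto simp: eq[OF True])
      next
        case False
        then show ?thesis
          using \<sigma> \<open>j \<in> V\<close> by (subst (1 2) D) auto
      qed
    qed
  qed
  from this[OF finite_V order_refl] show ?thesis
    by (simp add: N_def nonscarf_above_def)
qed

definition corner :: "'a set" where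
  "corner = range pure"

lemma corner_remove_not_above: "corner - {pure s} \<notin> above w"
proof
  assume "corner - {pure s} \<in> above w"
  then obtain t where "w s < g (pure t) s" "pure t \<noteq> pure s"
    by (auto simp: above_iff corner_def)
  then show False
    by (cases "s = t") (auto simp: pure_eq_0)
qed

text \<open>The filtration \<open>A S\<close> asks that at some variable \<open>s\<close> in
  \<open>S\<close> a generator other than \<open>pure s\<close> exceeds \<open>w\<close>. For the
  sets that are new in \<open>A (insert t S)\<close>, the variable \<open>t\<close> is covered
  without \<open>pure t\<close>, and \<open>pure t\<close> has exponent zero elsewhere, so
  \<open>pure t\<close> can be toggled.\<close>

lemma above_corner_acyclic:
  assumes w: "standard w"
  shows "acyclic_on TYPE('k::comm_ring_1) V R (above w - {corner})"
proof -
  define A where "A = (\<lambda>S. {\<sigma> \<in> above w. \<exists>s\<in>S. \<exists>v\<in>\<sigma>. v \<noteq> pure s \<and> w s < g v s})"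
  have up: "upclosed V (A S)" for S
    unfolding upclosed_def
  proof (intro conjI ballI allI impI; (elim conjE)?)
    show "A S \<subseteq> Pow V"
      by (auto simp: A_def above_def)
  next
    fix \<sigma> \<tau> assume \<sigma>: "\<sigma> \<in> A S" and \<tau>: "\<sigma> \<subseteq> \<tau>" "\<tau> \<subseteq> V"
    then have "\<tau> \<in> above w"
      using above_upclosed[of w] by (auto simp: A_def upclosed_def)
    then show "\<tau> \<in> A S"
      using \<sigma> \<tau>(1) unfolding A_def mem_Collect_eq by (meson subsetD)
  qed
  have "acyclic_on TYPE('k) V R (A S)" for S
  proof (induction rule: finite_induct[OF finite[of S]])
    case 1
    then show ?case
      by (simp add: A_def acyclic_on_empty finite_V order_R)
  next
    case (2 t S)
    show ?case
    proof (rule acyclic_on_cone_extension[OF finite_V order_R, where X' = "A S" and p = "pure t"])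
      show "upclosed V (A (insert t S))" "upclosed V (A S)"
        by (rule up)+
      show "acyclic_on TYPE('k) V R (A S)" "A S \<subseteq> A (insert t S)" "pure t \<in> V"
        using 2 pure_in by (auto simp: A_def)
      fix \<sigma> assume \<sigma>: "\<sigma> \<subseteq> V"
      have D: "\<rho> \<in> A (insert t S) - A S \<longleftrightarrow> (\<forall>s. s \<noteq> t \<longrightarrow> (\<exists>v\<in>\<rho>. w s < g v s)) \<and>
          (\<exists>v\<in>\<rho>. v \<noteq> pure t \<and> w t < g v t) \<and> \<not> (\<exists>s\<in>S. \<exists>v\<in>\<rho>. v \<noteq> pure s \<and> w s < g v s)"
        if "\<rho> \<subseteq> V" for \<rho>
        using that by (auto simp: A_def above_iff)
      have iff: "(\<exists>v\<in>insert (pure t) \<sigma>. P v) \<longleftrightarrow> (\<exists>v\<in>\<sigma> - {pure t}. P v)" if "\<not> P (pure t)" for P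
        using that by auto
      have notS: "s \<noteq> t" if "s \<in> S" for s
        using that 2 by blast
      have "\<not> w s < g (pure t) s" if "s \<noteq> t" for s
        using that by (simp add: pure_eq_0)
      then have eqs: "(\<forall>s. s \<noteq> t \<longrightarrow> (\<exists>v\<in>insert (pure t) \<sigma>. w s < g v s)) \<longleftrightarrow>
          (\<forall>s. s \<noteq> t \<longrightarrow> (\<exists>v\<in>\<sigma> - {pure t}. w s < g v s))"
        "(\<exists>s\<in>S. \<exists>v\<in>insert (pure t) \<sigma>. v \<noteq> pure s \<and> w s < g v s) \<longleftrightarrow>
          (\<exists>s\<in>S. \<exists>v\<in>\<sigma> - {pure t}. v \<noteq> pure s \<and> w s < g v s)"
        "(\<exists>v\<in>insert (pure t) \<sigma>. v \<noteq> pure t \<and> w t < g v t) \<longleftrightarrow>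
          (\<exists>v\<in>\<sigma> - {pure t}. v \<noteq> pure t \<and> w t < g v t)"
        using notS by blast+
      have sub: "insert (pure t) \<sigma> \<subseteq> V" "\<sigma> - {pure t} \<subseteq> V"
        using \<sigma> pure_in[of t] by auto
      show "insert (pure t) \<sigma> \<in> A (insert t S) - A S \<longleftrightarrow>
          \<sigma> - {pure t} \<in> A (insert t S) - A S"
        by (simp only: D[OF sub(1)] D[OF sub(2)] eqs)
    qed
  qed
  \<comment> \<open>In a set that is left over, only \<open>pure s\<close> exceeds \<open>w\<close>
    at \<open>s\<close>. As \<open>w\<close> is standard, every generator exceeds \<open>w\<close>
    somewhere, so the set consists of exactly the pure powers.\<close>
  moreover have "A UNIV = above w - {corner}"
  proof (intro set_eqI iffI)
    fix \<sigma> assume \<sigma>: "\<sigma> \<in> A UNIV"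
    then obtain s v where v: "v \<in> \<sigma>" "v \<noteq> pure s" "w s < g v s"
      by (auto simp: A_def)
    have "v \<notin> corner"
    proof
      assume "v \<in> corner"
      then obtain t where "v = pure t"
        by (auto simp: corner_def)
      then show False
        using v by (cases "s = t") (auto simp: pure_eq_0)
    qed
    then show "\<sigma> \<in> above w - {corner}"
      using \<sigma> v by (auto simp: A_def)
  next
    fix \<sigma> assume \<sigma>: "\<sigma> \<in> above w - {corner}"
    show "\<sigma> \<in> A UNIV"
    proof (rule ccontr)
      assume notA: "\<sigma> \<notin> A UNIV"
      then have only: "v = pure s" if "v \<in> \<sigma>" "w s < g v s" for v s
        using \<sigma> that notA unfolding A_def by blast
      have "pure s \<in> \<sigma>" for s
      proof -
        obtain v where "v \<in> \<sigma>" "w s < g v s"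
          using \<sigma> unfolding above_iff Diff_iff by blast
        then show ?thesis
          using only by metis
      qed
      moreover have "v \<in> corner" if "v \<in> \<sigma>" for v
      proof -
        have "v \<in> V"
          using \<sigma> that by (auto simp: above_def)
        then obtain s where "w s < g v s"
          using w unfolding standard_def by blast
        then show ?thesis
          using only[OF that] by (auto simp: corner_def)
      qed
      ultimately have "\<sigma> = corner"
        by (auto simp: corner_def)
      then show False
        using \<sigma> by simp
    qed
  qed
  ultimately show ?thesis
    by metis
qed

lemma pure_greater: "standard w \<Longrightarrow> w s < g (pure s) s"
  unfolding standard_def using pure_in[of s] pure_eq_0[of _ s] by (metis not_less0)

lemma corner_above: "standard w \<Longrightarrow> corner \<in> above w"
  using pure_greater pure_in by (auto simp: above_iff corner_def)

lemma card_corner: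
  assumes "standard w"
  shows "card corner = CARD('v)"
proof -
  have "inj pure"
  proof (rule injI)
    fix s t assume "pure s = pure t"
    then show "s = t"
      using pure_greater[OF assms, of s] pure_eq_0[of s t] by (cases "s = t") auto
  qed
  then show ?thesis
    by (simp add: corner_def card_image)
qed

text \<open>Each element of a Scarf face has a variable at which its deletion lowers the label, and
  two elements cannot share such a variable.\<close>

lemma card_scarf_le:
  assumes "\<sigma> \<in> scarf"
  shows "card \<sigma> \<le> CARD('v)"
proof -
  note fin = finite_face[OF scarf_subset[OF assms]]
  have "\<exists>s. lab (\<sigma> - {v}) s < g v s" if "v \<in> \<sigma>" for v
  proof (rule ccontr)
    assume "\<not> ?thesis"
    then have "lab (\<sigma> - {v}) s = lab \<sigma> s" for s
      using lcm_label_insert_remove[OF fin, of g v s] that by (simp add: insert_absorb not_less)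
    then have "\<sigma> - {v} = \<sigma>"
      using scarf_subset[OF assms] by (intro scarf_eqI[OF assms]) auto
    then show False
      using that by blast
  qed
  then obtain f where f: "\<And>v. v \<in> \<sigma> \<Longrightarrow> lab (\<sigma> - {v}) (f v) < g v (f v)"
    by metis
  have "inj_on f \<sigma>"
  proof (rule inj_onI, rule ccontr)
    fix u v assume uv: "u \<in> \<sigma>" "v \<in> \<sigma>" "f u = f v" "u \<noteq> v"
    then have "g u (f u) \<le> lab (\<sigma> - {v}) (f u)" "g v (f u) \<le> lab (\<sigma> - {u}) (f u)"
      using fin by (auto intro!: le_lcm_label)
    then show False
      using f[OF uv(1)] f[OF uv(2)] uv(3) by simp
  qed
  then show ?thesis
    using card_inj_on_le[of f \<sigma> UNIV] by simp
qed

end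

section \<open>Cohomology of the quotient complex of interior faces\<close>

context generic_labels
begin

text \<open>The differential of the quotient: interior faces above \<open>w\<close> represent
  cochains on \<open>above w\<close> modulo those on \<open>nonscarf_above w\<close>, and
  \<open>restrict_to interior\<close> is the projection, the same for every
  \<open>w\<close>.\<close>

definition scarf_coboundary :: "('a set \<Rightarrow> 'k::comm_ring_1) \<Rightarrow> 'a set \<Rightarrow> 'k" where
  "scarf_coboundary \<phi> = restrict_to interior (coboundary V R \<phi>)"

definition interior_above :: "('v \<Rightarrow> nat) \<Rightarrow> nat \<Rightarrow> 'a set set" where
  "interior_above w m = {\<sigma> \<in> interior. (\<forall>s. w s < lab \<sigma> s) \<and> card \<sigma> = m}"

lemma interior_above_eq:
  "interior_above w m = {\<sigma> \<in> above w. card \<sigma> = m} - nonscarf_above w"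
  using interior_above_iff[of _ w] unfolding interior_above_def by blast

lemma restrict_to_interior_eq:
  assumes "supported_on \<phi> (above w)"
  shows "restrict_to interior \<phi> = restrict_to (- nonscarf_above w) \<phi>"
proof
  fix \<sigma>
  have "\<sigma> \<in> above w \<Longrightarrow> \<sigma> \<in> interior \<longleftrightarrow> \<sigma> \<notin> nonscarf_above w"
    using interior_above_iff[of \<sigma> w] by (auto simp: above_def)
  then show "restrict_to interior \<phi> \<sigma> = restrict_to (- nonscarf_above w) \<phi> \<sigma>"
    using assms by (cases "\<sigma> \<in> above w") (auto simp: restrict_to_def supported_on_def)
qed

lemma supported_on_above:
  "supported_on \<phi> (interior_above w m) \<Longrightarrow> supported_on \<phi> {\<sigma> \<in> above w. card \<sigma> = m}"
  by (erule supported_on_mono) (auto simp: interior_above_eq)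

lemma supported_on_restrict_interior:
  assumes "supported_on \<phi> {\<sigma> \<in> above w. card \<sigma> = m}"
  shows "supported_on (restrict_to interior \<phi>) (interior_above w m)"
proof -
  have "supported_on \<phi> (above w)"
    using assms by (rule supported_on_mono) auto
  then show ?thesis
    using assms unfolding restrict_to_interior_eq[OF \<open>supported_on \<phi> (above w)\<close>] interior_above_eq
    by (auto simp: supported_on_def restrict_to_def)
qed

lemma restrict_interior_eq_self:
  assumes "supported_on \<phi> (interior_above w m)"
  shows "restrict_to interior \<phi> = \<phi>"
  using assms unfolding restrict_to_eq_self_iff
  by (rule supported_on_mono) (auto simp: interior_above_def)

lemma supported_on_nonscarf:
  assumes "supported_on \<phi> {\<sigma> \<in> above w. card \<sigma> = m}" "restrict_to interior \<phi> = 0"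
  shows "supported_on \<phi> {\<sigma> \<in> nonscarf_above w. card \<sigma> = m}"
  unfolding supported_on_def
proof (intro allI impI, rule ccontr)
  fix \<sigma> assume *: "\<sigma> \<notin> {\<sigma> \<in> nonscarf_above w. card \<sigma> = m}" "\<phi> \<sigma> \<noteq> 0"
  then have "\<sigma> \<in> above w" "card \<sigma> = m"
    using assms(1) by (auto simp: supported_on_def)
  then have "\<sigma> \<in> interior"
    using * interior_above_iff[of \<sigma> w] by blast
  then show False
    using * fun_cong[OF assms(2), of \<sigma>] by (simp add: restrict_to_def)
qed

lemma restrict_interior_nonscarf:
  assumes "supported_on \<phi> (nonscarf_above w)"
  shows "restrict_to interior \<phi> = 0"
proof
  fix \<sigma>
  show "restrict_to interior \<phi> \<sigma> = 0 \<sigma>"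
    using assms by (auto simp: restrict_to_def supported_on_def interior_def nonscarf_above_eq)
qed

lemma restrict_to_diff: "restrict_to X (\<phi> - \<psi>) = restrict_to X \<phi> - restrict_to X \<psi>"
  for \<phi> \<psi> :: "'b \<Rightarrow> 'k::ab_group_add"
  by (auto simp: restrict_to_def fun_eq_iff)

text \<open>The projection is a cochain map: what it discards lives on the upward closed
  \<open>nonscarf_above w\<close>, and so does the coboundary of that part.\<close>

lemma scarf_coboundary_restrict:
  assumes "supported_on \<phi> (above w)"
  shows "scarf_coboundary (restrict_to interior \<phi>) = scarf_coboundary \<phi>"
proof -
  have "supported_on (\<phi> - restrict_to interior \<phi>) (nonscarf_above w)"
    using assms unfolding restrict_to_interior_eq[OF assms]
    by (auto simp: supported_on_def restrict_to_def)
  then have "supported_on (coboundary V R (\<phi> - restrict_to interior \<phi>)) (nonscarf_above w)"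
    by (rule coboundary_supported_on'[OF nonscarf_above_upclosed])
  then have "scarf_coboundary (\<phi> - restrict_to interior \<phi>) = 0"
    unfolding scarf_coboundary_def by (rule restrict_interior_nonscarf)
  then show ?thesis
    by (simp add: scarf_coboundary_def coboundary_diff restrict_to_diff)
qed

lemma interior_subset_above_0: "interior \<subseteq> above (\<lambda>_. 0)"
  by (auto simp: interior_def above_def dest: scarf_subset)

lemma scarf_coboundary_scarf_coboundary:
  assumes "supported_on \<phi> interior"
  shows "scarf_coboundary (scarf_coboundary \<phi>) = 0"
proof -
  have "supported_on (coboundary V R \<phi>) (above (\<lambda>_. 0))"
    by (rule coboundary_supported_on'[OF above_upclosed
          supported_on_mono[OF assms interior_subset_above_0]])
  from scarf_coboundary_restrict[OF this] show ?thesis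
    by (simp add: scarf_coboundary_def coboundary_coboundary[OF finite_V order_R] restrict_to_def
        fun_eq_iff)
qed

lemma scarf_coboundary_supported_on:
  assumes "supported_on \<phi> (interior_above w m)"
  shows "supported_on (scarf_coboundary \<phi>) (interior_above w (Suc m))"
  unfolding scarf_coboundary_def
  by (intro supported_on_restrict_interior coboundary_supported_on[OF above_upclosed finite_V]
      supported_on_above assms)

text \<open>Removing an element of \<open>corner\<close> leaves a variable uncovered, so no
  codimension-one face of it lies in \<open>above w\<close>. Evaluation at \<open>corner\<close> is
  thus well defined on cohomology.\<close>

lemma coboundary_corner:
  assumes "supported_on \<phi> (above w)"
  shows "coboundary V R \<phi> corner = 0"
proof -
  have "\<phi> (corner - {v}) = 0" if "v \<in> corner" for v
    using assms corner_remove_not_above[of _ w] that by (auto simp: supported_on_def corner_def)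
  then show ?thesis
    by (simp add: coboundary_def)
qed

lemma ex_nonscarf_primitive:
  fixes \<phi> :: "'a set \<Rightarrow> 'k::comm_ring_1"
  assumes "supported_on \<phi> {\<sigma> \<in> nonscarf_above w. card \<sigma> = m}" "coboundary V R \<phi> = 0"
  obtains \<psi> where "supported_on \<psi> {\<sigma> \<in> nonscarf_above w. Suc (card \<sigma>) = m}" "coboundary V R \<psi> = \<phi>"
  using nonscarf_above_acyclic[where 'k = 'k, of w] assms unfolding acyclic_on_def by blast

text \<open>Such a cocycle is a coboundary by acyclicity. It measures the ambiguity of a lift along
  the projection, so the corner value of a lift is unambiguous.\<close>

lemma nonscarf_cocycle_corner:
  fixes \<phi> :: "'a set \<Rightarrow> 'k::comm_ring_1"
  assumes "supported_on \<phi> {\<sigma> \<in> nonscarf_above w. card \<sigma> = m}" "coboundary V R \<phi> = 0"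
  shows "\<phi> corner = 0"
proof -
  obtain \<psi> where \<psi>: "supported_on \<psi> {\<sigma> \<in> nonscarf_above w. Suc (card \<sigma>) = m}"
    "coboundary V R \<psi> = \<phi>"
    using ex_nonscarf_primitive[OF assms] .
  have "supported_on \<psi> (above w)"
    using \<psi>(1) by (rule supported_on_mono) (auto simp: nonscarf_above_def)
  then show ?thesis
    using coboundary_corner \<psi>(2) by blast
qed

lemma ex_primitive:
  fixes \<phi> :: "'a set \<Rightarrow> 'k::comm_ring_1"
  assumes w: "standard w" and \<phi>: "supported_on \<phi> {\<sigma> \<in> above w. card \<sigma> = m}"
    "coboundary V R \<phi> = 0" "\<phi> corner = 0"
  obtains \<psi> where "supported_on \<psi> {\<sigma> \<in> above w. Suc (card \<sigma>) = m}" "coboundary V R \<psi> = \<phi>"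
proof -
  have "supported_on \<phi> {\<sigma> \<in> above w - {corner}. card \<sigma> = m}"
    using \<phi>(1,3) by (auto simp: supported_on_def)
  then obtain \<psi> where "supported_on \<psi> {\<sigma> \<in> above w - {corner}. Suc (card \<sigma>) = m}"
    "coboundary V R \<psi> = \<phi>"
    using above_corner_acyclic[OF w, where 'k = 'k] \<phi>(2) unfolding acyclic_on_def by blast
  then show ?thesis
    by (intro that[of \<psi>]) (auto elim: supported_on_mono)
qed

text \<open>The coboundary of a cocycle of the quotient lies in the acyclic kernel and has a
  primitive \<open>\<gamma>\<close> there; then \<open>\<phi> - \<gamma>\<close> is a genuine
  cocycle on \<open>above w\<close> that projects to \<open>\<phi>\<close>.\<close>

lemma ex_correction:
  fixes \<phi> :: "'a set \<Rightarrow> 'k::comm_ring_1"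
  assumes \<phi>: "supported_on \<phi> (interior_above w m)" "scarf_coboundary \<phi> = 0"
  obtains \<gamma> where "supported_on \<gamma> {\<sigma> \<in> nonscarf_above w. card \<sigma> = m}"
    "coboundary V R \<gamma> = coboundary V R \<phi>"
proof -
  have "supported_on (coboundary V R \<phi>) {\<sigma> \<in> nonscarf_above w. card \<sigma> = Suc m}"
    using \<phi>(2) by (intro supported_on_nonscarf
        coboundary_supported_on[OF above_upclosed finite_V] supported_on_above \<phi>(1))
      (simp add: scarf_coboundary_def)
  then obtain \<gamma> where "supported_on \<gamma> {\<sigma> \<in> nonscarf_above w. Suc (card \<sigma>) = Suc m}"
    "coboundary V R \<gamma> = coboundary V R \<phi>"
    by (rule ex_nonscarf_primitive) (rule coboundary_coboundary[OF finite_V order_R])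
  then show ?thesis
    using that by simp
qed

text \<open>The corner value is the only obstruction: a lift that vanishes there has a primitive on
  \<open>above w\<close>, and the projection of this primitive is one for
  \<open>\<phi>\<close>.\<close>

lemma ex_scarf_primitive:
  fixes \<phi> :: "'a set \<Rightarrow> 'k::comm_ring_1"
  assumes w: "standard w" and \<phi>: "supported_on \<phi> (interior_above w m)"
    and \<gamma>: "supported_on \<gamma> {\<sigma> \<in> nonscarf_above w. card \<sigma> = m}"
      "coboundary V R \<gamma> = coboundary V R \<phi>"
    and corner: "(\<phi> - \<gamma>) corner = 0"
  obtains \<psi> where "supported_on \<psi> (interior_above w (m - 1))" "scarf_coboundary \<psi> = \<phi>"
proof -
  have "supported_on (\<phi> - \<gamma>) {\<sigma> \<in> above w. card \<sigma> = m}"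
    by (intro supported_on_diff supported_on_above \<phi> supported_on_mono[OF \<gamma>(1)])
      (auto simp: nonscarf_above_def)
  moreover have "coboundary V R (\<phi> - \<gamma>) = 0"
    by (simp add: coboundary_diff \<gamma>(2))
  ultimately obtain \<psi> where \<psi>: "supported_on \<psi> {\<sigma> \<in> above w. Suc (card \<sigma>) = m}"
    "coboundary V R \<psi> = \<phi> - \<gamma>"
    using corner by (rule ex_primitive[OF w])
  have above: "supported_on \<psi> (above w)"
    using \<psi>(1) by (rule supported_on_mono) auto
  \<comment> \<open>For \<open>m = 0\<close> the cochain \<open>\<psi>\<close> is zero, so the
    truncated subtraction does no harm.\<close>
  have "supported_on \<psi> {\<sigma> \<in> above w. card \<sigma> = m - 1}"
    using \<psi>(1) by (rule supported_on_mono) auto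
  then have 1: "supported_on (restrict_to interior \<psi>) (interior_above w (m - 1))"
    by (rule supported_on_restrict_interior)
  have "restrict_to interior \<gamma> = 0"
    using \<gamma>(1) by (intro restrict_interior_nonscarf) (auto elim: supported_on_mono)
  then have "restrict_to interior (\<phi> - \<gamma>) = \<phi>"
    unfolding restrict_to_diff by (simp add: restrict_interior_eq_self[OF \<phi>])
  then have 2: "scarf_coboundary (restrict_to interior \<psi>) = \<phi>"
    by (simp add: scarf_coboundary_restrict[OF above]) (simp add: scarf_coboundary_def \<psi>(2))
  from 1 2 show ?thesis
    by (rule that)
qed

text \<open>\<open>corner\<close> has \<open>CARD('v)\<close> elements, so in every other degree the
  obstruction vanishes by cardinality.\<close>

lemma scarf_exact:
  fixes \<phi> :: "'a set \<Rightarrow> 'k::comm_ring_1"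
  assumes w: "standard w" and \<phi>: "supported_on \<phi> (interior_above w m)" "scarf_coboundary \<phi> = 0"
    and m: "m \<noteq> CARD('v)"
  obtains \<psi> where "supported_on \<psi> (interior_above w (m - 1))" "scarf_coboundary \<psi> = \<phi>"
proof -
  obtain \<gamma> where \<gamma>: "supported_on \<gamma> {\<sigma> \<in> nonscarf_above w. card \<sigma> = m}"
    "coboundary V R \<gamma> = coboundary V R \<phi>"
    using ex_correction[OF \<phi>] .
  have "\<phi> corner = 0" "\<gamma> corner = 0"
    using \<phi>(1) \<gamma>(1) card_corner[OF w] m by (auto simp: supported_on_def interior_above_def)
  then have "(\<phi> - \<gamma>) corner = 0"
    by simp
  then show ?thesis
    by (rule ex_scarf_primitive[OF w \<phi>(1) \<gamma>]) (rule that)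
qed

section \<open>The fundamental class on top-dimensional faces\<close>

definition indicator_fun :: "'a set \<Rightarrow> 'a set \<Rightarrow> 'k::comm_ring_1" where
  "indicator_fun \<sigma> = (\<lambda>\<tau>. if \<tau> = \<sigma> then 1 else 0)"

definition top_faces :: "'a set set" where
  "top_faces = {\<sigma> \<in> interior. card \<sigma> = CARD('v)}"

text \<open>The vector \<open>lab \<sigma> s - 1\<close> is the largest \<open>w\<close> with
  \<open>\<sigma>\<close> above it. A correction for it is also supported on
  \<open>nonscarf_above w\<close> for every smaller \<open>w\<close>, so one choice serves all
  multidegrees.\<close>

definition correction :: "'a set \<Rightarrow> 'a set \<Rightarrow> 'k::comm_ring_1" where
  "correction \<sigma> = (SOME \<gamma>. supported_on \<gamma> {\<tau> \<in> nonscarf_above (\<lambda>s. lab \<sigma> s - 1). card \<tau> = CARD('v)} \<and>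
     coboundary V R \<gamma> = coboundary V R (indicator_fun \<sigma>))"

text \<open>The value of the fundamental class at a top-dimensional face, that is, its orientation.\<close>

definition orientation :: "'a set \<Rightarrow> 'k::comm_ring_1" where
  "orientation \<sigma> = (indicator_fun \<sigma> - correction \<sigma>) corner"

lemma finite_interior: "finite interior"
  by (rule finite_subset[of _ "Pow V"]) (auto simp: interior_def finite_V dest: scarf_subset)

lemma finite_top_faces: "finite top_faces"
  using finite_interior by (simp add: top_faces_def)

lemma scarf_coboundary_top:
  assumes "supported_on \<phi> (interior_above w CARD('v))"
  shows "scarf_coboundary \<phi> = 0"
proof -
  have "interior_above w (Suc CARD('v)) = {}"
    using card_scarf_le by (fastforce simp: interior_above_def interior_def)
  then show ?thesis
    using scarf_coboundary_supported_on[OF assms] by (auto simp: supported_on_def fun_eq_iff)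
qed

lemma correction:
  assumes "\<sigma> \<in> top_faces"
  shows "supported_on (correction \<sigma> :: 'a set \<Rightarrow> 'k::comm_ring_1)
      {\<tau> \<in> nonscarf_above (\<lambda>s. lab \<sigma> s - 1). card \<tau> = CARD('v)}"
    and "coboundary V R (correction \<sigma>) = (coboundary V R (indicator_fun \<sigma>) :: 'a set \<Rightarrow> 'k)"
proof -
  have "\<forall>s. lab \<sigma> s - 1 < lab \<sigma> s"
    using assms by (auto simp: top_faces_def interior_def)
  then have "supported_on (indicator_fun \<sigma> :: 'a set \<Rightarrow> 'k)
      (interior_above (\<lambda>s. lab \<sigma> s - 1) CARD('v))"
    using assms by (auto simp: supported_on_def indicator_fun_def interior_above_def top_faces_def)
  from ex_correction[OF this scarf_coboundary_top[OF this]]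
  have "\<exists>\<gamma> :: 'a set \<Rightarrow> 'k.
      supported_on \<gamma> {\<tau> \<in> nonscarf_above (\<lambda>s. lab \<sigma> s - 1). card \<tau> = CARD('v)} \<and>
      coboundary V R \<gamma> = coboundary V R (indicator_fun \<sigma>)"
    by blast
  from someI_ex[OF this]
  show "supported_on (correction \<sigma> :: 'a set \<Rightarrow> 'k)
      {\<tau> \<in> nonscarf_above (\<lambda>s. lab \<sigma> s - 1). card \<tau> = CARD('v)}"
    and "coboundary V R (correction \<sigma>) = (coboundary V R (indicator_fun \<sigma>) :: 'a set \<Rightarrow> 'k)"
    unfolding correction_def by blast+
qed

text \<open>Evaluation on the fundamental class; it becomes the augmentation in a single
  multidegree.\<close>

definition pairing :: "('a set \<Rightarrow> 'k::comm_ring_1) \<Rightarrow> 'k" where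
  "pairing \<phi> = (\<Sum>\<sigma>\<in>top_faces. \<phi> \<sigma> * orientation \<sigma>)"

text \<open>The same linear combination that writes \<open>\<phi>\<close> in indicators, taken of
  the corrections, gives \<open>\<gamma>\<close>; by linearity the corner value of the lift is the
  pairing.\<close>

lemma ex_lift:
  fixes \<phi> :: "'a set \<Rightarrow> 'k::comm_ring_1"
  assumes \<phi>: "supported_on \<phi> (interior_above w CARD('v))"
  obtains \<gamma> where "supported_on \<gamma> {\<sigma> \<in> nonscarf_above w. card \<sigma> = CARD('v)}"
    "coboundary V R \<gamma> = coboundary V R \<phi>" "(\<phi> - \<gamma>) corner = pairing \<phi>"
proof -
  define F where "F = interior_above w CARD('v)"
  have F: "F \<subseteq> top_faces" "finite F"
    using finite_interior by (auto simp: F_def interior_above_def top_faces_def)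
  define \<gamma> where "\<gamma> = (\<Sum>\<sigma>\<in>F. (\<lambda>\<tau>. \<phi> \<sigma> * correction \<sigma> \<tau>))"
  have \<phi>_eq: "\<phi> = (\<Sum>\<sigma>\<in>F. (\<lambda>\<tau>. \<phi> \<sigma> * indicator_fun \<sigma> \<tau>))"
    using \<phi> F(2) by (auto simp: fun_eq_iff sum_fun_apply indicator_fun_def supported_on_def F_def
        if_distrib[of "(*) _"] cong: if_cong)
  have supp: "supported_on (correction \<sigma> :: 'a set \<Rightarrow> 'k) {\<tau> \<in> nonscarf_above w. card \<tau> = CARD('v)}"
    if "\<sigma> \<in> F" for \<sigma>
  proof (rule supported_on_mono[OF correction(1)])
    show "\<sigma> \<in> top_faces"
      using that F(1) by blast
    have le: "w s \<le> lab \<sigma> s - 1" for s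
      using that by (auto simp: F_def interior_above_def dest: spec[of _ s])
    show "{\<tau> \<in> nonscarf_above (\<lambda>s. lab \<sigma> s - 1). card \<tau> = CARD('v)} \<subseteq>
        {\<tau> \<in> nonscarf_above w. card \<tau> = CARD('v)}"
      by (auto simp: nonscarf_above_def above_def intro: le_less_trans[OF le])
  qed
  show ?thesis
  proof (rule that[of \<gamma>])
    show "supported_on \<gamma> {\<sigma> \<in> nonscarf_above w. card \<sigma> = CARD('v)}"
      using supp unfolding \<gamma>_def supported_on_def sum_fun_apply
      by (intro allI impI sum.neutral ballI) simp
    have "coboundary V R \<gamma> = (\<Sum>\<sigma>\<in>F. (\<lambda>\<tau>. \<phi> \<sigma> * coboundary V R (correction \<sigma>) \<tau>))"
      by (simp only: \<gamma>_def coboundary_sum coboundary_scale)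
    also have "\<dots> = (\<Sum>\<sigma>\<in>F. (\<lambda>\<tau>. \<phi> \<sigma> * coboundary V R (indicator_fun \<sigma>) \<tau>))"
      using F(1) by (intro sum.cong refl) (use correction(2) in \<open>metis subsetD\<close>)
    also have "\<dots> = coboundary V R \<phi>"
      by (subst \<phi>_eq) (simp only: coboundary_sum coboundary_scale)
    finally show "coboundary V R \<gamma> = coboundary V R \<phi>" .
    have "(\<phi> - \<gamma>) corner = (\<Sum>\<sigma>\<in>F. \<phi> \<sigma> * indicator_fun \<sigma> corner) - (\<Sum>\<sigma>\<in>F. \<phi> \<sigma> * correction \<sigma> corner)"
      by (subst \<phi>_eq) (simp only: fun_diff_def \<gamma>_def sum_fun_apply)
    also have "\<dots> = (\<Sum>\<sigma>\<in>F. \<phi> \<sigma> * orientation \<sigma>)"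
      by (simp add: orientation_def right_diff_distrib sum_subtractf)
    also have "\<dots> = pairing \<phi>"
      unfolding pairing_def using F finite_top_faces \<phi>
      by (intro sum.mono_neutral_left) (auto simp: supported_on_def F_def)
    finally show "(\<phi> - \<gamma>) corner = pairing \<phi>" .
  qed
qed

lemma pairing_eq_0_imp_coboundary:
  fixes \<phi> :: "'a set \<Rightarrow> 'k::comm_ring_1"
  assumes w: "standard w" and \<phi>: "supported_on \<phi> (interior_above w CARD('v))" and 0: "pairing \<phi> = 0"
  obtains \<psi> where "supported_on \<psi> (interior_above w (CARD('v) - 1))" "scarf_coboundary \<psi> = \<phi>"
proof -
  obtain \<gamma> where \<gamma>: "supported_on \<gamma> {\<sigma> \<in> nonscarf_above w. card \<sigma> = CARD('v)}"
    "coboundary V R \<gamma> = coboundary V R \<phi>" "(\<phi> - \<gamma>) corner = pairing \<phi>"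
    using ex_lift[OF \<phi>] .
  have "(\<phi> - \<gamma>) corner = 0"
    unfolding \<gamma>(3) by (rule 0)
  then show ?thesis
    by (rule ex_scarf_primitive[OF w \<phi> \<gamma>(1,2)]) (rule that)
qed

text \<open>Two lifts of one cochain differ by a cocycle on \<open>nonscarf_above w\<close>, which
  vanishes at \<open>corner\<close>. So the pairing can be computed from any lift, not only from the
  chosen corrections.\<close>

lemma pairing_eq_corner:
  fixes \<zeta> :: "'a set \<Rightarrow> 'k::comm_ring_1"
  assumes \<zeta>: "supported_on \<zeta> {\<sigma> \<in> above w. card \<sigma> = CARD('v)}" "coboundary V R \<zeta> = 0"
  shows "pairing (restrict_to interior \<zeta>) = \<zeta> corner"
proof -
  let ?\<phi> = "restrict_to interior \<zeta>"
  have \<phi>: "supported_on ?\<phi> (interior_above w CARD('v))"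
    by (rule supported_on_restrict_interior[OF \<zeta>(1)])
  obtain \<gamma> where \<gamma>: "supported_on \<gamma> {\<sigma> \<in> nonscarf_above w. card \<sigma> = CARD('v)}"
    "coboundary V R \<gamma> = coboundary V R ?\<phi>" "(?\<phi> - \<gamma>) corner = pairing ?\<phi>"
    using ex_lift[OF \<phi>] .
  have "restrict_to interior \<gamma> = 0"
    using \<gamma>(1) by (intro restrict_interior_nonscarf) (auto elim: supported_on_mono)
  then have "restrict_to interior (?\<phi> - \<gamma> - \<zeta>) = 0"
    by (auto simp: restrict_to_def fun_eq_iff split: if_splits)
  moreover have "supported_on (?\<phi> - \<gamma> - \<zeta>) {\<sigma> \<in> above w. card \<sigma> = CARD('v)}"
    by (intro supported_on_diff supported_on_above \<phi>(1) \<zeta>(1) supported_on_mono[OF \<gamma>(1)])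
      (auto simp: nonscarf_above_def)
  ultimately have "supported_on (?\<phi> - \<gamma> - \<zeta>) {\<sigma> \<in> nonscarf_above w. card \<sigma> = CARD('v)}"
    by (intro supported_on_nonscarf)
  moreover have "coboundary V R (?\<phi> - \<gamma> - \<zeta>) = 0"
    by (simp add: coboundary_diff \<gamma>(2) \<zeta>(2))
  ultimately have "(?\<phi> - \<gamma> - \<zeta>) corner = 0"
    by (rule nonscarf_cocycle_corner)
  then show ?thesis
    using \<gamma>(3) by simp
qed

text \<open>\<open>coboundary V R \<psi>\<close> is itself a lift, and it vanishes at
  \<open>corner\<close>.\<close>

lemma pairing_scarf_coboundary:
  fixes \<psi> :: "'a set \<Rightarrow> 'k::comm_ring_1"
  assumes \<psi>: "supported_on \<psi> (interior_above w m)" "Suc m = CARD('v)"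
  shows "pairing (scarf_coboundary \<psi>) = 0"
proof -
  have "supported_on (coboundary V R \<psi>) {\<sigma> \<in> above w. card \<sigma> = CARD('v)}"
    using coboundary_supported_on[OF above_upclosed finite_V supported_on_above[OF \<psi>(1)]] \<psi>(2)
    by metis
  then have "pairing (scarf_coboundary \<psi>) = coboundary V R \<psi> corner"
    unfolding scarf_coboundary_def
    by (rule pairing_eq_corner) (rule coboundary_coboundary[OF finite_V order_R])
  also have "\<dots> = 0"
    by (rule coboundary_corner[of _ w])
      (rule supported_on_mono[OF supported_on_above[OF \<psi>(1)]], auto)
  finally show ?thesis .
qed

text \<open>The indicator of \<open>corner\<close> need not be a cocycle, but its coboundary avoids
  \<open>corner\<close> by cardinality. Acyclicity away from \<open>corner\<close> gives
  \<open>\<eta>\<close> with the same coboundary, and the difference is a cocycle with value 1 at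
  \<open>corner\<close>.\<close>

lemma ex_pairing_eq_1:
  assumes w: "standard w"
  obtains \<phi> :: "'a set \<Rightarrow> 'k::comm_ring_1"
  where "supported_on \<phi> (interior_above w CARD('v))" "pairing \<phi> = 1"
proof -
  let ?\<chi> = "indicator_fun corner :: 'a set \<Rightarrow> 'k"
  have \<chi>: "supported_on ?\<chi> {\<sigma> \<in> above w. card \<sigma> = CARD('v)}"
    using corner_above[OF w] card_corner[OF w] by (auto simp: supported_on_def indicator_fun_def)
  have "supported_on (coboundary V R ?\<chi>) {\<sigma> \<in> above w - {corner}. card \<sigma> = Suc CARD('v)}"
    using coboundary_supported_on[OF above_upclosed finite_V \<chi>, of R] card_corner[OF w]
    by (auto simp: supported_on_def)
  moreover have "coboundary V R (coboundary V R ?\<chi>) = 0"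
    by (rule coboundary_coboundary[OF finite_V order_R])
  ultimately obtain \<eta> where \<eta>: "supported_on \<eta> {\<sigma> \<in> above w - {corner}. Suc (card \<sigma>) = Suc CARD('v)}"
    "coboundary V R \<eta> = coboundary V R ?\<chi>"
    using above_corner_acyclic[OF w, where 'k = 'k] unfolding acyclic_on_def by blast
  have supp: "supported_on (?\<chi> - \<eta>) {\<sigma> \<in> above w. card \<sigma> = CARD('v)}"
    by (intro supported_on_diff \<chi> supported_on_mono[OF \<eta>(1)]) auto
  have "pairing (restrict_to interior (?\<chi> - \<eta>)) = (?\<chi> - \<eta>) corner"
    by (rule pairing_eq_corner[OF supp]) (simp add: coboundary_diff \<eta>(2))
  also have "\<dots> = 1"
    using \<eta>(1) by (auto simp: supported_on_def indicator_fun_def)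
  finally show ?thesis
    by (rule that[OF supported_on_restrict_interior[OF supp]])
qed

text \<open>A face whose label misses the variable \<open>s\<close> is extended by a generator whose exponent of \<open>s\<close> is
  as small as possible among those that do not raise the other exponents.\<close>

lemma boundary_face_not_facet:
  assumes \<sigma>: "\<sigma> \<in> scarf" and s: "lab \<sigma> s = 0"
  obtains i where "i \<notin> \<sigma>" "insert i \<sigma> \<in> scarf"
proof -
  note sub = scarf_subset[OF \<sigma>]
  note fin = finite_face[OF sub]
  define C where "C = {i \<in> V - \<sigma>. \<forall>t. t \<noteq> s \<longrightarrow> g i t \<le> lab \<sigma> t}"
  \<comment> \<open>Otherwise \<open>x\<close> could be deleted without changing the label; at
    \<open>s\<close> the label is zero anyway.\<close>
  have attains: "\<exists>t. t \<noteq> s \<and> g x t = lab \<sigma> t \<and> 0 < lab \<sigma> t" if "x \<in> \<sigma>" for x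
  proof (rule ccontr)
    assume neg: "\<not> ?thesis"
    have "lab (\<sigma> - {x}) t = lab \<sigma> t" for t
    proof -
      have "g x t \<noteq> lab \<sigma> t \<or> lab \<sigma> t = 0"
        using neg s by (cases "t = s") auto
      then show ?thesis
        using lcm_label_insert_remove[OF fin, of g x t] that
        by (auto simp: insert_absorb max_def split: if_splits)
    qed
    then have "\<sigma> - {x} = \<sigma>"
      using sub by (intro scarf_eqI[OF \<sigma>]) auto
    then show False
      using that by blast
  qed
  have C_pos: "0 < g i s" if i: "i \<in> C" for i
  proof (rule ccontr)
    assume "\<not> 0 < g i s"
    then have "g i t \<le> lab \<sigma> t" for t
      using i by (cases "t = s") (auto simp: C_def)
    then have "insert i \<sigma> = \<sigma>"
      using i sub by (intro scarf_eqI[OF \<sigma>]) (auto simp: lcm_label_insert[OF fin] C_def)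
    then show False
      using i by (auto simp: C_def)
  qed
  have "pure s \<notin> \<sigma>"
    using attains[of "pure s"] pure_eq_0 by force
  then have "pure s \<in> C"
    by (auto simp: C_def pure_in pure_eq_0)
  then obtain i where i: "i \<in> C" and least: "\<And>j. j \<in> C \<Longrightarrow> g i s \<le> g j s"
    using ex_has_least_nat[of "\<lambda>i. i \<in> C" "pure s" "\<lambda>i. g i s"] by blast
  let ?\<sigma> = "insert i \<sigma>"
  have lab_s: "lab ?\<sigma> s = g i s"
    using s by (simp add: lcm_label_insert[OF fin])
  have lab_t: "lab ?\<sigma> t = lab \<sigma> t" if "t \<noteq> s" for t
    using i that by (auto simp: lcm_label_insert[OF fin] C_def)
  \<comment> \<open>A tie would give an \<open>l\<close> with \<open>g l s < g i s\<close> that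
    raises no other exponent. Minimality of \<open>i\<close> excludes \<open>l \<in> C\<close>, so
    \<open>l \<in> \<sigma>\<close>; but \<open>l\<close> attains no positive exponent of the label
    outside \<open>s\<close>, against \<open>attains\<close>.\<close>
  have no_tie: "j = j'"
    if j: "j \<in> V" "\<And>t. g j t \<le> lab ?\<sigma> t" and j': "j' \<in> V" "\<And>t. g j' t \<le> lab ?\<sigma> t"
      and tie: "g j t = g j' t" "0 < g j t" for j j' t
  proof (rule ccontr)
    assume "j \<noteq> j'"
    then obtain l where l: "l \<in> V" "\<And>t. g l t < max (g j t) (g j' t) \<or> g l t = 0"
      using generic[OF j(1) j'(1) _ tie] by blast
    have less: "g l t < lab ?\<sigma> t \<or> g l t = 0" for t
      using l(2)[of t] j(2)[of t] j'(2)[of t] by (auto simp: less_max_iff_disj)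
    have "g l s < g i s"
      using less[of s] lab_s C_pos[OF i] by auto
    then have "l \<notin> C"
      using least[of l] by auto
    moreover have "g l t \<le> lab \<sigma> t" if "t \<noteq> s" for t
      using less[of t] lab_t[OF that] by auto
    ultimately have "l \<in> \<sigma>"
      using l(1) by (auto simp: C_def)
    then show False
      using attains[of l] less lab_t by (metis less_irrefl)
  qed
  have le: "g j t \<le> lab ?\<sigma> t" if "j \<in> ?\<sigma>" for j t
    using that fin by (auto intro: le_lcm_label)
  have "?\<sigma> \<in> scarf"
    unfolding scarf_def
  proof (intro CollectI conjI allI impI notI; (elim conjE)?)
    show "?\<sigma> \<subseteq> V"
      using sub i by (auto simp: C_def)
    fix \<rho> assume \<rho>: "\<rho> \<subseteq> V" "\<rho> \<noteq> ?\<sigma>" "lab \<rho> = lab ?\<sigma>"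
    have \<rho>_le: "g j t \<le> lab ?\<sigma> t" if "j \<in> \<rho>" for j t
      using le_lcm_label[OF finite_face[OF \<rho>(1)] that, of g t] \<rho>(3) by simp
    have "x \<in> \<rho>" if x: "x \<in> ?\<sigma>" for x
    proof -
      have "\<exists>t. g x t = lab ?\<sigma> t \<and> 0 < lab ?\<sigma> t"
      proof (cases "x = i")
        case True
        then show ?thesis
          using lab_s C_pos[OF i] by (intro exI[of _ s]) simp
      next
        case False
        then show ?thesis
          using x attains[of x] lab_t by (metis insertE)
      qed
      then obtain t where t: "g x t = lab ?\<sigma> t" "0 < lab ?\<sigma> t"
        by blast
      then obtain j where "j \<in> \<rho>" "g j t = lab ?\<sigma> t"
        using lcm_label_attained[OF finite_face[OF \<rho>(1)], of g t] \<rho>(3) by metis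
      then show ?thesis
        using no_tie[of x j t] x le[OF x] \<rho>_le[of j] t \<rho>(1) \<open>?\<sigma> \<subseteq> V\<close> by auto
    qed
    \<comment> \<open>An additional element would lie in \<open>C\<close> and, by minimality of
      \<open>i\<close>, tie with \<open>i\<close> at \<open>s\<close>.\<close>
    moreover have "j \<in> ?\<sigma>" if j: "j \<in> \<rho>" for j
    proof (rule ccontr)
      assume "j \<notin> ?\<sigma>"
      moreover have "g j t \<le> lab \<sigma> t" if "t \<noteq> s" for t
        using \<rho>_le[OF j, of t] lab_t[OF that] by simp
      ultimately have "j \<in> C"
        using j \<rho>(1) by (auto simp: C_def)
      then have "g j s = g i s"
        using least[of j] \<rho>_le[OF j, of s] lab_s by auto
      then show False
        using no_tie[of j i s] \<rho>_le[OF j] le[of i] j \<rho>(1) i C_pos[OF i] \<open>j \<notin> ?\<sigma>\<close>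
        by (auto simp: C_def)
    qed
    ultimately show False
      using \<rho>(2) by blast
  qed
  then show ?thesis
    using that i by (auto simp: C_def)
qed

end

section \<open>Minimal multigraded resolutions\<close>

lemma lookup_smult: "Poly_Mapping.lookup (smult p f) \<beta> = p * Poly_Mapping.lookup f \<beta>"
  by (simp add: smult_def map.rep_eq when_def)

lemma lookup_boundary_map:
  fixes F :: "('v, 'k::comm_ring_1, 'b) free_complex"
  assumes "finite A" "Poly_Mapping.keys f \<subseteq> A"
  shows "Poly_Mapping.lookup (boundary_map F f) \<gamma> =
    (\<Sum>\<beta>\<in>A. Poly_Mapping.lookup f \<beta> * Poly_Mapping.lookup (fc_diff F \<beta>) \<gamma>)"
  unfolding boundary_map_def lookup_sum lookup_smult
  by (rule sum.mono_neutral_left[OF assms]) (auto simp: in_keys_iff)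

lemma boundary_map_single:
  "boundary_map F (Poly_Mapping.single \<beta> p) = smult p (fc_diff F \<beta>)"
  by (rule poly_mapping_eqI) (subst lookup_boundary_map[of "{\<beta>}"], auto simp: lookup_smult)

lemma boundary_map_0 [simp]: "boundary_map F 0 = 0"
  by (simp add: boundary_map_def)

lemma augmentation_map_superset:
  assumes "finite A" "Poly_Mapping.keys f \<subseteq> A"
  shows "augmentation_map \<epsilon> f = (\<Sum>\<beta>\<in>A. Poly_Mapping.lookup f \<beta> * \<epsilon> \<beta>)"
  unfolding augmentation_map_def
  by (rule sum.mono_neutral_left[OF assms]) (auto simp: in_keys_iff)

lemma augmentation_map_single: "augmentation_map \<epsilon> (Poly_Mapping.single \<beta> p) = p * \<epsilon> \<beta>"
  by (subst augmentation_map_superset[of "{\<beta>}"]) auto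

lemma augmentation_map_0 [simp]: "augmentation_map \<epsilon> 0 = 0"
  by (simp add: augmentation_map_def)

lemma augmentation_map_add:
  "augmentation_map \<epsilon> (f + g) = augmentation_map \<epsilon> f + augmentation_map \<epsilon> g"
proof -
  let ?A = "Poly_Mapping.keys f \<union> Poly_Mapping.keys g"
  have "augmentation_map \<epsilon> h = (\<Sum>\<beta>\<in>?A. Poly_Mapping.lookup h \<beta> * \<epsilon> \<beta>)"
    if "Poly_Mapping.keys h \<subseteq> ?A" for h
    by (rule augmentation_map_superset) (use that in auto)
  then show ?thesis
    using Poly_Mapping.keys_add[of f g] by (simp add: lookup_add distrib_right sum.distrib)
qed

lemma augmentation_map_sum: "augmentation_map \<epsilon> (\<Sum>x\<in>A. f x) = (\<Sum>x\<in>A. augmentation_map \<epsilon> (f x))"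
  by (induction A rule: infinite_finite_induct) (simp_all add: augmentation_map_add)

lemma mem_chains_iff:
  "f \<in> chains F h \<longleftrightarrow> (\<forall>\<beta>\<in>Poly_Mapping.keys f. \<beta> \<in> fc_basis F \<and> fc_hdeg F \<beta> = h)"
  by (auto simp: chains_def)

lemma chains_0 [simp]: "0 \<in> chains F h"
  by (simp add: chains_def)

lemma single_in_chains:
  "\<beta> \<in> fc_basis F \<Longrightarrow> fc_hdeg F \<beta> = h \<Longrightarrow> Poly_Mapping.single \<beta> p \<in> chains F h"
  by (simp add: chains_def)

lemma chains_add: "f \<in> chains F h \<Longrightarrow> g \<in> chains F h \<Longrightarrow> f + g \<in> chains F h"
  using Poly_Mapping.keys_add[of f g] unfolding chains_def by blast

lemma chains_sum: "(\<And>x. x \<in> A \<Longrightarrow> f x \<in> chains F h) \<Longrightarrow> (\<Sum>x\<in>A. f x) \<in> chains F h"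
  by (induction A rule: infinite_finite_induct) (auto intro: chains_add)

text \<open>Every monomial except 1 is a multiple of a variable, so minimality becomes the vanishing
  of constant terms.\<close>

lemma mem_ideal_gen_vars_iff:
  "p \<in> ideal_gen (range var) \<longleftrightarrow> Poly_Mapping.lookup (p :: ('v, 'k::comm_ring_1) mpoly) 0 = 0"
proof -
  have "range (var :: 'v \<Rightarrow> ('v, 'k) mpoly) = monom ` range (\<lambda>s. var_pow s 1)"
    by (simp add: image_image)
  moreover have "(\<exists>s. var_pow s 1 \<le> e) \<longleftrightarrow> e \<noteq> 0" for e :: "'v expo"
    by (auto simp: var_pow_le_iff fun_eq_iff Suc_le_eq)
  ultimately show ?thesis
    by (auto simp: mem_ideal_gen_monom_iff in_keys_iff)
qed

lemma boundary_map_minimal: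
  assumes "minimal_complex F" "f \<in> chains F h"
  shows "Poly_Mapping.lookup (Poly_Mapping.lookup (boundary_map F f) \<gamma>) 0 = 0"
proof -
  have "Poly_Mapping.lookup f \<beta> * Poly_Mapping.lookup (fc_diff F \<beta>) \<gamma> \<in> ideal_gen (range var)"
    if "\<beta> \<in> Poly_Mapping.keys f" for \<beta>
    using assms that unfolding minimal_complex_def mem_chains_iff
    by (intro module.span_scale[OF module_times]) auto
  then have "Poly_Mapping.lookup (boundary_map F f) \<gamma> \<in> ideal_gen (range var)"
    by (subst lookup_boundary_map[OF _ order_refl]) (auto intro: module.span_sum[OF module_times])
  then show ?thesis
    by (simp only: mem_ideal_gen_vars_iff)
qed

text \<open>In positive degree such a basis element would be a cycle, hence a boundary, and its
  coefficient 1 contradicts minimality. This determines the dimension of interior facets.\<close>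

lemma minimal_resolution_diff_eq_0:
  assumes min: "minimal_complex F" and res: "free_resolution F \<epsilon> M"
    and \<beta>: "\<beta> \<in> fc_basis F" "fc_diff F \<beta> = 0"
  shows "fc_hdeg F \<beta> = 0"
proof (rule ccontr)
  assume "fc_hdeg F \<beta> \<noteq> 0"
  then have pos: "0 < fc_hdeg F \<beta>"
    using res \<beta>(1) by (auto simp: free_resolution_def order_less_le)
  let ?f = "Poly_Mapping.single \<beta> 1"
  have "boundary_map F ?f = 0"
    by (rule poly_mapping_eqI) (simp add: boundary_map_single lookup_smult \<beta>(2))
  then have "?f \<in> {f \<in> chains F (fc_hdeg F \<beta>). boundary_map F f = 0}"
    using single_in_chains[OF \<beta>(1) refl] by auto
  then have "?f \<in> boundary_map F ` chains F (fc_hdeg F \<beta> + 1)"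
    using res pos unfolding free_resolution_def by blast
  then obtain g where "g \<in> chains F (fc_hdeg F \<beta> + 1)" "boundary_map F g = ?f"
    by (metis imageE)
  then show False
    using boundary_map_minimal[OF min, of g _ \<beta>] by simp
qed

text \<open>Each basis element of degree zero goes to a nonzero multiple of its monomial. If a
  monomial could be omitted, another one would divide it, and the resulting relation would have a
  unit coefficient.\<close>

lemma minimal_resolution_imp_minimally_generated:
  fixes F :: "('v, 'k::field, 'b) free_complex"
  assumes min: "minimal_complex F" and res: "free_resolution F \<epsilon> M"
  shows "minimally_generated_by M
    {monom (fc_mdeg F \<beta>) | \<beta>. \<beta> \<in> fc_basis F \<and> fc_hdeg F \<beta> = 0}"
proof -
  define B where "B = {\<beta> \<in> fc_basis F. fc_hdeg F \<beta> = 0}"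
  define c where "c = (\<lambda>\<beta>. Poly_Mapping.lookup (\<epsilon> \<beta>) (fc_mdeg F \<beta>))"
  let ?m = "fc_mdeg F"
  have M: "M = augmentation_map \<epsilon> ` chains F 0"
    using res by (simp add: free_resolution_def)
  have \<epsilon>: "\<epsilon> \<beta> = Poly_Mapping.single (?m \<beta>) (c \<beta>)" if "\<beta> \<in> B" for \<beta>
  proof (rule poly_mapping_eqI)
    fix e
    have "Poly_Mapping.keys (\<epsilon> \<beta>) \<subseteq> {?m \<beta>}"
      using res that unfolding free_resolution_def B_def by blast
    then show "Poly_Mapping.lookup (\<epsilon> \<beta>) e = Poly_Mapping.lookup (Poly_Mapping.single (?m \<beta>) (c \<beta>)) e"
      by (cases "e = ?m \<beta>") (auto simp: c_def lookup_single_not_eq in_keys_iff)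
  qed
  have kernel: "Poly_Mapping.lookup (Poly_Mapping.lookup f \<beta>) 0 = 0"
    if "f \<in> chains F 0" "augmentation_map \<epsilon> f = 0" for f \<beta>
  proof -
    have "f \<in> boundary_map F ` chains F 1"
      using res that by (auto simp: free_resolution_def)
    then obtain g where "g \<in> chains F 1" "f = boundary_map F g"
      by (rule imageE)
    then show ?thesis
      using boundary_map_minimal[OF min] by simp
  qed
  have single: "Poly_Mapping.single \<beta> p \<in> chains F 0" if "\<beta> \<in> B" for \<beta> p
    using that by (auto simp: B_def intro: single_in_chains)
  \<comment> \<open>If the scalar vanished, the basis element itself would be in the kernel, with
    coefficient 1.\<close>
  have c: "c \<beta> \<noteq> 0" if \<beta>: "\<beta> \<in> B" for \<beta>
  proof
    assume "c \<beta> = 0"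
    then have "augmentation_map \<epsilon> (Poly_Mapping.single \<beta> 1) = 0"
      by (simp add: augmentation_map_single \<epsilon>[OF \<beta>])
    then show False
      using kernel[OF single[OF \<beta>], of 1 \<beta>] by simp
  qed
  have G: "{monom (?m \<beta>) | \<beta>. \<beta> \<in> fc_basis F \<and> fc_hdeg F \<beta> = 0} = monom ` ?m ` B"
    by (auto simp: B_def)
  have gen: "ideal_gen (monom ` ?m ` B) = M"
  proof (intro set_eqI iffI)
    fix p :: "('v, 'k) mpoly" assume p: "p \<in> ideal_gen (monom ` ?m ` B)"
    then have "\<forall>e\<in>Poly_Mapping.keys p. \<exists>\<beta>. \<beta> \<in> B \<and> ?m \<beta> \<le> e"
      by (simp add: mem_ideal_gen_monom_iff Bex_def)
    then obtain \<beta> where \<beta>: "\<And>e. e \<in> Poly_Mapping.keys p \<Longrightarrow> \<beta> e \<in> B \<and> ?m (\<beta> e) \<le> e"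
      by (rule bchoice[THEN exE]) blast
    define f where "f = (\<Sum>e\<in>Poly_Mapping.keys p. Poly_Mapping.single (\<beta> e)
      (Poly_Mapping.single (e - ?m (\<beta> e)) (Poly_Mapping.lookup p e / c (\<beta> e))))"
    have "augmentation_map \<epsilon> f = (\<Sum>e\<in>Poly_Mapping.keys p.
        Poly_Mapping.single e (Poly_Mapping.lookup p e))"
      unfolding f_def augmentation_map_sum augmentation_map_single
      using \<beta> by (intro sum.cong refl) (simp add: \<epsilon> mult_single le_imp_add_diff c)
    then have "augmentation_map \<epsilon> f = p"
      by (simp only: sum_single_lookup)
    moreover have "f \<in> chains F 0"
      unfolding f_def using \<beta> by (intro chains_sum single) auto
    ultimately show "p \<in> M"
      unfolding M by blast
  next
    fix p assume "p \<in> M"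
    then obtain f where f: "f \<in> chains F 0" "p = augmentation_map \<epsilon> f"
      unfolding M by blast
    have "Poly_Mapping.lookup f \<beta> * \<epsilon> \<beta> \<in> ideal_gen (monom ` ?m ` B)"
      if "\<beta> \<in> Poly_Mapping.keys f" for \<beta>
    proof -
      have "\<beta> \<in> B"
        using that f(1) by (auto simp: mem_chains_iff B_def)
      then show ?thesis
        by (intro module.span_scale[OF module_times])
          (auto simp: mem_ideal_gen_monom_iff \<epsilon> split: if_splits)
    qed
    then show "p \<in> ideal_gen (monom ` ?m ` B)"
      unfolding f(2) augmentation_map_def by (rule module.span_sum[OF module_times])
  qed
  have "ideal_gen H \<noteq> M" if H: "H \<subset> monom ` ?m ` B" for H
  proof
    assume H_gen: "ideal_gen H = M"
    obtain \<beta> where \<beta>: "\<beta> \<in> B" "monom (?m \<beta>) \<notin> H"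
      using H by blast
    define U where "U = {u \<in> ?m ` B. monom u \<in> H}"
    have "H = monom ` U"
      using H by (auto simp: U_def)
    moreover have "monom (?m \<beta>) \<in> ideal_gen H"
      unfolding H_gen gen[symmetric] using \<beta>(1) by (intro module.span_base[OF module_times]) blast
    ultimately obtain u where "u \<in> U" "u \<le> ?m \<beta>"
      by (auto simp: monom_mem_ideal_gen_iff)
    then obtain \<gamma> where \<gamma>: "\<gamma> \<in> B" "monom (?m \<gamma>) \<in> H" "?m \<gamma> \<le> ?m \<beta>"
      by (auto simp: U_def)
    then have "\<gamma> \<noteq> \<beta>"
      using \<beta>(2) by blast
    \<comment> \<open>The relation between the two monomials; since
      \<open>\<gamma> \<noteq> \<beta>\<close>, its coefficient at \<open>\<beta>\<close> is the
      constant \<open>c \<gamma>\<close>.\<close>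
    let ?f = "Poly_Mapping.single \<beta> (Poly_Mapping.single 0 (c \<gamma>)) +
      Poly_Mapping.single \<gamma> (Poly_Mapping.single (?m \<beta> - ?m \<gamma>) (- c \<beta>))"
    have "augmentation_map \<epsilon> ?f = Poly_Mapping.single (?m \<beta>) (c \<gamma> * c \<beta>) +
        Poly_Mapping.single (?m \<beta>) (- c \<beta> * c \<gamma>)"
      by (simp add: augmentation_map_add augmentation_map_single \<epsilon> \<beta>(1) \<gamma>(1) mult_single
          le_imp_add_diff[OF \<gamma>(3)])
    also have "\<dots> = 0"
      by (simp flip: single_add add: mult.commute)
    finally have "Poly_Mapping.lookup (Poly_Mapping.lookup ?f \<beta>) 0 = 0"
      by (intro kernel chains_add single \<beta>(1) \<gamma>(1))
    then show False
      using \<open>\<gamma> \<noteq> \<beta>\<close> c[OF \<gamma>(1)] by (simp add: lookup_add lookup_single_not_eq)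
  qed
  then show ?thesis
    unfolding minimally_generated_by_def G using gen by blast
qed

section \<open>Resolutions from Scarf complexes\<close>

lemma face_sign_single:
  "(face_sign R i \<tau> :: ('v, 'k::comm_ring_1) mpoly) = Poly_Mapping.single 0 (face_sign R i \<tau>)"
proof -
  have "(- 1) ^ n = (Poly_Mapping.single 0 ((- 1) ^ n) :: ('v, 'k) mpoly)" for n
  proof (induction n)
    case (Suc n)
    then show ?case
      by (simp add: single_uminus)
  qed (simp only: power_0 single_one)
  then show ?thesis
    by (simp only: face_sign_def)
qed

locale bounded_generic_labels = generic_labels V R g
  for V :: "'a set" and R :: "'a rel" and g :: "'a \<Rightarrow> 'v::finite \<Rightarrow> nat" +
  fixes D :: nat
  assumes bounded: "\<And>v s. v \<in> V \<Longrightarrow> g v s \<le> D"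
begin

definition mdeg :: "'a set \<Rightarrow> 'v \<Rightarrow> nat" where
  "mdeg \<sigma> = (\<lambda>s. D - lab \<sigma> s)"

definition scarf_diff :: "'a set \<Rightarrow> 'a set \<Rightarrow>\<^sub>0 ('v, 'k::comm_ring_1) mpoly" where
  "scarf_diff \<sigma> = (\<Sum>i\<in>{i. i \<notin> \<sigma> \<and> insert i \<sigma> \<in> interior}.
     Poly_Mapping.single (insert i \<sigma>)
       (face_sign R i (insert i \<sigma>) * monom (lab (insert i \<sigma>) - lab \<sigma>)))"

definition scarf_complex :: "('v, 'k::comm_ring_1, 'a set) free_complex" where
  "scarf_complex = \<lparr>fc_basis = interior,
     fc_hdeg = (\<lambda>\<sigma>. int CARD('v) - int (card \<sigma>)),
     fc_mdeg = mdeg,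
     fc_diff = scarf_diff\<rparr>"

definition augmentation :: "'a set \<Rightarrow> ('v, 'k::comm_ring_1) mpoly" where
  "augmentation \<sigma> = Poly_Mapping.single (mdeg \<sigma>) (orientation \<sigma>)"

text \<open>The faces contributing to the strand of multidegree \<open>c\<close> are those with label strictly above
  this vector; a face of full support satisfies the condition at \<open>s\<close> even if \<open>c s\<close> exceeds \<open>D\<close>.\<close>

definition threshold :: "('v \<Rightarrow> nat) \<Rightarrow> 'v \<Rightarrow> nat" where
  "threshold c = (\<lambda>s. D - (c s + 1))"

text \<open>In multidegree \<open>c\<close> the free module has one basis vector over the
  coefficients for each basis face with \<open>mdeg \<sigma> \<le> c\<close>, namely the generator
  times the monomial of exponent \<open>c - mdeg \<sigma>\<close>; \<open>strand\<close> reads off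
  these coordinates.\<close>

definition strand :: "('v \<Rightarrow> nat) \<Rightarrow> ('a set \<Rightarrow>\<^sub>0 ('v, 'k::comm_ring_1) mpoly) \<Rightarrow> 'a set \<Rightarrow> 'k" where
  "strand c f \<sigma> =
     (if mdeg \<sigma> \<le> c then Poly_Mapping.lookup (Poly_Mapping.lookup f \<sigma>) (c - mdeg \<sigma>) else 0)"

lemma lab_le: "\<sigma> \<subseteq> V \<Longrightarrow> lab \<sigma> s \<le> D"
  using bounded by (auto simp: lcm_label_le_iff finite_face)

lemma interior_subset: "\<sigma> \<in> interior \<Longrightarrow> \<sigma> \<subseteq> V"
  by (auto simp: interior_def dest: scarf_subset)

lemma mdeg_le_iff:
  assumes "\<sigma> \<in> interior"
  shows "mdeg \<sigma> \<le> c \<longleftrightarrow> (\<forall>s. threshold c s < lab \<sigma> s)"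
proof -
  have bounds: "0 < lab \<sigma> s" "lab \<sigma> s \<le> D" for s
    using assms lab_le[OF interior_subset] by (auto simp: interior_def)
  have "D - lab \<sigma> s \<le> c s \<longleftrightarrow> D - (c s + 1) < lab \<sigma> s" for s
    using bounds[of s] by arith
  then show ?thesis
    by (simp add: le_fun_def mdeg_def threshold_def)
qed

lemma mdeg_remove:
  assumes "\<tau> \<subseteq> V"
  shows "mdeg (\<tau> - {i}) = mdeg \<tau> + (lab \<tau> - lab (\<tau> - {i}))"
proof
  fix s
  have "lab (\<tau> - {i}) s \<le> lab \<tau> s" "lab \<tau> s \<le> D"
    using assms by (auto intro: lcm_label_mono finite_face lab_le)
  then show "mdeg (\<tau> - {i}) s = (mdeg \<tau> + (lab \<tau> - lab (\<tau> - {i}))) s"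
    by (simp add: mdeg_def)
qed

text \<open>Indexing by the target face turns the sum over inserted vertices into a sum over removed
  ones, the shape of \<open>coboundary\<close>.\<close>

lemma lookup_scarf_diff:
  "Poly_Mapping.lookup (scarf_diff \<sigma> :: 'a set \<Rightarrow>\<^sub>0 ('v, 'k::comm_ring_1) mpoly) \<tau> =
    (if \<tau> \<in> interior then \<Sum>i\<in>\<tau>. if \<tau> - {i} = \<sigma>
       then Poly_Mapping.single (lab \<tau> - lab \<sigma>) (face_sign R i \<tau>) else 0 else 0)"
proof -
  let ?I = "{i. i \<notin> \<sigma> \<and> insert i \<sigma> \<in> interior}"
  let ?c = "\<lambda>i \<tau>. Poly_Mapping.single (lab \<tau> - lab \<sigma>) (face_sign R i \<tau>) :: ('v, 'k) mpoly"
  have fin: "finite ?I"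
    by (rule finite_subset[OF _ finite_V]) (auto dest: interior_subset)
  have "Poly_Mapping.lookup (scarf_diff \<sigma> :: 'a set \<Rightarrow>\<^sub>0 ('v, 'k) mpoly) \<tau> =
      (\<Sum>i\<in>?I. if insert i \<sigma> = \<tau> then ?c i \<tau> else 0)"
    unfolding scarf_diff_def lookup_sum face_sign_single
    by (intro sum.cong refl) (auto simp: lookup_single when_def monom_def mult_single)
  also have "\<dots> = (\<Sum>i\<in>{i \<in> ?I. insert i \<sigma> = \<tau>}. ?c i \<tau>)"
    by (rule sum.inter_filter[OF fin, symmetric])
  also have "{i \<in> ?I. insert i \<sigma> = \<tau>} = (if \<tau> \<in> interior then {i \<in> \<tau>. \<tau> - {i} = \<sigma>} else {})"
    by (auto simp: insert_absorb)
  also have "(\<Sum>i\<in>\<dots>. ?c i \<tau>) =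
      (if \<tau> \<in> interior then \<Sum>i\<in>\<tau>. if \<tau> - {i} = \<sigma> then ?c i \<tau> else 0 else 0)"
    using finite_face[OF interior_subset, of \<tau>] by (simp add: sum.inter_filter)
  finally show ?thesis .
qed

lemma lookup_scarf_boundary:
  fixes f :: "'a set \<Rightarrow>\<^sub>0 ('v, 'k::comm_ring_1) mpoly"
  assumes f: "Poly_Mapping.keys f \<subseteq> interior"
  shows "Poly_Mapping.lookup (boundary_map scarf_complex f) \<tau> =
    (if \<tau> \<in> interior then \<Sum>i\<in>\<tau>.
       Poly_Mapping.single (lab \<tau> - lab (\<tau> - {i})) (face_sign R i \<tau>) * Poly_Mapping.lookup f (\<tau> - {i})
     else 0)"
proof (cases "\<tau> \<in> interior")
  case True
  \<comment> \<open>Some faces \<open>\<tau> - {i}\<close> need not be interior; they are added so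
    that the inner sum always meets its index, and \<open>f\<close> vanishes there.\<close>
  let ?A = "interior \<union> (\<lambda>i. \<tau> - {i}) ` \<tau>"
  have fin: "finite ?A"
    using finite_interior finite_face[OF interior_subset[OF True]] by blast
  have "Poly_Mapping.lookup (boundary_map scarf_complex f) \<tau> =
      (\<Sum>\<sigma>\<in>?A. Poly_Mapping.lookup f \<sigma> * Poly_Mapping.lookup (scarf_diff \<sigma>) \<tau>)"
    by (subst lookup_boundary_map[OF fin]) (use f in \<open>auto simp: scarf_complex_def\<close>)
  also have "\<dots> = (\<Sum>\<sigma>\<in>?A. \<Sum>i\<in>\<tau>. if \<tau> - {i} = \<sigma> then
      Poly_Mapping.single (lab \<tau> - lab \<sigma>) (face_sign R i \<tau>) * Poly_Mapping.lookup f \<sigma> else 0)"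
    using True by (simp add: lookup_scarf_diff sum_distrib_left if_distrib[of "(*) _"] mult.commute
        cong: if_cong)
  also have "\<dots> = (\<Sum>i\<in>\<tau>. \<Sum>\<sigma>\<in>?A. if \<tau> - {i} = \<sigma> then
      Poly_Mapping.single (lab \<tau> - lab \<sigma>) (face_sign R i \<tau>) * Poly_Mapping.lookup f \<sigma> else 0)"
    by (rule sum.swap)
  also have "\<dots> = (\<Sum>i\<in>\<tau>.
      Poly_Mapping.single (lab \<tau> - lab (\<tau> - {i})) (face_sign R i \<tau>) * Poly_Mapping.lookup f (\<tau> - {i}))"
    by (intro sum.cong refl, subst sum.delta'[OF fin]) auto
  finally show ?thesis
    using True by simp
next
  case False
  then show ?thesis
    by (subst lookup_boundary_map[OF _ order_refl]) (auto simp: scarf_complex_def lookup_scarf_diff)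
qed

text \<open>The quotient of the two labels equals the difference of the multidegrees, so its
  monomial shifts exponents just enough to stay in multidegree \<open>c\<close>, and only the sign
  remains.\<close>

lemma strand_boundary:
  fixes f :: "'a set \<Rightarrow>\<^sub>0 ('v, 'k::comm_ring_1) mpoly"
  assumes f: "Poly_Mapping.keys f \<subseteq> interior"
  shows "strand c (boundary_map scarf_complex f) = scarf_coboundary (strand c f)"
proof
  fix \<tau>
  show "strand c (boundary_map scarf_complex f) \<tau> = scarf_coboundary (strand c f) \<tau>"
  proof (cases "\<tau> \<in> interior")
    case False
    then show ?thesis
      by (simp add: strand_def lookup_scarf_boundary[OF f] scarf_coboundary_def restrict_to_def)
  next
    case True
    note sub = interior_subset[OF True]
    have face: "strand c f (\<tau> - {i}) = (if mdeg \<tau> \<le> c \<and> lab \<tau> - lab (\<tau> - {i}) \<le> c - mdeg \<tau>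
        then Poly_Mapping.lookup (Poly_Mapping.lookup f (\<tau> - {i}))
          (c - mdeg \<tau> - (lab \<tau> - lab (\<tau> - {i}))) else 0)" for i
    proof -
      have "a + b \<le> c \<longleftrightarrow> a \<le> c \<and> b \<le> c - a" for a b :: "'v \<Rightarrow> nat"
        by (auto simp: le_fun_def) (metis add_leD1 le_diff_conv2 add.commute)+
      moreover have "c - (a + b) = c - a - b" for a b :: "'v \<Rightarrow> nat"
        by (auto simp: fun_eq_iff)
      ultimately show ?thesis
        by (simp add: strand_def mdeg_remove[OF sub])
    qed
    have "scarf_coboundary (strand c f) \<tau> = (\<Sum>i\<in>\<tau>. face_sign R i \<tau> * strand c f (\<tau> - {i}))"
      using True sub by (simp add: scarf_coboundary_def restrict_to_def coboundary_def)
    also have "\<dots> = strand c (boundary_map scarf_complex f) \<tau>"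
      unfolding strand_def[of c "boundary_map scarf_complex f"] lookup_scarf_boundary[OF f] face
      using True by (auto simp: lookup_sum lookup_single_times intro!: sum.cong)
    finally show ?thesis ..
  qed
qed

section \<open>Passing between chains and their strands\<close>

lemma strand_0 [simp]: "strand c 0 = 0"
  by (auto simp: strand_def fun_eq_iff)

lemma strand_sum: "strand c (\<Sum>x\<in>A. f x) \<sigma> = (\<Sum>x\<in>A. strand c (f x) \<sigma>)"
  by (simp add: strand_def lookup_sum)

lemma poly_mapping_eq_strandI:
  assumes "\<And>c. strand c f = strand c f'"
  shows "f = f'"
proof (rule poly_mapping_eqI, rule poly_mapping_eqI)
  fix \<sigma> e
  show "Poly_Mapping.lookup (Poly_Mapping.lookup f \<sigma>) e =
      Poly_Mapping.lookup (Poly_Mapping.lookup f' \<sigma>) e"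
    using fun_cong[OF assms[of "e + mdeg \<sigma>"], of \<sigma>]
    by (simp add: strand_def le_fun_def)
qed

text \<open>Finiteness allows primitives found separately in each multidegree to be assembled into
  one chain.\<close>

lemma finite_strands: "finite {c. strand c f \<noteq> 0}"
proof (rule finite_subset)
  show "{c. strand c f \<noteq> 0} \<subseteq>
      (\<Union>\<sigma>\<in>Poly_Mapping.keys f. (\<lambda>e. e + mdeg \<sigma>) ` Poly_Mapping.keys (Poly_Mapping.lookup f \<sigma>))"
  proof
    fix c assume "c \<in> {c. strand c f \<noteq> 0}"
    then obtain \<sigma> where "strand c f \<sigma> \<noteq> 0"
      by (auto simp: fun_eq_iff)
    then have \<sigma>: "mdeg \<sigma> \<le> c" "c - mdeg \<sigma> \<in> Poly_Mapping.keys (Poly_Mapping.lookup f \<sigma>)"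
      by (auto simp: strand_def in_keys_iff split: if_splits)
    then have "\<sigma> \<in> Poly_Mapping.keys f"
      by (auto simp: in_keys_iff)
    moreover have "c = c - mdeg \<sigma> + mdeg \<sigma>"
      using le_imp_add_diff[OF \<sigma>(1)] by simp
    ultimately show "c \<in> (\<Union>\<sigma>\<in>Poly_Mapping.keys f. (\<lambda>e. e + mdeg \<sigma>) `
        Poly_Mapping.keys (Poly_Mapping.lookup f \<sigma>))"
      using \<sigma>(2) by blast
  qed
qed auto

lemma mem_scarf_chains_iff:
  "f \<in> chains scarf_complex h \<longleftrightarrow>
    (\<forall>\<sigma>\<in>Poly_Mapping.keys f. \<sigma> \<in> interior \<and> int (card \<sigma>) = int CARD('v) - h)"
  by (auto simp: mem_chains_iff scarf_complex_def)

lemma strand_supported_on: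
  assumes "f \<in> chains scarf_complex (int CARD('v) - int m)"
  shows "supported_on (strand c f) (interior_above (threshold c) m)"
  unfolding supported_on_def
proof (intro allI impI, rule ccontr)
  fix \<sigma> assume \<sigma>: "\<sigma> \<notin> interior_above (threshold c) m" "strand c f \<sigma> \<noteq> 0"
  then have "mdeg \<sigma> \<le> c" "\<sigma> \<in> Poly_Mapping.keys f"
    by (auto simp: strand_def in_keys_iff split: if_splits)
  then show False
    using assms \<sigma>(1) mdeg_le_iff[of \<sigma> c] by (auto simp: mem_scarf_chains_iff interior_above_def)
qed

lemma ex_chain_with_strands:
  fixes \<psi> :: "('v \<Rightarrow> nat) \<Rightarrow> 'a set \<Rightarrow> 'k::comm_ring_1"
  assumes C: "finite C" and \<psi>: "\<And>c. c \<in> C \<Longrightarrow> supported_on (\<psi> c) (interior_above (threshold c) m)"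
  obtains f where "f \<in> chains scarf_complex (int CARD('v) - int m)"
    "\<And>c. strand c f = (if c \<in> C then \<psi> c else 0)"
proof -
  define u where "u = (\<lambda>c. \<Sum>\<sigma>\<in>interior_above (threshold c) m.
    Poly_Mapping.single \<sigma> (Poly_Mapping.single (c - mdeg \<sigma>) (\<psi> c \<sigma>)))"
  have fin: "finite (interior_above w m)" for w
    using finite_interior by (simp add: interior_above_def)
  have lookup_u: "Poly_Mapping.lookup (u c) \<sigma> = (if \<sigma> \<in> interior_above (threshold c) m
      then Poly_Mapping.single (c - mdeg \<sigma>) (\<psi> c \<sigma>) else 0)" for c \<sigma>
    unfolding u_def lookup_sum lookup_single when_def using fin by simp
  have strand_u: "strand c' (u c) = (if c' = c then \<psi> c else 0)" if "c \<in> C" for c c'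
  proof
    fix \<sigma>
    show "strand c' (u c) \<sigma> = (if c' = c then \<psi> c else 0) \<sigma>"
    proof (cases "\<sigma> \<in> interior_above (threshold c) m")
      case False
      then have "\<psi> c \<sigma> = 0"
        using \<psi>[OF that] by (simp add: supported_on_def)
      then show ?thesis
        using False by (simp add: strand_def lookup_u)
    next
      case True
      then have le: "mdeg \<sigma> \<le> c"
        using mdeg_le_iff[of \<sigma> c] by (auto simp: interior_above_def)
      have "c' = c" if "mdeg \<sigma> \<le> c'" "c - mdeg \<sigma> = c' - mdeg \<sigma>"
        using le_imp_add_diff[OF le] le_imp_add_diff[OF that(1)] that(2) by metis
      then show ?thesis
        using True le by (auto simp: strand_def lookup_u lookup_single when_def)
    qed
  qed
  show ?thesis
  proof (rule that[of "\<Sum>c\<in>C. u c"])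
    have "u c \<in> chains scarf_complex (int CARD('v) - int m)" for c
      unfolding u_def
      by (intro chains_sum single_in_chains) (auto simp: scarf_complex_def interior_above_def)
    then show "(\<Sum>c\<in>C. u c) \<in> chains scarf_complex (int CARD('v) - int m)"
      by (intro chains_sum)
    fix c
    show "strand c (\<Sum>c\<in>C. u c) = (if c \<in> C then \<psi> c else 0)"
    proof
      fix \<sigma>
      have "strand c (\<Sum>c\<in>C. u c) \<sigma> = (\<Sum>c'\<in>C. if c = c' then \<psi> c' \<sigma> else 0)"
        unfolding strand_sum by (intro sum.cong refl) (simp add: strand_u)
      then show "strand c (\<Sum>c\<in>C. u c) \<sigma> = (if c \<in> C then \<psi> c else 0) \<sigma>"
        using C by simp
    qed
  qed
qed

lemma chains_keys: "f \<in> chains scarf_complex h \<Longrightarrow> Poly_Mapping.keys f \<subseteq> interior"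
  by (auto simp: mem_scarf_chains_iff)

lemma scarf_diff_in_chains:
  assumes "\<sigma> \<in> interior"
  shows "scarf_diff \<sigma> \<in> chains scarf_complex (int CARD('v) - int (card \<sigma>) - 1)"
  unfolding scarf_diff_def
  using finite_face[OF interior_subset[OF assms]]
  by (intro chains_sum single_in_chains) (auto simp: scarf_complex_def)

lemma boundary_in_chains:
  fixes f :: "'a set \<Rightarrow>\<^sub>0 ('v, 'k::comm_ring_1) mpoly"
  assumes "f \<in> chains scarf_complex h"
  shows "boundary_map scarf_complex f \<in> chains scarf_complex (h - 1)"
proof -
  have "smult p (scarf_diff \<sigma>) \<in> chains scarf_complex (h - 1)"
    if \<sigma>: "\<sigma> \<in> interior" "h = int CARD('v) - int (card \<sigma>)"
    for p :: "('v, 'k) mpoly" and \<sigma>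
  proof -
    have "Poly_Mapping.keys (smult p (scarf_diff \<sigma>)) \<subseteq>
        Poly_Mapping.keys (scarf_diff \<sigma> :: 'a set \<Rightarrow>\<^sub>0 ('v, 'k) mpoly)"
      by (auto simp: in_keys_iff lookup_smult)
    then show ?thesis
      using scarf_diff_in_chains[OF \<sigma>(1)] \<sigma>(2) unfolding mem_chains_iff by blast
  qed
  note smult = this
  have "fc_diff scarf_complex = (scarf_diff :: _ \<Rightarrow> _ \<Rightarrow>\<^sub>0 ('v, 'k) mpoly)"
    by (simp add: scarf_complex_def)
  then show ?thesis
    unfolding boundary_map_def
    by (simp only:) (intro chains_sum smult; use assms in \<open>auto simp: mem_scarf_chains_iff\<close>)
qed

lemma boundary_boundary:
  fixes f :: "'a set \<Rightarrow>\<^sub>0 ('v, 'k::comm_ring_1) mpoly"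
  assumes f: "f \<in> chains scarf_complex h"
  shows "boundary_map scarf_complex (boundary_map scarf_complex f) = 0"
proof (rule poly_mapping_eq_strandI)
  fix c
  have "Poly_Mapping.lookup f \<sigma> = 0" if "\<sigma> \<notin> interior" for \<sigma>
    using chains_keys[OF f] that by (metis in_keys_iff subsetD)
  then have "supported_on (strand c f) interior"
    by (auto simp: supported_on_def strand_def)
  then show "strand c (boundary_map scarf_complex (boundary_map scarf_complex f)) = strand c 0"
    by (simp add: strand_boundary chains_keys[OF f] chains_keys[OF boundary_in_chains[OF f]]
        scarf_coboundary_scarf_coboundary)
qed

lemma lookup_augmentation_map:
  fixes f :: "'a set \<Rightarrow>\<^sub>0 ('v, 'k::comm_ring_1) mpoly"
  assumes f: "f \<in> chains scarf_complex 0"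
  shows "Poly_Mapping.lookup (augmentation_map augmentation f) c = pairing (strand c f)"
proof -
  have "Poly_Mapping.keys f \<subseteq> top_faces"
    using f by (auto simp: mem_scarf_chains_iff top_faces_def)
  then have "augmentation_map augmentation f =
      (\<Sum>\<sigma>\<in>top_faces. augmentation \<sigma> * Poly_Mapping.lookup f \<sigma>)"
    by (simp add: augmentation_map_superset[OF finite_top_faces] mult.commute)
  then have "Poly_Mapping.lookup (augmentation_map augmentation f) c = (\<Sum>\<sigma>\<in>top_faces.
      if mdeg \<sigma> \<le> c then orientation \<sigma> * Poly_Mapping.lookup (Poly_Mapping.lookup f \<sigma>) (c - mdeg \<sigma>)
      else 0)"
    by (simp add: lookup_sum augmentation_def lookup_single_times)
  also have "\<dots> = pairing (strand c f)"
    unfolding pairing_def by (intro sum.cong refl) (simp add: strand_def mult.commute)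
  finally show ?thesis .
qed

lemma multigraded_scarf_complex:
  "multigraded_complex (scarf_complex :: ('v, 'k::comm_ring_1, 'a set) free_complex)"
  unfolding multigraded_complex_def
proof (intro ballI conjI)
  let ?F = "scarf_complex :: ('v, 'k, 'a set) free_complex"
  fix \<sigma> assume "\<sigma> \<in> fc_basis ?F"
  then have \<sigma>: "\<sigma> \<in> interior"
    by (simp add: scarf_complex_def)
  show "fc_diff ?F \<sigma> \<in> chains ?F (fc_hdeg ?F \<sigma> - 1)"
    using scarf_diff_in_chains[OF \<sigma>] by (simp add: scarf_complex_def)
  have "fc_diff ?F \<sigma> = boundary_map ?F (Poly_Mapping.single \<sigma> 1)"
    by (rule poly_mapping_eqI) (simp add: boundary_map_single lookup_smult)
  then show "boundary_map ?F (fc_diff ?F \<sigma>) = 0"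
    using boundary_boundary[OF single_in_chains[OF \<open>\<sigma> \<in> fc_basis ?F\<close> refl]] by simp
  fix \<tau> u assume \<tau>: "\<tau> \<in> fc_basis ?F" and
    u: "u \<in> Poly_Mapping.keys (Poly_Mapping.lookup (fc_diff ?F \<sigma>) \<tau>)"
  have "\<tau> \<in> interior"
    using \<tau> by (simp add: scarf_complex_def)
  then have "Poly_Mapping.lookup (\<Sum>i\<in>\<tau>. if \<tau> - {i} = \<sigma>
       then Poly_Mapping.single (lab \<tau> - lab \<sigma>) (face_sign R i \<tau>) else 0 :: ('v, 'k) mpoly) u \<noteq> 0"
    using u by (simp add: scarf_complex_def lookup_scarf_diff in_keys_iff)
  then obtain i where "i \<in> \<tau>" and i: "\<tau> - {i} = \<sigma>" and "u = lab \<tau> - lab \<sigma>"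
    unfolding lookup_sum by (rule sum.not_neutral_contains_not_neutral)
      (auto simp: lookup_single when_def split: if_splits)
  then show "u + fc_mdeg ?F \<tau> = fc_mdeg ?F \<sigma>"
    using mdeg_remove[OF interior_subset[OF \<open>\<tau> \<in> interior\<close>], of i]
    by (simp add: scarf_complex_def add.commute)
qed

text \<open>Different Scarf faces have different labels, so the monomial in each entry of the
  differential is never 1.\<close>

lemma minimal_scarf_complex:
  "minimal_complex (scarf_complex :: ('v, 'k::comm_ring_1, 'a set) free_complex)"
  unfolding minimal_complex_def mem_ideal_gen_vars_iff
proof (intro ballI allI)
  fix \<sigma> \<tau> assume "\<sigma> \<in> fc_basis (scarf_complex :: ('v, 'k, 'a set) free_complex)"
  then have \<sigma>: "\<sigma> \<in> interior"
    by (simp add: scarf_complex_def)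
  have "lab \<tau> - lab \<sigma> \<noteq> 0" if "\<tau> \<in> interior" "i \<in> \<tau>" "\<tau> - {i} = \<sigma>" for i
  proof
    assume "lab \<tau> - lab \<sigma> = 0"
    then have "lab \<tau> s \<le> lab \<sigma> s" for s
      by (auto simp: fun_eq_iff)
    moreover have "lab \<sigma> s \<le> lab \<tau> s" for s
      using that interior_subset[OF that(1)] by (intro lcm_label_mono finite_face) auto
    ultimately have "\<tau> = \<sigma>"
      using that(1) \<sigma> interior_subset
      by (intro scarf_eqI[of \<sigma>] order.antisym) (auto simp: interior_def)
    then show False
      using that by blast
  qed
  then have "Poly_Mapping.lookup (Poly_Mapping.lookup (scarf_diff \<sigma> :: _ \<Rightarrow>\<^sub>0 ('v, 'k) mpoly) \<tau>) 0 = 0"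
    by (auto simp: lookup_scarf_diff lookup_sum lookup_single when_def intro!: sum.neutral)
  then show "Poly_Mapping.lookup (Poly_Mapping.lookup
      (fc_diff (scarf_complex :: ('v, 'k, 'a set) free_complex) \<sigma>) \<tau>) 0 = 0"
    by (simp add: scarf_complex_def)
qed

lemma standard_if_strand_nonzero:
  assumes "f \<in> chains scarf_complex h" "strand c f \<sigma> \<noteq> 0"
  shows "standard (threshold c)"
proof -
  have "mdeg \<sigma> \<le> c" "\<sigma> \<in> Poly_Mapping.keys f"
    using assms(2) by (auto simp: strand_def in_keys_iff split: if_splits)
  then show ?thesis
    using assms(1) mdeg_le_iff[of \<sigma> c] standard_if_interior_above[of \<sigma> "threshold c"]
    by (auto simp: mem_scarf_chains_iff)
qed

text \<open>A nonzero strand already forces its threshold to be standard, so primitives have to be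
  found only in multidegrees of \<open>M\<close>; zero strands receive zero.\<close>

lemma boundary_if_strandwise:
  fixes f :: "'a set \<Rightarrow>\<^sub>0 ('v, 'k::comm_ring_1) mpoly"
  assumes f: "f \<in> chains scarf_complex h" and m: "h = int CARD('v) - int m" "m \<noteq> 0"
    and strands: "\<And>c. standard (threshold c) \<Longrightarrow>
      supported_on (strand c f) (interior_above (threshold c) m) \<Longrightarrow>
      \<exists>\<psi>. supported_on \<psi> (interior_above (threshold c) (m - 1)) \<and> scarf_coboundary \<psi> = strand c f"
  shows "f \<in> boundary_map scarf_complex ` chains scarf_complex (h + 1)"
proof -
  define C where "C = {c. strand c f \<noteq> 0}"
  have "\<exists>\<psi>. supported_on \<psi> (interior_above (threshold c) (m - 1)) \<and>
      scarf_coboundary \<psi> = strand c f" if c: "c \<in> C" for c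
  proof (rule strands)
    obtain \<sigma> where "strand c f \<sigma> \<noteq> 0"
      using c by (auto simp: C_def fun_eq_iff)
    then show "standard (threshold c)"
      by (rule standard_if_strand_nonzero[OF f])
    show "supported_on (strand c f) (interior_above (threshold c) m)"
      using f unfolding m(1) by (rule strand_supported_on)
  qed
  then obtain \<psi> where \<psi>: "\<And>c. c \<in> C \<Longrightarrow>
      supported_on (\<psi> c) (interior_above (threshold c) (m - 1)) \<and> scarf_coboundary (\<psi> c) = strand c f"
    by metis
  obtain e where e: "e \<in> chains scarf_complex (int CARD('v) - int (m - 1))"
    "\<And>c. strand c e = (if c \<in> C then \<psi> c else 0)"
    using ex_chain_with_strands[of C \<psi> "m - 1"] \<psi> finite_strands unfolding C_def by blast
  have "boundary_map scarf_complex e = f"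
  proof (rule poly_mapping_eq_strandI)
    fix c
    have "scarf_coboundary 0 = (0 :: 'a set \<Rightarrow> 'k)"
      unfolding scarf_coboundary_def coboundary_0 by (auto simp: restrict_to_def fun_eq_iff)
    then show "strand c (boundary_map scarf_complex e) = strand c f"
      using \<psi>[of c] by (cases "c \<in> C") (simp_all add: strand_boundary[OF chains_keys[OF e(1)]] e(2) C_def)
  qed
  moreover have "int CARD('v) - int (m - 1) = h + 1"
    using m by linarith
  ultimately show ?thesis
    using e(1) by force
qed

section \<open>Exactness and augmentation\<close>

lemma scarf_complex_exact:
  fixes f :: "'a set \<Rightarrow>\<^sub>0 ('v, 'k::comm_ring_1) mpoly"
  assumes f: "f \<in> chains scarf_complex h" and h: "0 < h" and cycle: "boundary_map scarf_complex f = 0"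
  shows "f \<in> boundary_map scarf_complex ` chains scarf_complex (h + 1)"
proof (cases "h < int CARD('v)")
  case True
  show ?thesis
  proof (rule boundary_if_strandwise[OF f, where m = "nat (int CARD('v) - h)"])
    fix c
    assume c: "standard (threshold c)"
      "supported_on (strand c f) (interior_above (threshold c) (nat (int CARD('v) - h)))"
    have "scarf_coboundary (strand c f) = 0"
      using strand_boundary[OF chains_keys[OF f], of c] cycle by simp
    moreover have "nat (int CARD('v) - h) \<noteq> CARD('v)"
      using True h by linarith
    ultimately show "\<exists>\<psi>. supported_on \<psi> (interior_above (threshold c) (nat (int CARD('v) - h) - 1)) \<and>
        scarf_coboundary \<psi> = strand c f"
      using scarf_exact[OF c] by metis
  qed (use True in auto)
next
  case False
  \<comment> \<open>Only the empty face could occur in this degree, and its label is 1, not of full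
    support.\<close>
  have "\<sigma> \<notin> Poly_Mapping.keys f" for \<sigma>
  proof
    assume "\<sigma> \<in> Poly_Mapping.keys f"
    then have "\<sigma> \<in> interior" "card \<sigma> = 0"
      using f False by (auto simp: mem_scarf_chains_iff)
    then have "\<sigma> = {}"
      using finite_face[OF interior_subset] by auto
    then show False
      using \<open>\<sigma> \<in> interior\<close> by (simp add: interior_def lcm_label_def)
  qed
  then have "f = boundary_map scarf_complex 0"
    by (intro poly_mapping_eqI) (simp add: in_keys_iff)
  then show ?thesis
    using chains_0 by blast
qed

lemma scarf_complex_exact_0:
  fixes f :: "'a set \<Rightarrow>\<^sub>0 ('v, 'k::comm_ring_1) mpoly"
  assumes f: "f \<in> chains scarf_complex 0" and kernel: "augmentation_map augmentation f = 0"
  shows "f \<in> boundary_map scarf_complex ` chains scarf_complex 1"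
proof -
  have "f \<in> boundary_map scarf_complex ` chains scarf_complex (0 + 1)"
  proof (rule boundary_if_strandwise[OF f, where m = "CARD('v)"])
    fix c
    assume c: "standard (threshold c)"
      "supported_on (strand c f) (interior_above (threshold c) CARD('v))"
    have "pairing (strand c f) = 0"
      by (simp flip: lookup_augmentation_map[OF f] add: kernel)
    then show "\<exists>\<psi>. supported_on \<psi> (interior_above (threshold c) (CARD('v) - 1)) \<and>
        scarf_coboundary \<psi> = strand c f"
      using pairing_eq_0_imp_coboundary[OF c] by metis
  qed auto
  then show ?thesis
    by simp
qed

lemma augmentation_boundary:
  fixes f :: "'a set \<Rightarrow>\<^sub>0 ('v, 'k::comm_ring_1) mpoly"
  assumes f: "f \<in> chains scarf_complex 1"
  shows "augmentation_map augmentation (boundary_map scarf_complex f) = 0"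
proof (rule poly_mapping_eqI)
  fix c
  have Suc: "Suc (CARD('v) - 1) = CARD('v)"
    by simp
  then have "(1 :: int) = int CARD('v) - int (CARD('v) - 1)"
    by linarith
  then have "supported_on (strand c f) (interior_above (threshold c) (CARD('v) - 1))"
    using f by (intro strand_supported_on) simp
  then have "pairing (scarf_coboundary (strand c f)) = 0"
    using Suc by (rule pairing_scarf_coboundary)
  moreover have "boundary_map scarf_complex f \<in> chains scarf_complex 0"
    using boundary_in_chains[OF f] by simp
  ultimately show "Poly_Mapping.lookup (augmentation_map augmentation (boundary_map scarf_complex f)) c =
      Poly_Mapping.lookup 0 c"
    by (simp add: lookup_augmentation_map strand_boundary[OF chains_keys[OF f]])
qed

theorem scarf_complex_resolution:
  fixes M :: "('v, 'k::comm_ring_1) mpoly set"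
  assumes M: "\<And>p. p \<in> M \<longleftrightarrow> (\<forall>c\<in>Poly_Mapping.keys p. standard (threshold c))"
  shows "free_resolution scarf_complex augmentation M"
  unfolding free_resolution_def
proof (intro conjI ballI allI impI)
  let ?F = "scarf_complex :: ('v, 'k, 'a set) free_complex"
  show "multigraded_complex ?F"
    by (rule multigraded_scarf_complex)
  show "0 \<le> fc_hdeg ?F \<sigma>" if "\<sigma> \<in> fc_basis ?F" for \<sigma>
    using that card_scarf_le[of \<sigma>] by (auto simp: scarf_complex_def interior_def)
  show "finite {\<sigma> \<in> fc_basis ?F. fc_hdeg ?F \<sigma> = h}" for h
    using finite_interior by (simp add: scarf_complex_def)
  show "Poly_Mapping.keys (augmentation \<sigma> :: ('v, 'k) mpoly) \<subseteq> {fc_mdeg ?F \<sigma>}" for \<sigma>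
    by (simp add: augmentation_def scarf_complex_def)
  show "augmentation_map augmentation ` chains ?F 0 = M"
  proof (intro set_eqI iffI)
    fix p assume "p \<in> augmentation_map augmentation ` chains ?F 0"
    then obtain f where f: "f \<in> chains ?F 0" "p = augmentation_map augmentation f"
      by blast
    have "standard (threshold c)" if "c \<in> Poly_Mapping.keys p" for c
    proof -
      have "pairing (strand c f) \<noteq> 0"
        using that f by (simp add: in_keys_iff lookup_augmentation_map)
      then have "strand c f \<noteq> 0"
        by (auto simp: pairing_def)
      then obtain \<sigma> where "strand c f \<sigma> \<noteq> 0"
        by (auto simp: fun_eq_iff)
      then show ?thesis
        by (rule standard_if_strand_nonzero[OF f(1)])
    qed
    then show "p \<in> M"
      by (simp add: M)
  next
    fix p assume p: "p \<in> M"
    let ?n = "CARD('v)"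
    \<comment> \<open>For surjectivity, a class of pairing 1 in each multidegree of \<open>p\<close>
      is scaled by the coefficient of \<open>p\<close> there.\<close>
    have "\<exists>\<phi> :: 'a set \<Rightarrow> 'k. supported_on \<phi> (interior_above (threshold c) ?n) \<and> pairing \<phi> = 1"
      if "c \<in> Poly_Mapping.keys p" for c
      using that p ex_pairing_eq_1[where 'k = 'k, of "threshold c"] unfolding M by metis
    then obtain \<phi> where \<phi>: "\<And>c. c \<in> Poly_Mapping.keys p \<Longrightarrow>
        supported_on (\<phi> c :: 'a set \<Rightarrow> 'k) (interior_above (threshold c) ?n) \<and> pairing (\<phi> c) = 1"
      by metis
    define \<psi> where "\<psi> = (\<lambda>c \<sigma>. Poly_Mapping.lookup p c * \<phi> c \<sigma>)"
    have "supported_on (\<psi> c) (interior_above (threshold c) ?n)" if "c \<in> Poly_Mapping.keys p" for c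
      using \<phi>[OF that] by (auto simp: supported_on_def \<psi>_def)
    then obtain f where f: "f \<in> chains ?F (int CARD('v) - int ?n)"
      "\<And>c. strand c f = (if c \<in> Poly_Mapping.keys p then \<psi> c else 0)"
      using ex_chain_with_strands[of "Poly_Mapping.keys p" \<psi> ?n] by auto
    have f0: "f \<in> chains ?F 0"
      using f(1) by simp
    have "augmentation_map augmentation f = p"
    proof (rule poly_mapping_eqI)
      fix c
      have "pairing (strand c f) = Poly_Mapping.lookup p c"
      proof (cases "c \<in> Poly_Mapping.keys p")
        case True
        have "pairing (\<psi> c) = Poly_Mapping.lookup p c * pairing (\<phi> c)"
          by (simp add: pairing_def \<psi>_def sum_distrib_left mult.assoc)
        then show ?thesis
          using True \<phi> by (simp add: f(2))
      next
        case False
        then show ?thesis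
          by (simp add: f(2) pairing_def in_keys_iff)
      qed
      then show "Poly_Mapping.lookup (augmentation_map augmentation f) c = Poly_Mapping.lookup p c"
        by (simp add: lookup_augmentation_map[OF f0])
    qed
    then show "p \<in> augmentation_map augmentation ` chains ?F 0"
      using f0 by blast
  qed
  show "{f \<in> chains ?F 0. augmentation_map augmentation f = 0} = boundary_map ?F ` chains ?F 1"
  proof (intro set_eqI iffI)
    fix f assume "f \<in> boundary_map ?F ` chains ?F 1"
    then obtain e where "e \<in> chains ?F 1" "f = boundary_map ?F e"
      by blast
    then show "f \<in> {f \<in> chains ?F 0. augmentation_map augmentation f = 0}"
      using boundary_in_chains[of e 1] augmentation_boundary[of e] by simp
  qed (use scarf_complex_exact_0 in blast)
  show "{f \<in> chains ?F h. boundary_map ?F f = 0} = boundary_map ?F ` chains ?F (h + 1)"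
    if "0 < h" for h
  proof (intro set_eqI iffI)
    fix f assume "f \<in> boundary_map ?F ` chains ?F (h + 1)"
    then obtain e where "e \<in> chains ?F (h + 1)" "f = boundary_map ?F e"
      by blast
    then show "f \<in> {f \<in> chains ?F h. boundary_map ?F f = 0}"
      using boundary_in_chains[of e "h + 1"] boundary_boundary[of e "h + 1"] by simp
  qed (use scarf_complex_exact that in blast)
qed

end

text \<open>A facet is interior by \<open>boundary_face_not_facet\<close>. Nothing can be added to
  it, so its differential is zero, and minimality of the resolution puts it in degree zero. The
  converse is the bound on the size of Scarf faces.\<close>

lemma (in bounded_generic_labels) facets_scarf:
  fixes M :: "('v, 'k::comm_ring_1) mpoly set"
  assumes res: "free_resolution scarf_complex \<epsilon> M"
  shows "facets scarf = {\<sigma> \<in> interior. card \<sigma> = CARD('v)}"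
proof (intro set_eqI iffI)
  let ?F = "scarf_complex :: ('v, 'k, 'a set) free_complex"
  fix \<sigma> assume "\<sigma> \<in> facets scarf"
  then have \<sigma>: "\<sigma> \<in> scarf" and max: "\<And>\<tau>. \<tau> \<in> scarf \<Longrightarrow> \<not> \<sigma> \<subset> \<tau>"
    by (auto simp: facets_def)
  have not_ext: "insert i \<sigma> \<notin> scarf" if "i \<notin> \<sigma>" for i
    using max[of "insert i \<sigma>"] that by blast
  have int: "\<sigma> \<in> interior"
  proof (rule ccontr)
    assume "\<sigma> \<notin> interior"
    then obtain s where "lab \<sigma> s = 0"
      using \<sigma> by (auto simp: interior_def)
    then show False
      using boundary_face_not_facet[OF \<sigma>] not_ext by blast
  qed
  have no_i: "{i. i \<notin> \<sigma> \<and> insert i \<sigma> \<in> interior} = {}"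
    using not_ext by (auto simp: interior_def)
  have "fc_diff ?F \<sigma> = 0"
    unfolding scarf_complex_def free_complex.select_convs scarf_diff_def no_i by simp
  moreover have "\<sigma> \<in> fc_basis ?F"
    using int by (simp add: scarf_complex_def)
  ultimately have "fc_hdeg ?F \<sigma> = 0"
    by (intro minimal_resolution_diff_eq_0[OF minimal_scarf_complex res])
  then show "\<sigma> \<in> {\<sigma> \<in> interior. card \<sigma> = CARD('v)}"
    using int by (simp add: scarf_complex_def)
next
  fix \<sigma> assume \<sigma>: "\<sigma> \<in> {\<sigma> \<in> interior. card \<sigma> = CARD('v)}"
  have "\<not> \<sigma> \<subset> \<tau>" if "\<tau> \<in> scarf" for \<tau>
    using psubset_card_mono[OF finite_face[OF scarf_subset[OF that]], of \<sigma>] card_scarf_le[OF that] \<sigma>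
    by auto
  then show "\<sigma> \<in> facets scarf"
    using \<sigma> by (auto simp: facets_def interior_def)
qed

section \<open>Cogeneric ideals\<close>

lemma gen_indices_iff:
  "v \<in> gen_indices TYPE('k::comm_ring_1) D r b \<longleftrightarrow> v \<in> Inl ` {1..r} \<union> range Inr \<and>
    (\<forall>v'\<in>Inl ` {1..r} \<union> range Inr. gen_exp D b v' \<le> gen_exp D b v \<longrightarrow> gen_exp D b v' = gen_exp D b v)"
  unfolding gen_indices_def dual_star_ideal_def min_gens_ideal_gen_monom by auto

lemma ex_gen_index_le:
  fixes b :: "nat \<Rightarrow> 'v::finite expo"
  assumes "v \<in> Inl ` {1..r} \<union> range Inr"
  obtains v' where "v' \<in> gen_indices TYPE('k::comm_ring_1) D r b" "gen_exp D b v' \<le> gen_exp D b v"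
proof -
  have "gen_exp D b v \<in> gen_exp D b ` (Inl ` {1..r} \<union> range Inr)"
    using assms by (rule imageI)
  then obtain u where u: "u \<in> gen_exp D b ` (Inl ` {1..r} \<union> range Inr)" "u \<le> gen_exp D b v"
    "\<And>u'. u' \<in> gen_exp D b ` (Inl ` {1..r} \<union> range Inr) \<Longrightarrow> u' \<le> u \<Longrightarrow> u' = u"
    by (rule ex_minimal_expo_le) blast
  from u(1) obtain v' where "v' \<in> Inl ` {1..r} \<union> range Inr" "u = gen_exp D b v'"
    by (rule imageE)
  then show ?thesis
    using u(2,3) by (intro that[of v']) (simp_all only: gen_indices_iff, blast)
qed

text \<open>Complementation by \<open>D\<close> reverses strict inequalities between positive
  exponents of components, so the condition on components becomes genericity of the dual
  generators.\<close>

lemma cogeneric_imp_generic: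
  fixes M :: "('v::finite, 'k::comm_ring_1) mpoly set"
  assumes cog: "cogeneric M" and dec: "irreducible_decomposition M r b"
    and D: "\<forall>u\<in>min_gens M. \<forall>s. u s < D"
    and i: "i \<in> gen_indices TYPE('k) D r b" and j: "j \<in> gen_indices TYPE('k) D r b" and "i \<noteq> j"
    and tie: "gen_exp D b i t = gen_exp D b j t" "0 < gen_exp D b i t"
  obtains l where "l \<in> gen_indices TYPE('k) D r b"
    "\<And>s. gen_exp D b l s < max (gen_exp D b i s) (gen_exp D b j s) \<or> gen_exp D b l s = 0"
proof -
  have less_D: "b i s < D" if "i \<in> {1..r}" "1 \<le> b i s" for i s
    using decomposition_exponent_less[OF dec that] D by blast
  \<comment> \<open>Exponents of dual generators stay below \<open>D\<close> when \<open>D\<close>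
    is positive, so a tie that involves a pure power would force both indices to be
    \<open>Inr t\<close>.\<close>
  have eq_D: "v = Inr t" if "gen_exp D b v t = D" "0 < D" for v
    using that by (cases v) (auto simp: dual_exp_def var_pow_def split: if_splits)
  have "\<exists>i'. v = Inl i' \<and> i' \<in> {1..r}"
    if v: "v = i \<or> v = j" for v
  proof (cases v)
    case (Inl i')
    then show ?thesis
      using v i j by (auto simp: gen_indices_iff)
  next
    case (Inr s)
    have pos: "0 < gen_exp D b v t"
      using v tie by auto
    then have "gen_exp D b v t = D" "0 < D"
      using Inr by (auto simp: var_pow_def split: if_splits)
    then have "gen_exp D b i t = D" "gen_exp D b j t = D"
      using v tie(1) by auto
    then show ?thesis
      using eq_D[of i] eq_D[of j] \<open>0 < D\<close> \<open>i \<noteq> j\<close> by simp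
  qed
  then obtain i' j' where ij: "i = Inl i'" "j = Inl j'" "i' \<in> {1..r}" "j' \<in> {1..r}"
    by metis
  have pos: "1 \<le> b i' t" "1 \<le> b j' t" and "D - b i' t = D - b j' t"
    using tie unfolding ij by (auto simp: dual_exp_def split: if_splits)
  then have "b i' t = b j' t"
    using less_D[OF ij(3) pos(1)] less_D[OF ij(4) pos(2)] by linarith
  moreover have "b i' \<noteq> b j'"
    using decomposition_inj_on[OF dec] ij \<open>i \<noteq> j\<close> by (auto dest: inj_onD)
  ultimately obtain l where l: "l \<in> {1..r}"
    "\<And>s. 1 \<le> b l s \<Longrightarrow> 1 \<le> b i' s \<and> b i' s < b l s \<or> 1 \<le> b j' s \<and> b j' s < b l s"
    using cogeneric_decompositionD[OF cog dec ij(3,4)] pos(1) by metis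
  have strict: "dual_exp D (b l) s < max (dual_exp D (b i') s) (dual_exp D (b j') s) \<or>
      dual_exp D (b l) s = 0" for s
    using l(2)[of s] less_D[OF l(1), of s]
    by (cases "1 \<le> b l s") (auto simp: dual_exp_def less_max_iff_disj)
  \<comment> \<open>The generator of \<open>l\<close> need not be minimal; passing to a minimal one
    that divides it preserves the inequalities.\<close>
  obtain l' where l': "l' \<in> gen_indices TYPE('k) D r b" "gen_exp D b l' \<le> gen_exp D b (Inl l)"
    using ex_gen_index_le[of "Inl l" r] l(1) by blast
  have le: "gen_exp D b l' s \<le> dual_exp D (b l) s" for s
    using l'(2) by (simp add: le_fun_def)
  show ?thesis
  proof (rule that[OF l'(1)])
    fix s
    show "gen_exp D b l' s < max (gen_exp D b i s) (gen_exp D b j s) \<or> gen_exp D b l' s = 0"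
      using strict[of s] le[of s] unfolding ij gen_exp.simps by linarith
  qed
qed

text \<open>This is Alexander duality.  If \<open>c s\<close> exceeds \<open>D\<close>, the complementary exponent is truncated to
  \<open>0\<close>.\<close>

lemma monom_mem_iff_dual:
  fixes M :: "('v::finite, 'k::comm_ring_1) mpoly set"
  assumes dec: "irreducible_decomposition M r b" and D: "\<forall>u\<in>min_gens M. \<forall>s. u s < D"
  shows "(monom c :: ('v, 'k) mpoly) \<in> M \<longleftrightarrow>
    (\<forall>v\<in>gen_indices TYPE('k) D r b. \<exists>s. D - (c s + 1) < gen_exp D b v s)"
proof
  assume c: "(monom c :: ('v, 'k) mpoly) \<in> M"
  then obtain u where "u \<in> min_gens M"
    by (rule ex_min_gens_le)
  then have "u s < D" for s
    using D by blast
  \<comment> \<open>For \<open>M = 0\<close> the bound on \<open>D\<close> is vacuous and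
    \<open>D\<close> may be 0; a monomial in \<open>M\<close> rules this out.\<close>
  then have D_pos: "0 < D"
    by (rule le_less_trans[OF le0])
  show "\<forall>v\<in>gen_indices TYPE('k) D r b. \<exists>s. D - (c s + 1) < gen_exp D b v s"
  proof
    fix v assume v: "v \<in> gen_indices TYPE('k) D r b"
    show "\<exists>s. D - (c s + 1) < gen_exp D b v s"
    proof (cases v)
      case (Inl i)
      then have "i \<in> {1..r}"
        using v by (auto simp: gen_indices_iff)
      then obtain s where s: "1 \<le> b i s" "b i s \<le> c s"
        using c unfolding monom_mem_decomposition_iff[OF dec] by blast
      have "b i s < D"
        using decomposition_exponent_less[OF dec \<open>i \<in> {1..r}\<close> s(1)] D by blast
      then show ?thesis
        using s Inl by (intro exI[of _ s]) (auto simp: dual_exp_def)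
    next
      case (Inr s)
      then show ?thesis
        using D_pos by (intro exI[of _ s]) (simp add: var_pow_def)
    qed
  qed
next
  assume *: "\<forall>v\<in>gen_indices TYPE('k) D r b. \<exists>s. D - (c s + 1) < gen_exp D b v s"
  show "(monom c :: ('v, 'k) mpoly) \<in> M"
    unfolding monom_mem_decomposition_iff[OF dec]
  proof
    fix i assume i: "i \<in> {1..r}"
    obtain v where v: "v \<in> gen_indices TYPE('k) D r b" "gen_exp D b v \<le> gen_exp D b (Inl i)"
      using ex_gen_index_le[of "Inl i" r] i by blast
    then obtain s where "D - (c s + 1) < gen_exp D b v s"
      using * by blast
    also have "\<dots> \<le> dual_exp D (b i) s"
      using v(2) by (simp add: le_fun_def)
    finally show "\<exists>s. 1 \<le> b i s \<and> b i s \<le> c s"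
      by (intro exI[of _ s]) (auto simp: dual_exp_def split: if_splits)
  qed
qed

lemma cogeneric_imp_bounded_generic_labels:
  fixes M :: "('v::finite, 'k::comm_ring_1) mpoly set"
  assumes cog: "cogeneric M" and dec: "irreducible_decomposition M r b"
    and D: "\<forall>u\<in>min_gens M. \<forall>s. u s < D"
    and R: "linear_order_on (gen_indices TYPE('k) D r b) R"
  shows "bounded_generic_labels (gen_indices TYPE('k) D r b) R (gen_exp D b) D"
proof
  show "finite (gen_indices TYPE('k) D r b)"
    by (rule finite_subset[of _ "Inl ` {1..r} \<union> range Inr"]) (auto simp: gen_indices_iff)
  show "linear_order_on (gen_indices TYPE('k) D r b) R"
    by (rule R)
  show "\<exists>v\<in>gen_indices TYPE('k) D r b. \<forall>t. t \<noteq> s \<longrightarrow> gen_exp D b v t = 0" for s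
  proof -
    \<comment> \<open>If the power of \<open>s\<close> with exponent \<open>D\<close> is not
      minimal, a minimal generator that divides it is again a power of \<open>s\<close>.\<close>
    obtain v where v: "v \<in> gen_indices TYPE('k) D r b" "gen_exp D b v \<le> gen_exp D b (Inr s)"
      using ex_gen_index_le[of "Inr s" r] by blast
    have "gen_exp D b v t \<le> var_pow s D t" for t
      using v(2) by (simp add: le_fun_def)
    then have "gen_exp D b v t = 0" if "t \<noteq> s" for t
      using that by (metis var_pow_def le_zero_eq)
    then show ?thesis
      using v(1) by blast
  qed
  show "\<exists>l\<in>gen_indices TYPE('k) D r b.
      \<forall>s. gen_exp D b l s < max (gen_exp D b i s) (gen_exp D b j s) \<or> gen_exp D b l s = 0"
    if "i \<in> gen_indices TYPE('k) D r b" "j \<in> gen_indices TYPE('k) D r b" "i \<noteq> j"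
      "gen_exp D b i t = gen_exp D b j t" "0 < gen_exp D b i t" for i j t
    using cogeneric_imp_generic[OF cog dec D that] by blast
  show "gen_exp D b v s \<le> D" for v s
    by (cases v) (auto simp: dual_exp_def var_pow_def)
qed

theorem theorem4p6:
  fixes M :: "('v::finite, 'k::field) mpoly set"
    and r D :: nat
    and b :: "nat \<Rightarrow> 'v expo"
    and R :: "(nat + 'v) rel"
  assumes "cogeneric M"
    and "irreducible_decomposition M r b"
    and "\<forall>u\<in>min_gens M. \<forall>s. u s < D"
    and "linear_order_on (gen_indices TYPE('k) D r b) R"
  shows "minimal_free_resolution
           (algebraic_co_scarf D r b R :: ('v, 'k, (nat + 'v) set) free_complex) M \<and>
         minimally_generated_by M
           {monom (\<lambda>s. D - lcm_exp D b \<sigma> s) | \<sigma>. \<sigma> \<in> facets (co_scarf TYPE('k) D r b)}"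
proof -
  interpret bounded_generic_labels "gen_indices TYPE('k) D r b" R "gen_exp D b" D
    by (rule cogeneric_imp_bounded_generic_labels[OF assms])
  let ?F = "scarf_complex :: ('v, 'k, (nat + 'v) set) free_complex"
  have lcm: "lcm_exp D b = lcm_label (gen_exp D b)"
    by (simp add: fun_eq_iff lcm_exp_def lcm_label_def)
  have scarf: "co_scarf TYPE('k) D r b = scarf"
    unfolding co_scarf_def scarf_def lcm ..
  have interior: "interior_faces TYPE('k) D r b = interior"
    unfolding interior_faces_def interior_def scarf lcm
    by (simp only: monom_dvd_monom_iff var_pow_le_iff Suc_le_eq One_nat_def)
  have complex: "algebraic_co_scarf D r b R = ?F"
    by (simp add: algebraic_co_scarf_def scarf_complex_def fun_eq_iff mdeg_def interior lcm
        co_scarf_diff_def scarf_diff_def)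
  \<comment> \<open>Alexander duality, applied to each term, describes the multidegrees of
    \<open>M\<close> by standard thresholds.\<close>
  have "p \<in> M \<longleftrightarrow> (\<forall>c\<in>Poly_Mapping.keys p. standard (threshold c))" for p
  proof -
    have "p \<in> M \<longleftrightarrow> (\<forall>c\<in>Poly_Mapping.keys p. (monom c :: ('v, 'k) mpoly) \<in> M)"
      unfolding monom_mem_decomposition_iff[OF assms(2)] by (rule mem_decomposition_iff[OF assms(2)])
    then show ?thesis
      by (simp add: monom_mem_iff_dual[OF assms(2,3)] standard_def threshold_def)
  qed
  then have res: "free_resolution scarf_complex augmentation M"
    by (rule scarf_complex_resolution)
  then have "minimal_free_resolution scarf_complex M"
    using minimal_scarf_complex by (auto simp: minimal_free_resolution_def)
  moreover have "{monom (\<lambda>s. D - lcm_exp D b \<sigma> s) | \<sigma>. \<sigma> \<in> facets (co_scarf TYPE('k) D r b)} =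
      ({monom (fc_mdeg ?F \<sigma>) | \<sigma>. \<sigma> \<in> fc_basis ?F \<and> fc_hdeg ?F \<sigma> = 0} :: ('v, 'k) mpoly set)"
    unfolding scarf facets_scarf[OF res] by (auto simp: scarf_complex_def mdeg_def lcm)
  ultimately show ?thesis
    using minimal_resolution_imp_minimally_generated[OF minimal_scarf_complex res]
    unfolding complex by simp
qed

end
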